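(* A finite regular semigroup $S$ is homogeneous (as a semigroup) if and only if there exist a finite homogeneous group $G$ and a characteristic subgroup $H$ of $G$ such that, up to isomorphism, one of the following holds: (1) $S=G\times B$ for some finite rectangular band $B$; (2) $S=\mathcal{M}[G;\underline{2},\underline{2};P_1]$, where $P_1$ is normalised, $H=\{\epsilon,a\}\cong\mathbb{Z}_2$ and $P_1'=(a)$; (3) $S=\mathcal{M}[G;\underline{3},\underline{3};P_2]$, where $P_2$ is normalised, $H=\{\epsilon,a,a^{-1}\}\cong\mathbb{Z}_3$ and $\Gamma(S)$ is $\{a,a^{-1}\}$-edge-coloured, with the edges of colour $a$ forming a perfect matching; (4) $S=\mathcal{M}[G;\underline{4},\underline{4};P_3]$, where $P_3$ is normalised, $H=\{\epsilon,a\}\cong\mathbb{Z}_2$ and $\Gamma(S)$ is $\{\epsilon,a\}$-edge-coloured, with the edges of colour $\epsilon$ forming a perfect matching.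
   Context: Semigroups are non-empty. A semigroup $S$ is regular if for each $x\in S$ there is $y\in S$ with $x=xyx$. A semigroup is homogeneous (as a semigroup) if every isomorphism between finitely generated subsemigroups extends to an automorphism. A group is homogeneous if every isomorphism between finitely generated subgroups extends to an automorphism. A subgroup is characteristic if it is preserved by all automorphisms. $\epsilon$ is the identity of $G$. A rectangular band is a semigroup $I\times\Lambda$ ($I,\Lambda$ non-empty sets) with $(i,\lambda)(j,\mu)=(i,\mu)$. For a group $G$, non-empty sets $I,\Lambda$ and a $\Lambda\times I$ matrix $P=(p_{\lambda,i})$ over $G$, the Rees matrix semigroup $\mathcal{M}[G;I,\Lambda;P]$ is $I\times G\times\Lambda$ with $(i,g,\lambda)(j,h,\mu)=(i,g\,p_{\lambda,j}h,\mu)$. $P$ is normalised if there are distinguished $1_I\in I$, $1_\Lambda\in\Lambda$ with $p_{1_\Lambda,i}=\epsilon=p_{\lambda,1_I}$ for all $i,\lambda$. $P'$ is the $(\Lambda\setminus\{1_\Lambda\})\times(I\setminus\{1_I\})$ submatrix of $P$. $\underline{n}$ denotes an $n$-element index set. $\Gamma(S)$ is the edge-coloured complete bipartite graph with left set $\Lambda\setminus\{1_\Lambda\}$, right set $I\setminus\{1_I\}$, in which the edge $(\lambda,i)$ has colour $p_{\lambda,i}$. A set of edges forms a perfect matching if each vertex is incident to exactly one of them. *)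

theory Defs
  imports "HOL-Algebra.Algebra"
begin

text \<open>
  A semigroup is represented by a monoid record whose \<open>one\<close> field carries no meaning.
  The notions \<open>hom\<close>, \<open>iso\<close>, \<open>\<cong>\<close> and the carrier and multiplication of \<open>\<times>\<times>\<close> never refer to
  \<open>one\<close>, so they are the right notions for semigroups as well.
\<close>

locale alg_semigroup =
  fixes S (structure)
  assumes nonempty: "carrier S \<noteq> {}"
    and m_closed: "\<lbrakk>x \<in> carrier S; y \<in> carrier S\<rbrakk> \<Longrightarrow> x \<otimes> y \<in> carrier S"
    and m_assoc: "\<lbrakk>x \<in> carrier S; y \<in> carrier S; z \<in> carrier S\<rbrakk>
                    \<Longrightarrow> (x \<otimes> y) \<otimes> z = x \<otimes> (y \<otimes> z)"

definition regular_semigroup :: "('a, 'm) monoid_scheme \<Rightarrow> bool" where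
  "regular_semigroup S \<longleftrightarrow>
     alg_semigroup S \<and>
     (\<forall>x \<in> carrier S. \<exists>y \<in> carrier S. x = x \<otimes>\<^bsub>S\<^esub> y \<otimes>\<^bsub>S\<^esub> x)"

definition subsemigroup :: "'a set \<Rightarrow> ('a, 'm) monoid_scheme \<Rightarrow> bool" where
  "subsemigroup A S \<longleftrightarrow>
     A \<noteq> {} \<and> A \<subseteq> carrier S \<and> (\<forall>x \<in> A. \<forall>y \<in> A. x \<otimes>\<^bsub>S\<^esub> y \<in> A)"

text \<open>The generating set is non-empty because semigroups are.\<close>

definition fg_subsemigroup :: "'a set \<Rightarrow> ('a, 'm) monoid_scheme \<Rightarrow> bool" where
  "fg_subsemigroup A S \<longleftrightarrow>
     (\<exists>Y. finite Y \<and> Y \<noteq> {} \<and> Y \<subseteq> carrier S \<and> A = (\<lambda>T. subsemigroup T S) hull Y)"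

definition homogeneous_semigroup :: "('a, 'm) monoid_scheme \<Rightarrow> bool" where
  "homogeneous_semigroup S \<longleftrightarrow>
     alg_semigroup S \<and>
     (\<forall>A B. fg_subsemigroup A S \<longrightarrow> fg_subsemigroup B S \<longrightarrow>
        (\<forall>\<phi> \<in> iso (S\<lparr>carrier := A\<rparr>) (S\<lparr>carrier := B\<rparr>).
           \<exists>\<theta> \<in> iso S S. \<forall>x \<in> A. \<theta> x = \<phi> x))"

definition fg_subgroup :: "'a set \<Rightarrow> ('a, 'm) monoid_scheme \<Rightarrow> bool" where
  "fg_subgroup A G \<longleftrightarrow> (\<exists>Y. finite Y \<and> Y \<subseteq> carrier G \<and> A = generate G Y)"

definition homogeneous_group :: "('a, 'm) monoid_scheme \<Rightarrow> bool" where
  "homogeneous_group G \<longleftrightarrow>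
     group G \<and>
     (\<forall>A B. fg_subgroup A G \<longrightarrow> fg_subgroup B G \<longrightarrow>
        (\<forall>\<phi> \<in> iso (G\<lparr>carrier := A\<rparr>) (G\<lparr>carrier := B\<rparr>).
           \<exists>\<theta> \<in> iso G G. \<forall>x \<in> A. \<theta> x = \<phi> x))"

definition characteristic_subgroup :: "'a set \<Rightarrow> ('a, 'm) monoid_scheme \<Rightarrow> bool" where
  "characteristic_subgroup H G \<longleftrightarrow> subgroup H G \<and> (\<forall>\<theta> \<in> iso G G. \<theta> ` H = H)"

definition rectangular_band :: "'i set \<Rightarrow> 'l set \<Rightarrow> ('i \<times> 'l) monoid" where
  "rectangular_band I L =
     \<lparr>carrier = I \<times> L, monoid.mult = (\<lambda>(i, l) (j, m). (i, m)), one = undefined\<rparr>"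

text \<open>
  A \<open>\<Lambda> \<times> I\<close> matrix over \<open>G\<close> is a function \<open>P\<close>, with \<open>P l i\<close> the entry in row \<open>l\<close>, column \<open>i\<close>;
  only its values on \<open>\<Lambda> \<times> I\<close> are relevant.
\<close>

definition rees_matrix_semigroup ::
  "('g, 'm) monoid_scheme \<Rightarrow> 'i set \<Rightarrow> 'l set \<Rightarrow> ('l \<Rightarrow> 'i \<Rightarrow> 'g) \<Rightarrow> ('i \<times> 'g \<times> 'l) monoid" where
  "rees_matrix_semigroup G I L P =
     \<lparr>carrier = I \<times> carrier G \<times> L,
      monoid.mult = (\<lambda>(i, g, l) (j, h, m). (i, g \<otimes>\<^bsub>G\<^esub> P l j \<otimes>\<^bsub>G\<^esub> h, m)),
      one = undefined\<rparr>"

definition matrix_over ::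
  "('g, 'm) monoid_scheme \<Rightarrow> 'i set \<Rightarrow> 'l set \<Rightarrow> ('l \<Rightarrow> 'i \<Rightarrow> 'g) \<Rightarrow> bool" where
  "matrix_over G I L P \<longleftrightarrow> (\<forall>l \<in> L. \<forall>i \<in> I. P l i \<in> carrier G)"

text \<open>Here \<open>i1\<close> and \<open>l1\<close> are the distinguished elements \<open>1\<^sub>I\<close> and \<open>1\<^sub>\<Lambda>\<close>.\<close>

definition normalised_matrix ::
  "('g, 'm) monoid_scheme \<Rightarrow> 'i set \<Rightarrow> 'l set \<Rightarrow> 'i \<Rightarrow> 'l \<Rightarrow> ('l \<Rightarrow> 'i \<Rightarrow> 'g) \<Rightarrow> bool" where
  "normalised_matrix G I L i1 l1 P \<longleftrightarrow>
     matrix_over G I L P \<and> i1 \<in> I \<and> l1 \<in> L \<and>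
     (\<forall>i \<in> I. P l1 i = \<one>\<^bsub>G\<^esub>) \<and> (\<forall>l \<in> L. P l i1 = \<one>\<^bsub>G\<^esub>)"

text \<open>
  Edge-coloured complete bipartite graphs. An edge is a pair of a left and a right vertex, so
  the two sides count as disjoint even if they share elements.
\<close>

record ('l, 'r, 'c) coloured_bipartite =
  left_vertices :: "'l set"
  right_vertices :: "'r set"
  colour :: "'l \<times> 'r \<Rightarrow> 'c"

definition edges :: "('l, 'r, 'c) coloured_bipartite \<Rightarrow> ('l \<times> 'r) set" where
  "edges \<Gamma> = left_vertices \<Gamma> \<times> right_vertices \<Gamma>"

definition edge_coloured_by :: "('l, 'r, 'c) coloured_bipartite \<Rightarrow> 'c set \<Rightarrow> bool" where
  "edge_coloured_by \<Gamma> C \<longleftrightarrow> (\<forall>e \<in> edges \<Gamma>. colour \<Gamma> e \<in> C)"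

definition edges_of_colour :: "('l, 'r, 'c) coloured_bipartite \<Rightarrow> 'c \<Rightarrow> ('l \<times> 'r) set" where
  "edges_of_colour \<Gamma> c = {e \<in> edges \<Gamma>. colour \<Gamma> e = c}"

definition perfect_matching :: "('l, 'r, 'c) coloured_bipartite \<Rightarrow> ('l \<times> 'r) set \<Rightarrow> bool" where
  "perfect_matching \<Gamma> M \<longleftrightarrow>
     M \<subseteq> edges \<Gamma> \<and>
     (\<forall>u \<in> left_vertices \<Gamma>. \<exists>!e. e \<in> M \<and> fst e = u) \<and>
     (\<forall>v \<in> right_vertices \<Gamma>. \<exists>!e. e \<in> M \<and> snd e = v)"

definition sandwich_graph ::
  "'i set \<Rightarrow> 'l set \<Rightarrow> 'i \<Rightarrow> 'l \<Rightarrow> ('l \<Rightarrow> 'i \<Rightarrow> 'g) \<Rightarrow> ('l, 'i, 'g) coloured_bipartite" where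
  "sandwich_graph I L i1 l1 P =
     \<lparr>left_vertices = L - {l1}, right_vertices = I - {i1}, colour = (\<lambda>(l, i). P l i)\<rparr>"

end

theory Submission
  imports Defs
begin

text \<open>
  All idempotents of a homogeneous semigroup \<open>S\<close> are conjugate under automorphisms, so if \<open>S\<close> is finite
  then no idempotent lies strictly below another one; a regular \<open>S\<close> is then a Rees matrix
  semigroup, with a sandwich matrix \<open>P\<close> normalised at an idempotent. Extending the automorphisms
  of \<open>G \<times> \<Lambda>\<close> and \<open>I \<times> G\<close> which permute \<open>\<Lambda>\<close> or \<open>I\<close> shows that every permutation of the rows of \<open>P\<close>
  is undone by one of the columns, up to renormalisation, and vice versa. If \<open>P\<close> is not trivial then
  its rows are distinct and so are its columns; counting the images of one column under
  transpositions gives \<open>card I = card \<Lambda>\<close> and shows that \<open>P'\<close> has one entry \<open>b\<close> in each row and column and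
  a constant \<open>a\<close> elsewhere. Comparing a row with its renormalisations leaves only the character tables
  of \<open>\<int>\<^sub>2\<close>, \<open>\<int>\<^sub>3\<close> and \<open>\<int>\<^sub>2 \<times> \<int>\<^sub>2\<close>.

  Conversely, for these matrices translations of the character group act transitively on the
  idempotents, so it is enough to extend an isomorphism that fixes the base idempotent. It amounts
  to a partial isomorphism of \<open>G\<close>, which extends by homogeneity of \<open>G\<close>, and to partial injections of
  \<open>I\<close> and \<open>\<Lambda>\<close> which preserve the matching and therefore have a common extension to a permutation.
\<close>

section \<open>Isomorphisms and homogeneity of semigroups\<close>

text \<open>Normalisation gives the extension property its force: column \<open>i1\<close> is
  trivial, so \<open>{i1} \<times> G \<times> L\<close> is the direct product of \<open>G\<close>
  with a right zero band, and every automorphism of \<open>G\<close> combined with any permutation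
  of \<open>L\<close> is an automorphism of it. Extending such a map produces a permutation of the
  columns, hence equations between entries of \<open>P\<close>. The bound 4 on the size comes from
  comparing multisets. If \<open>P'\<close> has \<open>n\<close> rows, a row consists of one
  \<open>b\<close> and \<open>n - 1\<close> times \<open>a\<close>, the quotient of two rows of one
  \<open>b/a\<close>, one \<open>a/b\<close> and \<open>n - 2\<close> times the identity. For
  \<open>a \<noteq> b\<close> these can agree only if \<open>n\<close> is 2 or 3; for
  \<open>n = 1\<close> there is no second row, and \<open>b\<close> is its own inverse. The subgroup
  \<open>H\<close> is the set of entries of \<open>P\<close>: an automorphism of \<open>G\<close>
  combined with the identity on the rows permutes the columns and so preserves this set. In the
  converse, the decisive property of the three tables is that the product of two rows is again a
  row; this supplies the automorphisms that move any idempotent to the base.\<close>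

lemma iso_restrict_iff:
  assumes "subsemigroup A S" and "subsemigroup B S"
  shows "\<phi> \<in> iso (S\<lparr>carrier := A\<rparr>) (S\<lparr>carrier := B\<rparr>) \<longleftrightarrow>
    bij_betw \<phi> A B \<and> (\<forall>x\<in>A. \<forall>y\<in>A. \<phi> (x \<otimes>\<^bsub>S\<^esub> y) = \<phi> x \<otimes>\<^bsub>S\<^esub> \<phi> y)"
  by (auto simp: iso_def hom_def bij_betw_def)

lemma iso_mult:
  assumes "\<phi> \<in> iso S T" "x \<in> carrier S" "y \<in> carrier S"
  shows "\<phi> (x \<otimes>\<^bsub>S\<^esub> y) = \<phi> x \<otimes>\<^bsub>T\<^esub> \<phi> y"
  using assms by (simp add: iso_def hom_def)

lemma iso_bij_betw: "\<phi> \<in> iso S T \<Longrightarrow> bij_betw \<phi> (carrier S) (carrier T)"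
  by (simp add: iso_def)

lemma iso_in_carrier: "\<phi> \<in> iso S T \<Longrightarrow> x \<in> carrier S \<Longrightarrow> \<phi> x \<in> carrier T"
  using iso_bij_betw bij_betwE by blast

lemma (in alg_semigroup) fg_subsemigroup_iff:
  assumes "finite (carrier S)"
  shows "fg_subsemigroup A S \<longleftrightarrow> subsemigroup A S"
proof
  assume "fg_subsemigroup A S"
  then obtain Y where Y: "Y \<noteq> {}" "Y \<subseteq> carrier S" "A = (\<lambda>T. subsemigroup T S) hull Y"
    by (auto simp: fg_subsemigroup_def)
  have "subsemigroup (carrier S) S"
    using nonempty by (auto simp: subsemigroup_def m_closed)
  with Y have "A \<subseteq> carrier S"
    by (metis hull_minimal)
  moreover have "A \<noteq> {}"
    using Y hull_subset by fastforce
  moreover have "x \<otimes> y \<in> A" if "x \<in> A" "y \<in> A" for x y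
    using that unfolding Y(3) hull_def by (auto simp: subsemigroup_def)
  ultimately show "subsemigroup A S"
    by (auto simp: subsemigroup_def)
next
  assume A: "subsemigroup A S"
  then have "A = (\<lambda>T. subsemigroup T S) hull A"
    by (simp add: hull_same)
  with A show "fg_subsemigroup A S"
    unfolding fg_subsemigroup_def using assms finite_subset[of A "carrier S"]
    by (intro exI[of _ A]) (auto simp: subsemigroup_def)
qed

lemma homogeneous_semigroupI:
  assumes "alg_semigroup S" "finite (carrier S)"
    and "\<And>A B \<phi>. \<lbrakk>subsemigroup A S; subsemigroup B S; bij_betw \<phi> A B;
           \<And>x y. x \<in> A \<Longrightarrow> y \<in> A \<Longrightarrow> \<phi> (x \<otimes>\<^bsub>S\<^esub> y) = \<phi> x \<otimes>\<^bsub>S\<^esub> \<phi> y\<rbrakk>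
         \<Longrightarrow> \<exists>\<theta>\<in>iso S S. \<forall>x\<in>A. \<theta> x = \<phi> x"
  shows "homogeneous_semigroup S"
  unfolding homogeneous_semigroup_def alg_semigroup.fg_subsemigroup_iff[OF assms(1,2)]
proof (intro conjI allI impI ballI assms(1))
  fix A B \<phi>
  assume "subsemigroup A S" "subsemigroup B S"
    "\<phi> \<in> iso (S\<lparr>carrier := A\<rparr>) (S\<lparr>carrier := B\<rparr>)"
  then show "\<exists>\<theta>\<in>iso S S. \<forall>x\<in>A. \<theta> x = \<phi> x"
    by (intro assms(3)[of A B]) (simp_all add: iso_restrict_iff)
qed

lemma homogeneous_semigroup_extend:
  assumes "homogeneous_semigroup S" "finite (carrier S)"
    and "subsemigroup A S" "subsemigroup B S" "bij_betw \<phi> A B"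
    and "\<And>x y. x \<in> A \<Longrightarrow> y \<in> A \<Longrightarrow> \<phi> (x \<otimes>\<^bsub>S\<^esub> y) = \<phi> x \<otimes>\<^bsub>S\<^esub> \<phi> y"
  obtains \<theta> where "\<theta> \<in> iso S S" "\<And>x. x \<in> A \<Longrightarrow> \<theta> x = \<phi> x"
proof -
  have S: "alg_semigroup S"
    using assms(1) by (simp add: homogeneous_semigroup_def)
  have "\<phi> \<in> iso (S\<lparr>carrier := A\<rparr>) (S\<lparr>carrier := B\<rparr>)"
    using assms by (simp add: iso_restrict_iff)
  then show ?thesis
    using that assms(1,3,4)
    unfolding homogeneous_semigroup_def alg_semigroup.fg_subsemigroup_iff[OF S assms(2)]
    by blast
qed

section \<open>Transport along isomorphisms\<close>

lemma (in alg_semigroup) inv_into_iso: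
  assumes "\<phi> \<in> iso S T"
  shows "inv_into (carrier S) \<phi> \<in> iso T S"
proof -
  let ?\<psi> = "inv_into (carrier S) \<phi>"
  have b: "bij_betw \<phi> (carrier S) (carrier T)" using assms by (rule iso_bij_betw)
  then have b': "bij_betw ?\<psi> (carrier T) (carrier S)" by (rule bij_betw_inv_into)
  have "?\<psi> (x \<otimes>\<^bsub>T\<^esub> y) = ?\<psi> x \<otimes> ?\<psi> y" if "x \<in> carrier T" "y \<in> carrier T" for x y
  proof -
    have "?\<psi> x \<in> carrier S" "?\<psi> y \<in> carrier S" using b' that bij_betwE by blast+
    then have "\<phi> (?\<psi> x \<otimes> ?\<psi> y) = x \<otimes>\<^bsub>T\<^esub> y" "?\<psi> x \<otimes> ?\<psi> y \<in> carrier S"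
      using b that by (simp_all add: iso_mult[OF assms] bij_betw_inv_into_right m_closed)
    then show ?thesis using b by (metis bij_betw_inv_into_left)
  qed
  with b' show ?thesis by (auto simp: iso_def hom_def bij_betwE)
qed

lemma (in alg_semigroup) is_iso_sym: "S \<cong> T \<Longrightarrow> T \<cong> S"
  using inv_into_iso unfolding is_iso_def by blast

lemma (in alg_semigroup) alg_semigroup_iso:
  assumes "S \<cong> T"
  shows "alg_semigroup T"
proof -
  obtain \<phi> where \<phi>: "\<phi> \<in> iso S T" using assms by (auto simp: is_iso_def)
  have c: "carrier T = \<phi> ` carrier S" using iso_bij_betw[OF \<phi>] by (simp add: bij_betw_def)
  show ?thesis
  proof
    show "carrier T \<noteq> {}" using c nonempty by simp
    show "x \<otimes>\<^bsub>T\<^esub> y \<in> carrier T" if "x \<in> carrier T" "y \<in> carrier T" for x y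
      using that unfolding c by (auto simp: iso_mult[OF \<phi>, symmetric] m_closed)
    show "(x \<otimes>\<^bsub>T\<^esub> y) \<otimes>\<^bsub>T\<^esub> z = x \<otimes>\<^bsub>T\<^esub> (y \<otimes>\<^bsub>T\<^esub> z)"
      if "x \<in> carrier T" "y \<in> carrier T" "z \<in> carrier T" for x y z
      using that unfolding c by (auto simp: iso_mult[OF \<phi>, symmetric] m_closed m_assoc)
  qed
qed

lemma subsemigroup_image:
  assumes "\<alpha> \<in> iso S T" "subsemigroup A S"
  shows "subsemigroup (\<alpha> ` A) T"
  unfolding subsemigroup_def
proof (intro conjI ballI)
  have A: "A \<noteq> {}" "A \<subseteq> carrier S" "\<And>x y. x \<in> A \<Longrightarrow> y \<in> A \<Longrightarrow> x \<otimes>\<^bsub>S\<^esub> y \<in> A"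
    using assms(2) by (auto simp: subsemigroup_def)
  show "\<alpha> ` A \<noteq> {}" "\<alpha> ` A \<subseteq> carrier T"
    using A iso_in_carrier[OF assms(1)] by auto
  fix x y assume "x \<in> \<alpha> ` A" "y \<in> \<alpha> ` A"
  then obtain x' y' where "x = \<alpha> x'" "x' \<in> A" "y = \<alpha> y'" "y' \<in> A" by blast
  then show "x \<otimes>\<^bsub>T\<^esub> y \<in> \<alpha> ` A"
    using A iso_mult[OF assms(1), of x' y'] by (metis image_eqI subsetD)
qed

text \<open>An extension of \<open>\<beta> \<circ> \<phi> \<circ> \<alpha>\<inverse>\<close> can be
  carried back to one of \<open>\<phi>\<close>. Source and target are moved separately: equal
  \<open>\<alpha>\<close> and \<open>\<beta>\<close> give the invariance of homogeneity, while
  separately chosen automorphisms normalise \<open>\<phi>\<close> to fix a given idempotent.\<close>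

lemma extend_conjugate:
  assumes S: "alg_semigroup S"
    and \<alpha>: "\<alpha> \<in> iso S T" and \<beta>: "\<beta> \<in> iso S T"
    and A: "subsemigroup A S" and B: "subsemigroup B S" and \<phi>: "bij_betw \<phi> A B"
    and hom: "\<And>x y. x \<in> A \<Longrightarrow> y \<in> A \<Longrightarrow> \<phi> (x \<otimes>\<^bsub>S\<^esub> y) = \<phi> x \<otimes>\<^bsub>S\<^esub> \<phi> y"
    and ext: "\<And>\<psi>. \<lbrakk>bij_betw \<psi> (\<alpha> ` A) (\<beta> ` B);
        \<And>x y. x \<in> \<alpha> ` A \<Longrightarrow> y \<in> \<alpha> ` A \<Longrightarrow> \<psi> (x \<otimes>\<^bsub>T\<^esub> y) = \<psi> x \<otimes>\<^bsub>T\<^esub> \<psi> y;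
        \<And>x. x \<in> A \<Longrightarrow> \<psi> (\<alpha> x) = \<beta> (\<phi> x)\<rbrakk>
      \<Longrightarrow> \<exists>\<theta>\<in>iso T T. \<forall>x\<in>\<alpha> ` A. \<theta> x = \<psi> x"
  shows "\<exists>\<theta>\<in>iso S S. \<forall>x\<in>A. \<theta> x = \<phi> x"
proof -
  interpret alg_semigroup S by (rule S)
  let ?a = "inv_into (carrier S) \<alpha>" and ?b = "inv_into (carrier S) \<beta>"
  define \<psi> where "\<psi> = \<beta> \<circ> \<phi> \<circ> ?a"
  have sub: "A \<subseteq> carrier S" "B \<subseteq> carrier S" using A B by (auto simp: subsemigroup_def)
  have inj: "inj_on \<alpha> (carrier S)" "inj_on \<beta> (carrier S)"
    using \<alpha> \<beta> by (auto simp: iso_def bij_betw_def)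
  have \<psi>: "\<psi> (\<alpha> x) = \<beta> (\<phi> x)" if "x \<in> A" for x
    using that sub inj by (auto simp: \<psi>_def)
  have mA: "x \<otimes>\<^bsub>S\<^esub> y \<in> A" if "x \<in> A" "y \<in> A" for x y
    using A that by (auto simp: subsemigroup_def)
  have \<phi>B: "\<phi> x \<in> B" if "x \<in> A" for x using \<phi> that bij_betwE by blast
  have "bij_betw ?a (\<alpha> ` A) A"
    using inj sub by (auto simp: bij_betw_def inv_into_image_cancel intro!: inj_on_inv_into)
  moreover have "bij_betw \<beta> B (\<beta> ` B)"
    using inj sub by (auto simp: bij_betw_def intro: inj_on_subset)
  ultimately have "bij_betw \<psi> (\<alpha> ` A) (\<beta> ` B)"
    unfolding \<psi>_def using \<phi> by (metis bij_betw_trans)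
  moreover have "\<psi> (x \<otimes>\<^bsub>T\<^esub> y) = \<psi> x \<otimes>\<^bsub>T\<^esub> \<psi> y" if xy: "x \<in> \<alpha> ` A" "y \<in> \<alpha> ` A" for x y
  proof -
    obtain x' y' where e: "x = \<alpha> x'" "x' \<in> A" "y = \<alpha> y'" "y' \<in> A" using xy by auto
    then have "x \<otimes>\<^bsub>T\<^esub> y = \<alpha> (x' \<otimes>\<^bsub>S\<^esub> y')"
      using sub by (auto simp: iso_mult[OF \<alpha>] subset_iff)
    then show ?thesis using e sub \<phi>B by (auto simp: \<psi> mA hom iso_mult[OF \<beta>] subset_iff)
  qed
  ultimately have "\<exists>\<theta>\<in>iso T T. \<forall>x\<in>\<alpha> ` A. \<theta> x = \<psi> x"
    using \<psi> by (rule ext)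
  then obtain \<theta> where \<theta>: "\<theta> \<in> iso T T" "\<And>x. x \<in> \<alpha> ` A \<Longrightarrow> \<theta> x = \<psi> x"
    by blast
  have "?b \<circ> (\<theta> \<circ> \<alpha>) \<in> iso S S"
    by (rule iso_set_trans[OF iso_set_trans[OF \<alpha> \<theta>(1)] inv_into_iso[OF \<beta>]])
  moreover have "(?b \<circ> (\<theta> \<circ> \<alpha>)) x = \<phi> x" if "x \<in> A" for x
  proof -
    have "(?b \<circ> (\<theta> \<circ> \<alpha>)) x = ?b (\<beta> (\<phi> x))" using that \<theta>(2) \<psi> by simp
    also have "\<dots> = \<phi> x" using inj sub \<phi>B[OF that] by (blast intro: inv_into_f_f)
    finally show ?thesis .
  qed
  ultimately show ?thesis by blast
qed

lemma homogeneous_semigroup_iso: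
  assumes "S \<cong> T" "homogeneous_semigroup T" "finite (carrier T)" "alg_semigroup S"
  shows "homogeneous_semigroup S"
proof -
  obtain \<alpha> where \<alpha>: "\<alpha> \<in> iso S T" using assms(1) by (auto simp: is_iso_def)
  have "finite (carrier S)" using assms(1,3) iso_finite by blast
  with assms(4) show ?thesis
  proof (rule homogeneous_semigroupI)
    fix A B \<phi>
    assume *: "subsemigroup A S" "subsemigroup B S" "bij_betw \<phi> A B"
      "\<And>x y. x \<in> A \<Longrightarrow> y \<in> A \<Longrightarrow> \<phi> (x \<otimes>\<^bsub>S\<^esub> y) = \<phi> x \<otimes>\<^bsub>S\<^esub> \<phi> y"
    show "\<exists>\<theta>\<in>iso S S. \<forall>x\<in>A. \<theta> x = \<phi> x"
    proof (rule extend_conjugate[OF assms(4) \<alpha> \<alpha> *])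
      fix \<psi> assume \<psi>: "bij_betw \<psi> (\<alpha> ` A) (\<alpha> ` B)"
        "\<And>x y. x \<in> \<alpha> ` A \<Longrightarrow> y \<in> \<alpha> ` A \<Longrightarrow> \<psi> (x \<otimes>\<^bsub>T\<^esub> y) = \<psi> x \<otimes>\<^bsub>T\<^esub> \<psi> y"
      show "\<exists>\<theta>\<in>iso T T. \<forall>x\<in>\<alpha> ` A. \<theta> x = \<psi> x"
        by (rule homogeneous_semigroup_extend[OF assms(2,3) subsemigroup_image[OF \<alpha> *(1)]
          subsemigroup_image[OF \<alpha> *(2)] \<psi>]) auto
    qed
  qed
qed

text \<open>The singletons of two idempotents are isomorphic subsemigroups, so some automorphism
  takes \<open>g\<close> to \<open>f\<close>. It embeds the set of idempotents below
  \<open>g\<close> into the set of those below \<open>f\<close>, which is impossible by finiteness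
  if \<open>f\<close> lies strictly below \<open>g\<close>.\<close>

lemma homogeneous_primitive:
  assumes hom: "homogeneous_semigroup S" and fin: "finite (carrier S)"
    and f: "f \<in> carrier S" "f \<otimes>\<^bsub>S\<^esub> f = f" and g: "g \<in> carrier S" "g \<otimes>\<^bsub>S\<^esub> g = g"
    and le: "f \<otimes>\<^bsub>S\<^esub> g = f" "g \<otimes>\<^bsub>S\<^esub> f = f"
  shows "f = g"
proof (rule ccontr)
  assume "f \<noteq> g"
  interpret alg_semigroup S using hom by (simp add: homogeneous_semigroup_def)
  have "subsemigroup {g} S" "subsemigroup {f} S"
    using f g by (auto simp: subsemigroup_def)
  moreover have "bij_betw (\<lambda>x. f) {g} {f}" by (simp add: bij_betw_def)
  ultimately obtain \<theta> where \<theta>: "\<theta> \<in> iso S S" "\<theta> g = f"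
    using homogeneous_semigroup_extend[OF hom fin, of "{g}" "{f}" "\<lambda>x. f"] f g by auto
  \<comment> \<open>\<open>K h\<close> collects the idempotents below \<open>h\<close> in the
    natural order.\<close>
  define K where "K h = {k \<in> carrier S. k \<otimes>\<^bsub>S\<^esub> k = k \<and> k \<otimes>\<^bsub>S\<^esub> h = k \<and> h \<otimes>\<^bsub>S\<^esub> k = k}" for h
  have "K f \<subset> K g"
  proof
    show "K f \<subseteq> K g"
    proof
      fix k assume k: "k \<in> K f"
      then have *: "k \<in> carrier S" "k \<otimes>\<^bsub>S\<^esub> k = k" "k \<otimes>\<^bsub>S\<^esub> f = k" "f \<otimes>\<^bsub>S\<^esub> k = k"
        by (auto simp: K_def)
      then have "k \<otimes>\<^bsub>S\<^esub> g = k" "g \<otimes>\<^bsub>S\<^esub> k = k"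
        using m_assoc[of k f g] m_assoc[of g f k] f g le by auto
      with * show "k \<in> K g" by (simp add: K_def)
    qed
    have "g \<in> K g" "g \<notin> K f" using g le \<open>f \<noteq> g\<close> by (auto simp: K_def)
    then show "K f \<noteq> K g" by blast
  qed
  moreover have "finite (K g)" using fin by (simp add: K_def)
  ultimately have "card (K f) < card (K g)" by (rule psubset_card_mono[rotated])
  moreover have "\<theta> ` K g \<subseteq> K f"
  proof
    fix y assume "y \<in> \<theta> ` K g"
    then obtain k where k: "y = \<theta> k" "k \<in> carrier S" "k \<otimes>\<^bsub>S\<^esub> k = k"
      "k \<otimes>\<^bsub>S\<^esub> g = k" "g \<otimes>\<^bsub>S\<^esub> k = k"
      by (auto simp: K_def)
    then show "y \<in> K f"
      using iso_mult[OF \<theta>(1), of k k] iso_mult[OF \<theta>(1), of k g] iso_mult[OF \<theta>(1), of g k]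
        iso_in_carrier[OF \<theta>(1)] g \<theta>(2)
      by (simp add: K_def)
  qed
  then have "card (\<theta> ` K g) \<le> card (K f)"
    using fin by (intro card_mono) (auto simp: K_def)
  moreover have "inj_on \<theta> (K g)"
    using iso_bij_betw[OF \<theta>(1)] by (auto simp: bij_betw_def K_def inj_on_def)
  ultimately show False by (simp add: card_image)
qed

section \<open>Rees coordinates of a primitive regular semigroup\<close>

lemma rees_simps [simp]:
  "carrier (rees_matrix_semigroup G I L P) = I \<times> carrier G \<times> L"
  "(i, g, l) \<otimes>\<^bsub>rees_matrix_semigroup G I L P\<^esub> (j, h, m) =
     (i, g \<otimes>\<^bsub>G\<^esub> P l j \<otimes>\<^bsub>G\<^esub> h, m)"
  by (simp_all add: rees_matrix_semigroup_def)

text \<open>Every idempotent is minimal in the natural order. Together with regularity this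
  characterises the completely simple semigroups; Rees's theorem for them is obtained here by direct
  calculation with idempotents.\<close>

locale primitive_regular_semigroup = alg_semigroup +
  assumes regular: "x \<in> carrier S \<Longrightarrow> \<exists>y\<in>carrier S. x = x \<otimes> y \<otimes> x"
    and primitive: "\<lbrakk>f \<in> carrier S; g \<in> carrier S; f \<otimes> f = f; g \<otimes> g = g; f \<otimes> g = f; g \<otimes> f = f\<rbrakk>
      \<Longrightarrow> f = g"
begin

definition local_group where
  "local_group e = \<lparr>carrier = {x \<in> carrier S. e \<otimes> x = x \<and> x \<otimes> e = x}, monoid.mult = (\<otimes>), one = e\<rparr>"

text \<open>An element \<open>y\<close> with \<open>x y x = x\<close> is cut down to
  \<open>z = e y e\<close>. Then \<open>z x\<close> is an idempotent below \<open>e\<close>, so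
  primitivity makes it equal to \<open>e\<close>, and \<open>z\<close> is a left inverse of
  \<open>x\<close>.\<close>

lemma group_local_group:
  assumes e: "e \<in> carrier S" "e \<otimes> e = e"
  shows "group (local_group e)"
proof (rule groupI)
  fix x assume "x \<in> carrier (local_group e)"
  then have x: "x \<in> carrier S" "e \<otimes> x = x" "x \<otimes> e = x" by (auto simp: local_group_def)
  obtain y where y: "y \<in> carrier S" "x = x \<otimes> y \<otimes> x" using regular x(1) by blast
  define z where "z = e \<otimes> y \<otimes> e"
  have z: "z \<in> carrier S" "e \<otimes> z = z" "z \<otimes> e = z"
    using e y by (simp_all add: z_def m_closed m_assoc) (simp_all add: m_closed m_assoc[symmetric])
  have xzx: "x \<otimes> z \<otimes> x = x"
  proof -
    have "x \<otimes> z \<otimes> x = (x \<otimes> e) \<otimes> y \<otimes> (e \<otimes> x)"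
      using e x(1) y(1) by (simp add: z_def m_closed m_assoc)
    then show ?thesis using x y by simp
  qed
  have "(z \<otimes> x) \<otimes> (z \<otimes> x) = z \<otimes> (x \<otimes> z \<otimes> x)"
    using x z by (simp add: m_closed m_assoc)
  then have "(z \<otimes> x) \<otimes> (z \<otimes> x) = z \<otimes> x" by (simp add: xzx)
  moreover have "z \<otimes> x \<otimes> e = z \<otimes> x" using x z e by (simp add: m_assoc)
  moreover have "e \<otimes> (z \<otimes> x) = z \<otimes> x" using x z e by (simp add: m_assoc[symmetric])
  ultimately have "z \<otimes> x = e" using primitive e m_closed x z by blast
  then show "\<exists>y\<in>carrier (local_group e). y \<otimes>\<^bsub>local_group e\<^esub> x = \<one>\<^bsub>local_group e\<^esub>"
    using z by (auto simp: local_group_def)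
next
  fix x y assume "x \<in> carrier (local_group e)" "y \<in> carrier (local_group e)"
  then show "x \<otimes>\<^bsub>local_group e\<^esub> y \<in> carrier (local_group e)"
    using e m_assoc[of e x y] m_assoc[of x y e] by (simp add: local_group_def m_closed)
qed (use e m_assoc in \<open>simp_all add: local_group_def\<close>)

text \<open>\<open>I\<close> and \<open>L\<close> consist of the idempotents that generate the same
  left ideal, respectively the same right ideal, as \<open>e\<close>. Every element is a product
  \<open>i g l\<close> with \<open>g\<close> in \<open>e S e\<close>, and the sandwich entry is
  simply the product \<open>l i\<close>. It is normalised at \<open>e\<close> because
  \<open>e i = e\<close> and \<open>l e = e\<close>.\<close>

lemma rees_coordinates:
  assumes e: "e \<in> carrier S" "e \<otimes> e = e"
  defines "I \<equiv> {i \<in> carrier S. i \<otimes> i = i \<and> i \<otimes> e = i \<and> e \<otimes> i = e}"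
    and "L \<equiv> {l \<in> carrier S. l \<otimes> l = l \<and> e \<otimes> l = l \<and> l \<otimes> e = e}"
  shows "normalised_matrix (local_group e) I L e e (\<otimes>)"
    and "(\<lambda>(i, g, l). i \<otimes> g \<otimes> l) \<in> iso (rees_matrix_semigroup (local_group e) I L (\<otimes>)) S"
proof -
  interpret G: group "local_group e" using e by (rule group_local_group)
  have G: "x \<in> carrier (local_group e) \<longleftrightarrow> x \<in> carrier S \<and> e \<otimes> x = x \<and> x \<otimes> e = x"
    "x \<otimes>\<^bsub>local_group e\<^esub> y = x \<otimes> y" "\<one>\<^bsub>local_group e\<^esub> = e" for x y
    by (auto simp: local_group_def)
  have I: "i \<in> carrier S" "i \<otimes> i = i" "i \<otimes> e = i" "e \<otimes> i = e" if "i \<in> I" for i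
    using that by (auto simp: I_def)
  have L: "l \<in> carrier S" "l \<otimes> l = l" "l \<otimes> e = e" "e \<otimes> l = l" if "l \<in> L" for l
    using that by (auto simp: L_def)
  have LI: "l \<otimes> i \<in> carrier (local_group e)" if "l \<in> L" "i \<in> I" for l i
    using I[OF that(2)] L[OF that(1)] e unfolding G
    by (simp add: m_closed m_assoc) (simp add: m_closed m_assoc[symmetric])
  have "e \<in> I" "e \<in> L" using e by (auto simp: I_def L_def)
  then show "normalised_matrix (local_group e) I L e e (\<otimes>)"
    using LI I L by (auto simp: normalised_matrix_def matrix_over_def G(3))
  let ?R = "rees_matrix_semigroup (local_group e) I L (\<otimes>)"
  let ?f = "\<lambda>(i, g, l). i \<otimes> g \<otimes> l"
  \<comment> \<open>Multiplying \<open>i g l\<close> by \<open>e\<close> on the right, on the left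
    or on both sides isolates \<open>i g\<close>, \<open>g l\<close> and \<open>g\<close>;
    injectivity rests on this.\<close>
  have le: "i \<otimes> g \<otimes> l \<otimes> e = i \<otimes> g" if "i \<in> I" "g \<in> carrier (local_group e)" "l \<in> L" for i g l
    using I[OF that(1)] that(2) L[OF that(3)] e unfolding G by (simp add: m_closed m_assoc)
  have ele: "e \<otimes> (i \<otimes> g) = g" if "i \<in> I" "g \<in> carrier (local_group e)" for i g
    using I[OF that(1)] that(2) e unfolding G by (simp add: m_closed m_assoc[symmetric])
  have el: "e \<otimes> (i \<otimes> g \<otimes> l) = g \<otimes> l" if "i \<in> I" "g \<in> carrier (local_group e)" "l \<in> L" for i g l
    using I[OF that(1)] that(2) L[OF that(3)] e unfolding G
    by (simp add: m_closed m_assoc[symmetric])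
  have "inj_on ?f (carrier ?R)"
  proof (rule inj_onI, clarsimp)
    fix i g l j h m
    assume i: "i \<in> I" "j \<in> I" and l: "l \<in> L" "m \<in> L"
      and g: "g \<in> carrier (local_group e)" "h \<in> carrier (local_group e)"
      and eq: "i \<otimes> g \<otimes> l = j \<otimes> h \<otimes> m"
    have ig: "i \<otimes> g = j \<otimes> h" using le i l g eq by metis
    then have gh: "g = h" using ele i g by metis
    obtain k where k: "k \<in> carrier (local_group e)" "k \<otimes> g = e" "g \<otimes> k = e"
      using G.inv_closed[OF g(1)] G.l_inv[OF g(1)] G.r_inv[OF g(1)] unfolding G(2,3) by blast
    have "i = i \<otimes> g \<otimes> k" "j = j \<otimes> h \<otimes> k"
      using k g I[OF i(1)] I[OF i(2)] gh by (simp_all add: G m_assoc)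
    then have "i = j" using ig by simp
    have "g \<otimes> l = h \<otimes> m" using el i l g eq by metis
    moreover have "l = k \<otimes> (g \<otimes> l)" "m = k \<otimes> (h \<otimes> m)"
      using k g L[OF l(1)] L[OF l(2)] gh by (simp_all add: G m_assoc[symmetric])
    ultimately show "i = j \<and> g = h \<and> l = m" using \<open>i = j\<close> gh by simp
  qed
  moreover have "?f ` carrier ?R = carrier S"
  proof
    show "?f ` carrier ?R \<subseteq> carrier S" using I(1) L(1) by (auto simp: G m_closed)
    show "carrier S \<subseteq> ?f ` carrier ?R"
    proof
      fix x assume x: "x \<in> carrier S"
      \<comment> \<open>If \<open>x = i g l\<close>, then \<open>e x e = g\<close>,
        \<open>x e = i g\<close> and \<open>e x = g l\<close>. With \<open>h\<close> the inverse of
        \<open>g\<close> in \<open>e S e\<close> this forces \<open>i = x h\<close> and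
        \<open>l = h x\<close>.\<close>
      let ?g = "e \<otimes> x \<otimes> e"
      have g: "?g \<in> carrier (local_group e)"
        using x e by (simp add: G m_closed m_assoc) (simp add: m_closed m_assoc[symmetric])
      define h where "h = inv\<^bsub>local_group e\<^esub> ?g"
      have h: "h \<in> carrier S" "e \<otimes> h = h" "h \<otimes> e = h" "h \<otimes> ?g = e" "?g \<otimes> h = e"
        using G.inv_closed[OF g] G.l_inv[OF g] G.r_inv[OF g] unfolding h_def[symmetric] G by auto
      have hx: "h \<otimes> (x \<otimes> e) = e" and xh: "e \<otimes> x \<otimes> h = e"
      proof -
        have "h \<otimes> (x \<otimes> e) = (h \<otimes> e) \<otimes> (x \<otimes> e)" by (simp add: h)
        also have "\<dots> = h \<otimes> ?g" using h(1) x e by (simp add: m_closed m_assoc)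
        finally show "h \<otimes> (x \<otimes> e) = e" by (simp add: h)
        have "e \<otimes> x \<otimes> h = e \<otimes> x \<otimes> (e \<otimes> h)" by (simp add: h)
        also have "\<dots> = ?g \<otimes> h" using h(1) x e by (simp add: m_closed m_assoc)
        finally show "e \<otimes> x \<otimes> h = e" by (simp add: h)
      qed
      have hxh: "h \<otimes> x \<otimes> h = h"
      proof -
        have "h \<otimes> x \<otimes> h = h \<otimes> x \<otimes> (e \<otimes> h)" by (simp add: h)
        also have "\<dots> = h \<otimes> (x \<otimes> e) \<otimes> h" using h(1) x e by (simp add: m_closed m_assoc)
        finally show ?thesis by (simp add: hx h)
      qed
      have i: "x \<otimes> h \<in> I"
      proof -
        have "x \<otimes> h \<otimes> (x \<otimes> h) = x \<otimes> (h \<otimes> x \<otimes> h)" using h(1) x by (simp add: m_closed m_assoc)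
        then show ?thesis using x h(1,3) xh e by (simp add: I_def m_closed hxh m_assoc)
      qed
      have l: "h \<otimes> x \<in> L"
      proof -
        have "h \<otimes> x \<otimes> (h \<otimes> x) = h \<otimes> x \<otimes> h \<otimes> x" using h(1) x by (simp add: m_closed m_assoc)
        moreover have "e \<otimes> (h \<otimes> x) = h \<otimes> x" using x h e by (simp add: m_assoc[symmetric])
        ultimately show ?thesis using x h(1) hx e by (simp add: L_def m_closed hxh m_assoc)
      qed
      \<comment> \<open>What remains is \<open>x h x = x\<close>. The idempotent \<open>x y\<close>
        fixes \<open>x\<close> from the left, and \<open>(x h) (x y)\<close> is an idempotent below
        it, hence equal to it; so \<open>x h\<close> fixes \<open>x\<close> as well.\<close>
      obtain y where y: "y \<in> carrier S" "x = x \<otimes> y \<otimes> x" using regular x by blast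
      let ?f = "x \<otimes> y" and ?i = "x \<otimes> h"
      have fi: "?f \<otimes> ?i = ?i"
      proof -
        have "?f \<otimes> ?i = x \<otimes> y \<otimes> x \<otimes> h" using x y(1) h(1) by (simp add: m_closed m_assoc)
        then show ?thesis using y by simp
      qed
      have ff: "?f \<otimes> ?f = ?f"
      proof -
        have "?f \<otimes> ?f = x \<otimes> y \<otimes> x \<otimes> y" using x y(1) by (simp add: m_closed m_assoc)
        then show ?thesis using y by simp
      qed
      have c: "?f \<in> carrier S" "?i \<in> carrier S" using x y h by (auto simp: m_closed)
      have "?i \<otimes> ?f \<otimes> (?i \<otimes> ?f) = ?i \<otimes> (?f \<otimes> ?i) \<otimes> ?f"
        using c by (simp only: m_closed m_assoc)
      then have "?i \<otimes> ?f \<otimes> (?i \<otimes> ?f) = ?i \<otimes> ?f" using fi I(2)[OF i] by simp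
      moreover have "?f \<otimes> (?i \<otimes> ?f) = ?i \<otimes> ?f"
        using m_assoc[OF c(1,2,1)] fi by simp
      moreover have "?i \<otimes> ?f \<otimes> ?f = ?i \<otimes> ?f"
        using m_assoc[OF c(2,1,1)] ff by simp
      ultimately have "?i \<otimes> ?f = ?f" using primitive[of "?i \<otimes> ?f" ?f] ff c m_closed by metis
      moreover have "?i \<otimes> x = ?i \<otimes> (?f \<otimes> x)" using y by simp
      ultimately have ix: "?i \<otimes> x = x" using m_assoc[OF c(2,1) x] y by simp
      have "x = ?i \<otimes> ?g \<otimes> (h \<otimes> x)"
      proof -
        have "?i \<otimes> ?g \<otimes> (h \<otimes> x) = x \<otimes> (h \<otimes> ?g) \<otimes> h \<otimes> x"
          using x h(1) e by (simp only: m_closed m_assoc)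
        also have "\<dots> = x \<otimes> (e \<otimes> h) \<otimes> x"
          using x h(1) e unfolding h(4) by (simp only: m_closed m_assoc)
        finally show ?thesis using ix by (simp add: h)
      qed
      then have "x = (\<lambda>(i, g, l). i \<otimes> g \<otimes> l) (?i, ?g, h \<otimes> x)" by simp
      with i g l show "x \<in> (\<lambda>(i, g, l). i \<otimes> g \<otimes> l) ` carrier ?R"
        by (intro rev_image_eqI[of "(?i, ?g, h \<otimes> x)"]) auto
    qed
  qed
  moreover have "?f \<in> hom ?R S"
  proof (rule homI)
    fix x y assume "x \<in> carrier ?R" "y \<in> carrier ?R"
    then show "?f (x \<otimes>\<^bsub>?R\<^esub> y) = ?f x \<otimes> ?f y"
      using I(1) L(1) by (cases x; cases y) (simp add: G m_closed m_assoc)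
  next
    fix x assume "x \<in> carrier ?R"
    then show "?f x \<in> carrier S"
      using I(1) L(1) by (cases x) (simp add: G m_closed)
  qed
  ultimately show "?f \<in> iso ?R S"
    by (simp add: iso_iff)
qed

end

section \<open>Automorphisms of a homogeneous Rees matrix semigroup\<close>

text \<open>
  If a value class \<open>C\<close> of a non-constant function on \<open>Y\<close> has complement \<open>D\<close>, then swapping one
  point of \<open>C\<close> with one of \<open>D\<close> gives \<open>card C * card D\<close> further functions of the orbit.
\<close>

lemma
  fixes Q :: "'j \<Rightarrow> 'x \<Rightarrow> 'c"
  assumes fin: "finite Y" "finite J"
    and closed: "\<And>i x y. i \<in> J \<Longrightarrow> x \<in> Y \<Longrightarrow> y \<in> Y \<Longrightarrow>
      \<exists>j\<in>J. \<forall>l\<in>Y. Q j l = Q i (Transposition.transpose x y l)"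
    and i: "i \<in> J" and uv: "u \<in> Y" "v \<in> Y" "Q i u \<noteq> Q i v"
  shows card_le_transposition_closed: "card Y \<le> card J"
    and constant_but_one: "card J \<le> card Y \<Longrightarrow> \<exists>x\<in>Y. \<exists>a. \<forall>l\<in>Y - {x}. Q i l = a"
proof -
  define C where "C = {l \<in> Y. Q i l = Q i u}"
  define D where "D = Y - C"
  \<comment> \<open>\<open>cl j\<close> is the class of the fixed value \<open>Q i u\<close> for
    \<open>Q j\<close>. A swap of \<open>x\<close> in \<open>C\<close> with \<open>y\<close> in
    \<open>D\<close> turns \<open>C\<close> into \<open>sw (x, y)\<close>, so these sets occur among
    the \<open>cl j\<close>.\<close>
  define cl where "cl j = {l \<in> Y. Q j l = Q i u}" for j
  define sw where "sw = (\<lambda>(x, y). insert y (C - {x}))"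
  have CD: "finite C" "finite D" "card C > 0" "card D > 0" "C \<inter> D = {}" "Y = C \<union> D"
    using fin uv by (auto simp: C_def D_def card_gt_0_iff)
  have "inj_on sw (C \<times> D)"
  proof (rule inj_onI, clarify)
    fix x y x' y' assume *: "x \<in> C" "y \<in> D" "x' \<in> C" "y' \<in> D" "sw (x, y) = sw (x', y')"
    have "y = y'" using * CD(5) by (auto simp: sw_def)
    moreover have "x = x'" using * CD(5) by (auto simp: sw_def)
    ultimately show "x = x' \<and> y = y'" by simp
  qed
  then have "card (sw ` (C \<times> D)) = card C * card D" by (simp add: card_image card_cartesian_product)
  moreover have "C \<notin> sw ` (C \<times> D)" using CD(5) by (auto simp: sw_def)
  ultimately have cardsw: "card (insert C (sw ` (C \<times> D))) = card C * card D + 1"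
    using CD by simp
  have "sw (x, y) \<in> cl ` J" if xy: "x \<in> C" "y \<in> D" for x y
  proof -
    obtain j where j: "j \<in> J" "\<forall>l\<in>Y. Q j l = Q i (Transposition.transpose x y l)"
      using closed[OF i, of x y] xy CD by auto
    have "l \<in> cl j \<longleftrightarrow> l \<in> sw (x, y)" for l
    proof (cases "l \<in> Y")
      case True
      then have "Q j l = Q i (Transposition.transpose x y l)" using j(2) by blast
      moreover have "x \<noteq> y" "y \<in> Y" "Q i y \<noteq> Q i u" "Q i x = Q i u"
        using xy by (auto simp: C_def D_def)
      ultimately show ?thesis
        using True by (cases "l = x"; cases "l = y") (auto simp: cl_def sw_def C_def)
    next
      case False
      moreover have "y \<in> Y" using xy by (simp add: D_def)
      ultimately show ?thesis by (auto simp: cl_def sw_def C_def)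
    qed
    then have "cl j = sw (x, y)" by blast
    with j(1) show ?thesis by blast
  qed
  moreover have "C = cl i" by (simp add: C_def cl_def)
  ultimately have sub: "insert C (sw ` (C \<times> D)) \<subseteq> cl ` J" using i by auto
  have "card C * card D + 1 \<le> card (cl ` J)"
    using card_mono[OF _ sub] fin cardsw by simp
  moreover have cardY: "card Y = card C + card D"
    using CD by (simp add: card_Un_disjoint)
  \<comment> \<open>The surplus over \<open>card Y\<close> is a product that vanishes exactly if one
    of the two non-empty sets is a singleton.\<close>
  moreover have "card C * card D + 1 = card C + card D + (card C - 1) * (card D - 1)"
  proof -
    obtain p q where "card C = Suc p" "card D = Suc q" using CD(3,4) gr0_implies_Suc by metis
    then show ?thesis by simp
  qed
  ultimately have le: "card Y + (card C - 1) * (card D - 1) \<le> card (cl ` J)" by simp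
  moreover have le': "card (cl ` J) \<le> card J" using fin(2) by (rule card_image_le)
  ultimately show "card Y \<le> card J" by simp
  assume J: "card J \<le> card Y"
  with le le' have z: "(card C - 1) * (card D - 1) = 0" and eq: "card (cl ` J) = card J"
    by linarith+
  from z consider "card D = 1" | "card C = 1" using CD(3,4) by fastforce
  then show "\<exists>x\<in>Y. \<exists>a. \<forall>l\<in>Y - {x}. Q i l = a"
  proof cases
    case 1
    then obtain x where "D = {x}" by (auto simp: card_1_singleton_iff)
    then show ?thesis by (intro bexI[of _ x] exI[of _ "Q i u"]) (auto simp: C_def D_def)
  next
    case 2
    then obtain x where "C = {x}" by (auto simp: card_1_singleton_iff)
    moreover have "u \<in> C" using uv by (simp add: C_def)
    ultimately have C: "C = {u}" by simp
    \<comment> \<open>\<open>D\<close> may still carry several values. Equality in the count makes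
      \<open>cl\<close> injective; a swap within \<open>D\<close> does not change the class
      \<open>C = {u}\<close>, hence not \<open>Q i\<close> itself, so \<open>Q i\<close> is constant
      on \<open>D\<close>.\<close>
    have inj: "inj_on cl J" using fin(2) eq by (rule eq_card_imp_inj_on)
    have "Q i y = Q i v" if y: "y \<in> Y - {u}" for y
    proof -
      have vD: "v \<in> D" "y \<in> D" using uv y unfolding D_def C by auto
      obtain j where j: "j \<in> J" "\<forall>l\<in>Y. Q j l = Q i (Transposition.transpose y v l)"
        using closed[OF i, of y v] y uv by auto
      have "l \<in> cl j \<longleftrightarrow> l \<in> cl i" for l
      proof (cases "l \<in> Y")
        case True
        then have "Q j l = Q i (Transposition.transpose y v l)" using j(2) by blast
        then show ?thesis
          using True vD by (cases "l = y"; cases "l = v") (simp_all add: cl_def C_def D_def)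
      qed (auto simp: cl_def)
      then have "cl j = cl i" by blast
      with inj j(1) i have "j = i" by (auto dest: inj_onD)
      with j(2) y show ?thesis by auto
    qed
    then show ?thesis using uv by blast
  qed
qed

text \<open>The exceptional point of \<open>Q i\<close> can be moved to every point of
  \<open>Y\<close> by a transposition. This gives \<open>card Y\<close> different members of
  \<open>J\<close>, which by the cardinality hypothesis are all of them.\<close>

lemma transposition_closed_matching:
  fixes Q :: "'j \<Rightarrow> 'x \<Rightarrow> 'c"
  assumes fin: "finite Y" "finite J"
    and closed: "\<And>i x y. i \<in> J \<Longrightarrow> x \<in> Y \<Longrightarrow> y \<in> Y \<Longrightarrow>
      \<exists>j\<in>J. \<forall>l\<in>Y. Q j l = Q i (Transposition.transpose x y l)"
    and i: "i \<in> J" and uv: "u \<in> Y" "v \<in> Y" "Q i u \<noteq> Q i v"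
    and card: "card J \<le> card Y"
  obtains a b f where "a \<noteq> b" "bij_betw f Y J"
    "\<And>x y. x \<in> Y \<Longrightarrow> y \<in> Y \<Longrightarrow> Q (f x) y = (if y = x then b else a)"
proof -
  obtain z a where z: "z \<in> Y" "\<And>l. l \<in> Y \<Longrightarrow> l \<noteq> z \<Longrightarrow> Q i l = a"
    using constant_but_one[OF assms] by auto
  define b where "b = Q i z"
  have ab: "a \<noteq> b" using z uv unfolding b_def by metis
  have "\<exists>j\<in>J. \<forall>y\<in>Y. Q j y = (if y = x then b else a)" if x: "x \<in> Y" for x
  proof -
    obtain j where j: "j \<in> J" "\<forall>l\<in>Y. Q j l = Q i (Transposition.transpose x z l)"
      using closed[OF i x z(1)] by auto
    have "Q j y = (if y = x then b else a)" if "y \<in> Y" for y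
      using j(2) that x z by (auto simp: b_def Transposition.transpose_def)
    with j(1) show ?thesis by blast
  qed
  then obtain f where f: "\<And>x. x \<in> Y \<Longrightarrow> f x \<in> J"
    "\<And>x y. x \<in> Y \<Longrightarrow> y \<in> Y \<Longrightarrow> Q (f x) y = (if y = x then b else a)"
    by metis
  have inj: "inj_on f Y" using f(2) ab by (metis inj_onI)
  then have "f ` Y = J"
    using f(1) fin card by (intro card_seteq) (auto simp: card_image)
  with inj have "bij_betw f Y J" by (simp add: bij_betw_def)
  then show ?thesis using that ab f(2) by blast
qed

section \<open>Extension of partial automorphisms over a normalised matrix\<close>

locale rees_matrix = group G for G (structure) +
  fixes I :: "'i set" and L :: "'l set" and P :: "'l \<Rightarrow> 'i \<Rightarrow> 'a" and i1 :: 'i and l1 :: 'l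
  assumes finite_G: "finite (carrier G)" and finite_I: "finite I" and finite_L: "finite L"
    and normalised: "normalised_matrix G I L i1 l1 P"
begin

abbreviation "R \<equiv> rees_matrix_semigroup G I L P"

lemma base [simp]: "i1 \<in> I" "l1 \<in> L"
  and P_closed [simp]: "l \<in> L \<Longrightarrow> i \<in> I \<Longrightarrow> P l i \<in> carrier G"
  and P_base [simp]: "i \<in> I \<Longrightarrow> P l1 i = \<one>" "l \<in> L \<Longrightarrow> P l i1 = \<one>"
  using normalised by (auto simp: normalised_matrix_def matrix_over_def)

lemma finite_R: "finite (carrier R)"
  using finite_G finite_I finite_L by simp

lemma alg_semigroup_R: "alg_semigroup R"
proof
  show "carrier R \<noteq> {}" using base by (auto simp: ex_in_conv[symmetric] simp del: base)
qed (auto simp: m_assoc)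

end

locale homogeneous_rees_matrix = rees_matrix +
  assumes homogeneous: "homogeneous_semigroup R"
begin

lemma extend:
  assumes "subsemigroup A R" "subsemigroup B R" "bij_betw \<phi> A B"
    and "\<And>x y. x \<in> A \<Longrightarrow> y \<in> A \<Longrightarrow> \<phi> (x \<otimes>\<^bsub>R\<^esub> y) = \<phi> x \<otimes>\<^bsub>R\<^esub> \<phi> y"
  obtains \<theta> where "\<theta> \<in> iso R R" "\<And>x. x \<in> A \<Longrightarrow> \<theta> x = \<phi> x"
  using homogeneous_semigroup_extend[OF homogeneous finite_R assms] by blast

text \<open>An isomorphism between subgroups of \<open>G\<close> acts on their copies in
  \<open>{i1} \<times> G \<times> {l1}\<close>. It fixes the idempotent there, hence so does its
  extension \<open>\<Theta>\<close>, which therefore maps the whole copy of \<open>G\<close> to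
  itself and induces \<open>\<tau>\<close>.\<close>

lemma homogeneous_group_G: "homogeneous_group G"
  unfolding homogeneous_group_def
proof (intro conjI allI impI ballI)
  show "group G" by unfold_locales
  fix A B \<phi>
  assume "fg_subgroup A G" "fg_subgroup B G"
    and \<phi>: "\<phi> \<in> iso (G\<lparr>carrier := A\<rparr>) (G\<lparr>carrier := B\<rparr>)"
  then interpret A: subgroup A G + B: subgroup B G
    using generate_is_subgroup by (auto simp: fg_subgroup_def)
  have b: "bij_betw \<phi> A B" and m: "\<And>x y. x \<in> A \<Longrightarrow> y \<in> A \<Longrightarrow> \<phi> (x \<otimes> y) = \<phi> x \<otimes> \<phi> y"
    using \<phi> by (auto simp: iso_def hom_def)
  have \<phi>A: "\<phi> x \<in> B" if "x \<in> A" for x using b that bij_betwE by blast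
  have "\<phi> \<one> \<otimes> \<phi> \<one> = \<phi> \<one>" using m[of \<one> \<one>] by simp
  then have \<phi>1: "\<phi> \<one> = \<one>" using \<phi>A[of \<one>] B.mem_carrier by (simp add: r_cancel_one)
  let ?A = "{i1} \<times> A \<times> {l1}" and ?B = "{i1} \<times> B \<times> {l1}"
  have bij: "bij_betw (map_prod id (map_prod \<phi> id)) ?A ?B"
    by (intro bij_betw_map_prod b bij_betw_id)
  obtain \<Theta> where \<Theta>: "\<Theta> \<in> iso R R" "\<And>g. g \<in> A \<Longrightarrow> \<Theta> (i1, g, l1) = (i1, \<phi> g, l1)"
  proof (rule extend[of ?A ?B "map_prod id (map_prod \<phi> id)"])
    show "subsemigroup ?A R" "subsemigroup ?B R"
      using A.subset B.subset A.subgroup_axioms B.subgroup_axioms subgroup_nonempty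
      by (auto simp: subsemigroup_def)
  qed (use bij m \<phi>A in auto)
  define \<tau> where "\<tau> g = fst (snd (\<Theta> (i1, g, l1)))" for g
  have \<tau>: "\<Theta> (i1, g, l1) = (i1, \<tau> g, l1)" and \<tau>c: "\<tau> g \<in> carrier G" if g: "g \<in> carrier G" for g
  proof -
    let ?x = "(i1, g, l1)" and ?e = "(i1, \<one>, l1)"
    have e: "\<Theta> ?e = ?e" using \<Theta>(2) \<phi>1 by simp
    have c: "?x \<in> carrier R" "?e \<in> carrier R" using g by auto
    obtain i h l where x: "\<Theta> ?x = (i, h, l)" "h \<in> carrier G"
      using iso_in_carrier[OF \<Theta>(1) c(1)] by auto
    have "i = i1" using iso_mult[OF \<Theta>(1) c(2,1)] e x g by simp
    moreover have "l = l1" using iso_mult[OF \<Theta>(1) c] e x g by simp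
    ultimately show "\<Theta> ?x = (i1, \<tau> g, l1)" "\<tau> g \<in> carrier G" using x by (auto simp: \<tau>_def)
  qed
  have "\<tau> \<in> iso G G"
  proof (rule isoI)
    show "\<tau> \<in> hom G G"
    proof (rule homI)
      fix x y assume xy: "x \<in> carrier G" "y \<in> carrier G"
      then show "\<tau> (x \<otimes> y) = \<tau> x \<otimes> \<tau> y"
        using iso_mult[OF \<Theta>(1), of "(i1, x, l1)" "(i1, y, l1)"] by (simp add: \<tau> \<tau>c)
    qed (rule \<tau>c)
    have inj: "inj_on \<tau> (carrier G)"
    proof (rule inj_onI)
      fix x y assume xy: "x \<in> carrier G" "y \<in> carrier G" "\<tau> x = \<tau> y"
      then have "\<Theta> (i1, x, l1) = \<Theta> (i1, y, l1)" by (simp add: \<tau>)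
      then show "x = y"
        using iso_bij_betw[OF \<Theta>(1)] xy by (auto simp: bij_betw_def dest: inj_onD)
    qed
    then show "bij_betw \<tau> (carrier G) (carrier G)"
      using finite_G \<tau>c by (intro bij_betw_imageI endo_inj_surj) auto
  qed
  moreover have "\<tau> x = \<phi> x" if "x \<in> A" for x
    using \<tau>[of x] \<Theta>(2)[OF that] that by auto
  ultimately show "\<exists>\<theta>\<in>iso G G. \<forall>x\<in>A. \<theta> x = \<phi> x" by blast
qed

text \<open>The map that acts as \<open>\<theta>\<close> and \<open>\<pi>\<close> on
  \<open>{i1} \<times> G \<times> L\<close> is extended to \<open>\<Theta>\<close>, and the images
  of \<open>(j, \<one>, l1)\<close> define \<open>\<psi>\<close> and factors \<open>w j\<close>. The
  product of \<open>(i1, \<one>, l)\<close> and \<open>(j, \<one>, l1)\<close> is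
  \<open>(i1, P l j, l1)\<close>; applying \<open>\<Theta>\<close> gives the equation, and row
  \<open>l1\<close> determines \<open>w j\<close>.\<close>

lemma row_permutation:
  assumes \<pi>: "bij_betw \<pi> L L" and \<theta>: "\<theta> \<in> iso G G"
  obtains \<psi> where "bij_betw \<psi> I I" "\<psi> i1 = i1"
    "\<And>l j. l \<in> L \<Longrightarrow> j \<in> I \<Longrightarrow> \<theta> (P l j) = P (\<pi> l) (\<psi> j) \<otimes> inv (P (\<pi> l1) (\<psi> j))"
proof -
  have \<pi>L: "\<pi> l \<in> L" if "l \<in> L" for l using \<pi> that bij_betwE by blast
  have \<theta>G: "\<theta> g \<in> carrier G" if "g \<in> carrier G" for g using \<theta> that by (rule iso_in_carrier)
  have \<theta>1: "\<theta> \<one> = \<one>" using \<theta> by (simp add: iso_def hom_one)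
  let ?A = "{i1} \<times> carrier G \<times> L"
  have sub: "subsemigroup ?A R" using one_closed base by (auto simp: subsemigroup_def simp del: one_closed base)
  have bij: "bij_betw (map_prod id (map_prod \<theta> \<pi>)) ?A ?A"
    using iso_bij_betw[OF \<theta>] \<pi> by (intro bij_betw_map_prod) auto
  obtain \<Theta> where \<Theta>: "\<Theta> \<in> iso R R"
    "\<And>g l. g \<in> carrier G \<Longrightarrow> l \<in> L \<Longrightarrow> \<Theta> (i1, g, l) = (i1, \<theta> g, \<pi> l)"
    by (rule extend[OF sub sub bij]) (use \<pi>L iso_mult[OF \<theta>] \<theta>G in auto)
  have "\<exists>k w. k \<in> I \<and> w \<in> carrier G \<and> \<Theta> (j, \<one>, l1) = (k, w, \<pi> l1)" if j: "j \<in> I" for j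
  proof -
    have c: "(j, \<one>, l1) \<in> carrier R" "(i1, \<one>, l1) \<in> carrier R" using j by auto
    obtain k w l where x: "\<Theta> (j, \<one>, l1) = (k, w, l)" "k \<in> I" "w \<in> carrier G"
      using iso_in_carrier[OF \<Theta>(1) c(1)] by auto
    moreover have "l = \<pi> l1" using iso_mult[OF \<Theta>(1) c] x j by (simp add: \<Theta>(2))
    ultimately show ?thesis by blast
  qed
  then obtain \<psi> w where \<psi>: "\<And>j. j \<in> I \<Longrightarrow> \<psi> j \<in> I" "\<And>j. j \<in> I \<Longrightarrow> w j \<in> carrier G"
    "\<And>j. j \<in> I \<Longrightarrow> \<Theta> (j, \<one>, l1) = (\<psi> j, w j, \<pi> l1)"
    by metis
  have P: "\<theta> (P l j) = P (\<pi> l) (\<psi> j) \<otimes> w j" if "l \<in> L" "j \<in> I" for l j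
    using iso_mult[OF \<Theta>(1), of "(i1, \<one>, l)" "(j, \<one>, l1)"] that \<psi>[OF that(2)]
    by (simp add: \<Theta>(2) \<theta>1 \<pi>L)
  have w: "w j = inv (P (\<pi> l1) (\<psi> j))" if j: "j \<in> I" for j
  proof -
    have "inv (w j) = P (\<pi> l1) (\<psi> j)"
      using P[of l1 j] j \<psi>[OF j] by (intro inv_equality) (simp_all add: \<theta>1 \<pi>L)
    then show ?thesis using \<psi>(2)[OF j] by (metis inv_inv)
  qed
  have "inj_on \<psi> I"
  proof (rule inj_onI)
    fix j k assume jk: "j \<in> I" "k \<in> I" "\<psi> j = \<psi> k"
    then have "\<Theta> (j, \<one>, l1) = \<Theta> (k, \<one>, l1)" by (simp add: \<psi>(3) w)
    then have "(j, \<one>, l1) = (k, \<one>, l1)"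
      using iso_bij_betw[OF \<Theta>(1)] jk by (auto simp: bij_betw_def dest: inj_onD)
    then show "j = k" by simp
  qed
  then have "bij_betw \<psi> I I"
    using finite_I \<psi>(1) by (intro bij_betw_imageI endo_inj_surj) auto
  moreover have "\<psi> i1 = i1" using \<psi>(3)[of i1] \<Theta>(2)[of \<one> l1] by simp
  ultimately show ?thesis using that P w by metis
qed

text \<open>The left-right dual, on \<open>I \<times> G \<times> {l1}\<close>, with a left zero band
  in place of the right zero one. As \<open>G\<close> need not be commutative, it matters that the
  correcting factor now stands on the left.\<close>

lemma column_permutation:
  assumes \<pi>: "bij_betw \<pi> I I" and \<theta>: "\<theta> \<in> iso G G"
  obtains \<psi> where "bij_betw \<psi> L L" "\<psi> l1 = l1"
    "\<And>l j. l \<in> L \<Longrightarrow> j \<in> I \<Longrightarrow> \<theta> (P l j) = inv (P (\<psi> l) (\<pi> i1)) \<otimes> P (\<psi> l) (\<pi> j)"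
proof -
  have \<pi>I: "\<pi> i \<in> I" if "i \<in> I" for i using \<pi> that bij_betwE by blast
  have \<theta>G: "\<theta> g \<in> carrier G" if "g \<in> carrier G" for g using \<theta> that by (rule iso_in_carrier)
  have \<theta>1: "\<theta> \<one> = \<one>" using \<theta> by (simp add: iso_def hom_one)
  let ?A = "I \<times> carrier G \<times> {l1}"
  have sub: "subsemigroup ?A R" using one_closed base by (auto simp: subsemigroup_def simp del: one_closed base)
  have bij: "bij_betw (map_prod \<pi> (map_prod \<theta> id)) ?A ?A"
    using iso_bij_betw[OF \<theta>] \<pi> by (intro bij_betw_map_prod) auto
  obtain \<Theta> where \<Theta>: "\<Theta> \<in> iso R R"
    "\<And>g i. g \<in> carrier G \<Longrightarrow> i \<in> I \<Longrightarrow> \<Theta> (i, g, l1) = (\<pi> i, \<theta> g, l1)"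
    by (rule extend[OF sub sub bij]) (use \<pi>I iso_mult[OF \<theta>] \<theta>G in auto)
  have "\<exists>k w. k \<in> L \<and> w \<in> carrier G \<and> \<Theta> (i1, \<one>, l) = (\<pi> i1, w, k)" if l: "l \<in> L" for l
  proof -
    have c: "(i1, \<one>, l1) \<in> carrier R" "(i1, \<one>, l) \<in> carrier R" using l by auto
    obtain i w k where x: "\<Theta> (i1, \<one>, l) = (i, w, k)" "k \<in> L" "w \<in> carrier G"
      using iso_in_carrier[OF \<Theta>(1) c(2)] by auto
    moreover have "i = \<pi> i1" using iso_mult[OF \<Theta>(1) c] x l by (simp add: \<Theta>(2))
    ultimately show ?thesis by blast
  qed
  then obtain \<psi> w where \<psi>: "\<And>l. l \<in> L \<Longrightarrow> \<psi> l \<in> L" "\<And>l. l \<in> L \<Longrightarrow> w l \<in> carrier G"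
    "\<And>l. l \<in> L \<Longrightarrow> \<Theta> (i1, \<one>, l) = (\<pi> i1, w l, \<psi> l)"
    by metis
  have P: "\<theta> (P l j) = w l \<otimes> P (\<psi> l) (\<pi> j)" if "l \<in> L" "j \<in> I" for l j
    using iso_mult[OF \<Theta>(1), of "(i1, \<one>, l)" "(j, \<one>, l1)"] that \<psi>[OF that(1)]
    by (simp add: \<Theta>(2) \<theta>1 \<pi>I)
  have w: "w l = inv (P (\<psi> l) (\<pi> i1))" if "l \<in> L" for l
    using P[of l i1] that \<psi>[OF that] by (intro inv_equality[symmetric]) (simp_all add: \<theta>1 \<pi>I)
  have "inj_on \<psi> L"
  proof (rule inj_onI)
    fix j k assume jk: "j \<in> L" "k \<in> L" "\<psi> j = \<psi> k"
    then have "\<Theta> (i1, \<one>, j) = \<Theta> (i1, \<one>, k)" by (simp add: \<psi>(3) w)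
    then have "(i1, \<one>, j) = (i1, \<one>, k)"
      using iso_bij_betw[OF \<Theta>(1)] jk by (auto simp: bij_betw_def dest: inj_onD)
    then show "j = k" by simp
  qed
  then have "bij_betw \<psi> L L"
    using finite_L \<psi>(1) by (intro bij_betw_imageI endo_inj_surj) auto
  moreover have "\<psi> l1 = l1" using \<psi>(3)[of l1] \<Theta>(2)[of \<one> i1] by simp
  ultimately show ?thesis using that P w by metis
qed

end

section \<open>Classification of the sandwich matrices\<close>

definition two_valued_matrix :: "'g \<Rightarrow> 'g \<Rightarrow> 'g \<Rightarrow> nat \<Rightarrow> nat \<Rightarrow> 'g" where
  "two_valued_matrix u a b l i = (if l = 1 \<or> i = 1 then u else if l = i then b else a)"

text \<open>
  These are the parameters for which \<open>two_valued_matrix \<one> a b\<close> on \<open>{1..N}\<close> is the character table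
  of \<open>\<int>\<^sub>2\<close>, \<open>\<int>\<^sub>3\<close> or \<open>\<int>\<^sub>2 \<times> \<int>\<^sub>2\<close>, with \<open>\<pm>1\<close> or the cube roots of unity replaced by powers of \<open>a\<close>.
\<close>

definition character_table_parameters :: "('g, 'm) monoid_scheme \<Rightarrow> nat \<Rightarrow> 'g \<Rightarrow> 'g \<Rightarrow> bool" where
  "character_table_parameters G N a b \<longleftrightarrow>
     a \<in> carrier G \<and> a \<noteq> \<one>\<^bsub>G\<^esub> \<and>
     (N = 2 \<and> b = a \<and> a \<otimes>\<^bsub>G\<^esub> a = \<one>\<^bsub>G\<^esub> \<or>
      N = 3 \<and> b = inv\<^bsub>G\<^esub> a \<and> a \<otimes>\<^bsub>G\<^esub> a = inv\<^bsub>G\<^esub> a \<or>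
      N = 4 \<and> b = \<one>\<^bsub>G\<^esub> \<and> a \<otimes>\<^bsub>G\<^esub> a = \<one>\<^bsub>G\<^esub>)"

text \<open>The rows off the base are numbered \<open>2..N\<close> arbitrarily and the columns
  through the matching \<open>f\<close>, which thereby becomes the diagonal.\<close>

lemma canonical_relabelling:
  fixes P :: "'l \<Rightarrow> 'i \<Rightarrow> 'g"
  assumes "finite L" "l1 \<in> L" "i1 \<in> I"
    and f: "bij_betw f (L - {l1}) (I - {i1})"
    and P: "\<And>x y. x \<in> L - {l1} \<Longrightarrow> y \<in> L - {l1} \<Longrightarrow> P y (f x) = (if y = x then b else a)"
    and base: "\<And>i. i \<in> I \<Longrightarrow> P l1 i = u" "\<And>l. l \<in> L \<Longrightarrow> P l i1 = u"
  shows "\<exists>f g. bij_betw f {1..card L} I \<and> bij_betw g {1..card L} L \<and>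
    (\<forall>l\<in>{1..card L}. \<forall>i\<in>{1..card L}. P (g l) (f i) = two_valued_matrix u a b l i)"
proof -
  let ?N = "card L"
  have "card (L - {l1}) = card {2..?N}" using assms(1,2) by simp
  then obtain h where h: "bij_betw h {2..?N} (L - {l1})"
    using finite_same_card_bij[of "{2..?N}" "L - {l1}"] assms(1) by auto
  have "?N > 0" using assms(1,2) card_gt_0_iff by blast
  then have split: "{1..?N} = {1} \<union> {2..?N}" by auto
  define g where "g k = (if k = 1 then l1 else h k)" for k
  define f' where "f' k = (if k = 1 then i1 else f (h k))" for k
  have "bij_betw g {2..?N} (L - {l1})" using h by (rule bij_betw_cong[THEN iffD1, rotated]) (auto simp: g_def)
  moreover have "bij_betw g {1} {l1}" by (simp add: g_def)
  ultimately have g: "bij_betw g {1..?N} L"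
    unfolding split using assms(2,3) bij_betw_combine[of g "{1}" "{l1}" "{2..?N}" "L - {l1}"]
    by (simp add: insert_absorb)
  have "bij_betw f' {2..?N} (I - {i1})"
    using bij_betw_trans[OF h f] by (rule bij_betw_cong[THEN iffD1, rotated]) (auto simp: f'_def)
  moreover have "bij_betw f' {1} {i1}" by (simp add: f'_def)
  ultimately have f': "bij_betw f' {1..?N} I"
    unfolding split using assms(2,3) bij_betw_combine[of f' "{1}" "{i1}" "{2..?N}" "I - {i1}"]
    by (simp add: insert_absorb)
  have M: "P (g l) (f' i) = two_valued_matrix u a b l i" if "l \<in> {1..?N}" "i \<in> {1..?N}" for l i
  proof (cases "l = 1 \<or> i = 1")
    case True
    have "g l \<in> L" "f' i \<in> I" using f' g that bij_betwE by blast+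
    with True base show ?thesis by (auto simp: two_valued_matrix_def g_def f'_def)
  next
    case False
    with that have "l \<in> {2..?N}" "i \<in> {2..?N}" by auto
    then have "h l \<in> L - {l1}" "h i \<in> L - {l1}" "h l = h i \<longleftrightarrow> l = i"
      using bij_betwE[OF h] inj_on_eq_iff[OF bij_betw_imp_inj_on[OF h]] by blast+
    with False show ?thesis by (simp add: two_valued_matrix_def g_def f'_def P)
  qed
  then show ?thesis using f' g by blast
qed

lemma bij_betw_pointed:
  assumes "bij_betw f A A" "x \<in> A" "f x = x"
  shows "bij_betw f (A - {x}) (A - {x})"
  using bij_betw_DiffI[OF assms(1), of "{x}" "{x}"] assms by (simp add: bij_betw_def)

section \<open>Symmetries of the rows and columns\<close>

context homogeneous_rees_matrix
begin

text \<open>A permutation of the rows carries the pair \<open>l1\<close>, \<open>\<nu>\<close> to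
  the pair \<open>l\<close>, \<open>m\<close>. Up to a permutation of columns,
  \<open>P \<nu> i\<close> is then the quotient of two entries in the same column of the equal rows
  \<open>m\<close> and \<open>l\<close>.\<close>

lemma equal_rows_imp_trivial:
  assumes "l \<in> L" "m \<in> L" "l \<noteq> m" "\<And>j. j \<in> I \<Longrightarrow> P l j = P m j" and \<nu>: "\<nu> \<in> L" "i \<in> I"
  shows "P \<nu> i = \<one>"
proof (cases "\<nu> = l1")
  case False
  let ?\<tau> = "Transposition.transpose l1 l"
  \<comment> \<open>\<open>?\<tau>\<close> takes \<open>l1\<close> to \<open>l\<close>; the second
    transposition takes the image of \<open>\<nu>\<close> to \<open>m\<close> and leaves
    \<open>l\<close> alone.\<close>
  let ?\<pi> = "Transposition.transpose m (?\<tau> \<nu>) \<circ> ?\<tau>"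
  have "?\<tau> \<nu> \<in> L" using assms by (auto simp: Transposition.transpose_def)
  then have "bij_betw ?\<pi> L L" using assms by (intro bij_betw_trans[of _ L L]) auto
  then obtain \<psi> where \<psi>: "bij_betw \<psi> I I"
    "\<And>l j. l \<in> L \<Longrightarrow> j \<in> I \<Longrightarrow> P l j = P (?\<pi> l) (\<psi> j) \<otimes> inv (P (?\<pi> l1) (\<psi> j))"
    using row_permutation[OF _ iso_set_refl] by blast
  have "?\<tau> \<nu> \<noteq> l" using False by (auto simp: Transposition.transpose_def)
  then have "?\<pi> l1 = l" using \<open>l \<noteq> m\<close> by simp
  moreover have "?\<pi> \<nu> = m" by simp
  moreover have "\<psi> i \<in> I" using \<psi>(1) \<nu>(2) bij_betwE by blast
  ultimately show ?thesis using \<psi>(2)[OF \<nu>] assms by simp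
qed (use \<nu> in simp)

lemma equal_columns_imp_trivial:
  assumes "j \<in> I" "k \<in> I" "j \<noteq> k" "\<And>l. l \<in> L \<Longrightarrow> P l j = P l k" and \<nu>: "\<nu> \<in> I" "l \<in> L"
  shows "P l \<nu> = \<one>"
proof (cases "\<nu> = i1")
  case False
  let ?\<tau> = "Transposition.transpose i1 j"
  let ?\<pi> = "Transposition.transpose k (?\<tau> \<nu>) \<circ> ?\<tau>"
  have "?\<tau> \<nu> \<in> I" using assms by (auto simp: Transposition.transpose_def)
  then have "bij_betw ?\<pi> I I" using assms by (intro bij_betw_trans[of _ I I]) auto
  then obtain \<psi> where \<psi>: "bij_betw \<psi> L L"
    "\<And>l j. l \<in> L \<Longrightarrow> j \<in> I \<Longrightarrow> P l j = inv (P (\<psi> l) (?\<pi> i1)) \<otimes> P (\<psi> l) (?\<pi> j)"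
    using column_permutation[OF _ iso_set_refl] by blast
  have "?\<tau> \<nu> \<noteq> j" using False by (auto simp: Transposition.transpose_def)
  then have "?\<pi> i1 = j" using \<open>j \<noteq> k\<close> by simp
  moreover have "?\<pi> \<nu> = k" by simp
  moreover have "\<psi> l \<in> L" using \<psi>(1) \<nu>(2) bij_betwE by blast
  ultimately show ?thesis using \<psi>(2)[OF \<nu>(2,1)] assms by simp
qed (use \<nu> in simp)

text \<open>A permutation of the rows that fixes \<open>l1\<close> needs no renormalisation, since
  row \<open>l1\<close> is trivial; it simply permutes the columns of \<open>P'\<close>.\<close>

lemma columns_transposition_closed:
  assumes "i \<in> I - {i1}" "x \<in> L - {l1}" "y \<in> L - {l1}"
  shows "\<exists>j\<in>I - {i1}. \<forall>l\<in>L - {l1}. P l j = P (Transposition.transpose x y l) i"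
proof -
  let ?\<pi> = "Transposition.transpose x y"
  have "bij_betw ?\<pi> L L" using assms by auto
  then obtain \<psi> where \<psi>: "bij_betw \<psi> I I" "\<psi> i1 = i1"
    "\<And>l j. l \<in> L \<Longrightarrow> j \<in> I \<Longrightarrow> P l j = P (?\<pi> l) (\<psi> j) \<otimes> inv (P (?\<pi> l1) (\<psi> j))"
    using row_permutation[OF _ iso_set_refl] by blast
  have "?\<pi> l1 = l1" using assms by auto
  have "i \<in> \<psi> ` (I - {i1})"
    using bij_betw_pointed[OF \<psi>(1) _ \<psi>(2)] assms(1) by (simp add: bij_betw_def)
  then obtain j where j: "j \<in> I - {i1}" "\<psi> j = i" by blast
  have "P l j = P (?\<pi> l) i" if "l \<in> L - {l1}" for l
  proof -
    have "?\<pi> l \<in> L" using that assms by (auto simp: Transposition.transpose_def)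
    then show ?thesis
      using \<psi>(3)[of l j] j that assms \<open>?\<pi> l1 = l1\<close> by simp
  qed
  with j(1) show ?thesis by blast
qed

lemma rows_transposition_closed:
  assumes "l \<in> L - {l1}" "x \<in> I - {i1}" "y \<in> I - {i1}"
  shows "\<exists>k\<in>L - {l1}. \<forall>i\<in>I - {i1}. P k i = P l (Transposition.transpose x y i)"
proof -
  let ?\<pi> = "Transposition.transpose x y"
  have "bij_betw ?\<pi> I I" using assms by auto
  then obtain \<psi> where \<psi>: "bij_betw \<psi> L L" "\<psi> l1 = l1"
    "\<And>l j. l \<in> L \<Longrightarrow> j \<in> I \<Longrightarrow> P l j = inv (P (\<psi> l) (?\<pi> i1)) \<otimes> P (\<psi> l) (?\<pi> j)"
    using column_permutation[OF _ iso_set_refl] by blast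
  have "?\<pi> i1 = i1" using assms by auto
  have "l \<in> \<psi> ` (L - {l1})"
    using bij_betw_pointed[OF \<psi>(1) _ \<psi>(2)] assms(1) by (simp add: bij_betw_def)
  then obtain k where k: "k \<in> L - {l1}" "\<psi> k = l" by blast
  have "P k i = P l (?\<pi> i)" if "i \<in> I - {i1}" for i
  proof -
    have "?\<pi> i \<in> I" using that assms by (auto simp: Transposition.transpose_def)
    then show ?thesis
      using \<psi>(3)[of k i] k that assms \<open>?\<pi> i1 = i1\<close> by simp
  qed
  with k(1) show ?thesis by blast
qed

text \<open>The exchange of columns \<open>i\<close> and \<open>j\<close> is undone by a permutation
  of the rows, to which a constant column \<open>i\<close> is insensitive; so both columns would be
  equal and \<open>P\<close> trivial. The second column is essential: a \<open>P'\<close> with a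
  single entry has a constant column.\<close>

lemma nonconstant_column:
  assumes nt: "l0 \<in> L" "i0 \<in> I" "P l0 i0 \<noteq> \<one>"
    and i: "i \<in> I - {i1}" and j: "j \<in> I - {i1}" "i \<noteq> j"
  obtains u v where "u \<in> L - {l1}" "v \<in> L - {l1}" "P u i \<noteq> P v i"
proof (rule ccontr)
  assume "\<not> thesis"
  then have const: "P u i = P v i" if "u \<in> L - {l1}" "v \<in> L - {l1}" for u v
    using that \<open>\<And>v u. \<lbrakk>u \<in> L - {l1}; v \<in> L - {l1}; P u i \<noteq> P v i\<rbrakk> \<Longrightarrow> thesis\<close> by blast
  let ?\<pi> = "Transposition.transpose i j"
  have "bij_betw ?\<pi> I I" using i j by auto
  then obtain \<psi> where \<psi>: "bij_betw \<psi> L L" "\<psi> l1 = l1"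
    "\<And>l j. l \<in> L \<Longrightarrow> j \<in> I \<Longrightarrow> P l j = inv (P (\<psi> l) (?\<pi> i1)) \<otimes> P (\<psi> l) (?\<pi> j)"
    using column_permutation[OF _ iso_set_refl] by blast
  have "?\<pi> i1 = i1" using i j by auto
  have "P l i = P l j" if l: "l \<in> L" for l
  proof (cases "l = l1")
    case False
    have *: "\<psi> l \<in> L - {l1}"
      using bij_betwE[OF bij_betw_pointed[OF \<psi>(1) base(2) \<psi>(2)]] l False by blast
    have "P l j = P (\<psi> l) i" using \<psi>(3)[of l j] l i j * \<open>?\<pi> i1 = i1\<close> by simp
    also have "\<dots> = P l i" using const[OF *, of l] l False by simp
    finally show ?thesis ..
  qed (use i j in simp)
  then show False using equal_columns_imp_trivial[of i j i0 l0] i j nt by auto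
qed

lemma nonconstant_row:
  assumes nt: "l0 \<in> L" "i0 \<in> I" "P l0 i0 \<noteq> \<one>"
    and l: "l \<in> L - {l1}" and m: "m \<in> L - {l1}" "l \<noteq> m"
  obtains u v where "u \<in> I - {i1}" "v \<in> I - {i1}" "P l u \<noteq> P l v"
proof (rule ccontr)
  assume "\<not> thesis"
  then have const: "P l u = P l v" if "u \<in> I - {i1}" "v \<in> I - {i1}" for u v
    using that \<open>\<And>v u. \<lbrakk>u \<in> I - {i1}; v \<in> I - {i1}; P l u \<noteq> P l v\<rbrakk> \<Longrightarrow> thesis\<close> by blast
  let ?\<pi> = "Transposition.transpose l m"
  have "bij_betw ?\<pi> L L" using l m by auto
  then obtain \<psi> where \<psi>: "bij_betw \<psi> I I" "\<psi> i1 = i1"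
    "\<And>l j. l \<in> L \<Longrightarrow> j \<in> I \<Longrightarrow> P l j = P (?\<pi> l) (\<psi> j) \<otimes> inv (P (?\<pi> l1) (\<psi> j))"
    using row_permutation[OF _ iso_set_refl] by blast
  have "?\<pi> l1 = l1" using l m by auto
  have "P l i = P m i" if i: "i \<in> I" for i
  proof (cases "i = i1")
    case False
    have *: "\<psi> i \<in> I - {i1}"
      using bij_betwE[OF bij_betw_pointed[OF \<psi>(1) base(1) \<psi>(2)]] i False by blast
    have "P m i = P l (\<psi> i)" using \<psi>(3)[of m i] i l m * \<open>?\<pi> l1 = l1\<close> by simp
    also have "\<dots> = P l i" using const[OF *, of i] i False by simp
    finally show ?thesis ..
  qed (use l m in simp)
  then show False using equal_rows_imp_trivial[of l m l0 i0] l m nt by auto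
qed

text \<open>The counting is used in both directions: closure of the rows bounds
  \<open>card I\<close> by \<open>card L\<close>, and under this bound closure of the columns gives
  the matching. If \<open>P'\<close> has one entry, there is no value off the matching and
  \<open>a\<close> is set to \<open>b\<close> by convention; the last clause records that this is
  the only coincidence.\<close>

lemma matching:
  assumes nt: "l0 \<in> L" "i0 \<in> I" "P l0 i0 \<noteq> \<one>"
  obtains f b a where "bij_betw f (L - {l1}) (I - {i1})"
    "\<And>x y. x \<in> L - {l1} \<Longrightarrow> y \<in> L - {l1} \<Longrightarrow> P y (f x) = (if y = x then b else a)"
    "a = b \<longleftrightarrow> (\<exists>x. L - {l1} = {x})"
proof -
  have l0: "l0 \<in> L - {l1}" and i0: "i0 \<in> I - {i1}" using nt by auto
  show ?thesis
  proof (cases "L - {l1} = {l0} \<and> I - {i1} = {i0}")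
    case True
    then show ?thesis by (intro that[of "\<lambda>_. i0" "P l0 i0" "P l0 i0"]) (auto simp: bij_betw_def)
  next
    case False
    \<comment> \<open>A single row or a single column is excluded here: the columns, respectively
      rows, would be constant.\<close>
    have *: "\<exists>m. m \<in> L - {l1} \<and> m \<noteq> l0 \<and> (\<exists>j. j \<in> I - {i1} \<and> j \<noteq> i0)"
    proof (cases "L - {l1} = {l0}")
      case True
      with False i0 obtain j where j: "j \<in> I - {i1}" "i0 \<noteq> j" by blast
      obtain u v where "u \<in> L - {l1}" "v \<in> L - {l1}" "P u i0 \<noteq> P v i0"
        using nonconstant_column[OF nt i0 j] .
      with True show ?thesis by auto
    next
      case False
      with l0 obtain m where m: "m \<in> L - {l1}" "l0 \<noteq> m" by blast
      obtain u v where "u \<in> I - {i1}" "v \<in> I - {i1}" "P l0 u \<noteq> P l0 v"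
        using nonconstant_row[OF nt l0 m] .
      with m show ?thesis by metis
    qed
    then obtain m j where mj: "m \<in> L - {l1}" "l0 \<noteq> m" "j \<in> I - {i1}" "i0 \<noteq> j"
      by blast
    obtain u v where uv: "u \<in> I - {i1}" "v \<in> I - {i1}" "P l0 u \<noteq> P l0 v"
      using nonconstant_row[OF nt l0 mj(1,2)] .
    obtain u' v' where uv': "u' \<in> L - {l1}" "v' \<in> L - {l1}" "P u' i0 \<noteq> P v' i0"
      using nonconstant_column[OF nt i0 mj(3,4)] .
    have fin: "finite (I - {i1})" "finite (L - {l1})" using finite_I finite_L by auto
    have "card (I - {i1}) \<le> card (L - {l1})"
      using card_le_transposition_closed[OF fin rows_transposition_closed l0 uv] .
    then obtain a b f where "a \<noteq> b" "bij_betw f (L - {l1}) (I - {i1})"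
      "\<And>x y. x \<in> L - {l1} \<Longrightarrow> y \<in> L - {l1} \<Longrightarrow> P y (f x) = (if y = x then b else a)"
      using transposition_closed_matching[of "L - {l1}" "I - {i1}" "\<lambda>i l. P l i",
          OF fin(2,1) columns_transposition_closed i0 uv'] by blast
    moreover have "\<not> (\<exists>x. L - {l1} = {x})" using l0 mj(1,2) by (metis singletonD)
    ultimately show ?thesis using that by blast
  qed
qed

text \<open>
  Renormalising at the row \<open>x\<close> instead of \<open>l1\<close> permutes the columns, so the quotients
  \<open>P y k / P x k\<close> are, up to the order of the columns, the entries of row \<open>y\<close>.
\<close>

lemma renormalised_row:
  assumes x: "x \<in> L - {l1}"
  obtains \<chi> where "bij_betw \<chi> (I - {i1}) (I - {i1})"
    "\<And>k. k \<in> I - {i1} \<Longrightarrow> P x (\<chi> k) = inv (P x k)"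
    "\<And>y k. y \<in> L - {l1} \<Longrightarrow> y \<noteq> x \<Longrightarrow> k \<in> I - {i1} \<Longrightarrow> P y (\<chi> k) = P y k \<otimes> inv (P x k)"
proof -
  let ?\<pi> = "Transposition.transpose l1 x"
  have "bij_betw ?\<pi> L L" using x by auto
  then obtain \<psi> where \<psi>: "bij_betw \<psi> I I" "\<psi> i1 = i1"
    "\<And>l j. l \<in> L \<Longrightarrow> j \<in> I \<Longrightarrow> P l j = P (?\<pi> l) (\<psi> j) \<otimes> inv (P (?\<pi> l1) (\<psi> j))"
    using row_permutation[OF _ iso_set_refl] by blast
  have b: "bij_betw \<psi> (I - {i1}) (I - {i1})" using bij_betw_pointed[OF \<psi>(1) _ \<psi>(2)] by simp
  let ?\<chi> = "inv_into (I - {i1}) \<psi>"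
  have \<chi>: "?\<chi> k \<in> I - {i1}" "\<psi> (?\<chi> k) = k" if "k \<in> I - {i1}" for k
    using bij_betwE[OF bij_betw_inv_into[OF b]] bij_betw_inv_into_right[OF b] that by blast+
  show ?thesis
  proof (rule that)
    show "bij_betw ?\<chi> (I - {i1}) (I - {i1})" using b by (rule bij_betw_inv_into)
    show "P x (?\<chi> k) = inv (P x k)" if "k \<in> I - {i1}" for k
      using \<psi>(3)[of x "?\<chi> k"] \<chi>[OF that] that x by simp
    show "P y (?\<chi> k) = P y k \<otimes> inv (P x k)" if "y \<in> L - {l1}" "y \<noteq> x" "k \<in> I - {i1}" for y k
      using \<psi>(3)[of y "?\<chi> k"] \<chi>[OF that(3)] that x by simp
  qed
qed

lemma div_eq_self: "\<lbrakk>x \<in> carrier G; y \<in> carrier G; x = x \<otimes> inv y\<rbrakk> \<Longrightarrow> y = \<one>"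
  by (metis inv_closed inv_eq_1_iff l_cancel_one')

lemma div_eq_imp: "\<lbrakk>x \<in> carrier G; y \<in> carrier G; z = x \<otimes> inv y\<rbrakk> \<Longrightarrow> x = z \<otimes> y"
  by (simp add: m_assoc)

text \<open>Row \<open>m\<close> is compared with its quotient by row \<open>l0\<close>, which has
  \<open>b/a\<close> in column \<open>f m\<close>, \<open>a/b\<close> in column \<open>f l0\<close>
  and the identity in all others. By means of \<open>\<chi>\<close> the quotient is a rearrangement
  of row \<open>m\<close>, with a single entry \<open>b\<close>.\<close>

lemma matching_parameters:
  assumes nt: "l0 \<in> L" "i0 \<in> I" "P l0 i0 \<noteq> \<one>"
    and f: "bij_betw f (L - {l1}) (I - {i1})"
    and P: "\<And>x y. x \<in> L - {l1} \<Longrightarrow> y \<in> L - {l1} \<Longrightarrow> P y (f x) = (if y = x then b else a)"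
    and ab: "a = b \<longleftrightarrow> (\<exists>x. L - {l1} = {x})"
  shows "character_table_parameters G (card L) a b"
proof -
  have l0: "l0 \<in> L - {l1}" using nt by auto
  have cardL: "card L = Suc (card (L - {l1}))"
    using finite_L by (metis base(2) card.remove)
  have finL: "finite (L - {l1})" using finite_L by simp
  have fI: "f x \<in> I - {i1}" if "x \<in> L - {l1}" for x using f that bij_betwE by blast
  have bG: "b \<in> carrier G" using P[OF l0 l0] fI[OF l0] l0 P_closed[of l0 "f l0"] by auto
  have surj: "\<exists>x\<in>L - {l1}. k = f x" if "k \<in> I - {i1}" for k using f that by (auto simp: bij_betw_def)
  have inj: "f x = f y \<longleftrightarrow> x = y" if "x \<in> L - {l1}" "y \<in> L - {l1}" for x y
    using f that by (auto simp: bij_betw_def dest: inj_onD)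
  obtain \<chi> where \<chi>: "bij_betw \<chi> (I - {i1}) (I - {i1})"
    "\<And>k. k \<in> I - {i1} \<Longrightarrow> P l0 (\<chi> k) = inv (P l0 k)"
    "\<And>y k. y \<in> L - {l1} \<Longrightarrow> y \<noteq> l0 \<Longrightarrow> k \<in> I - {i1} \<Longrightarrow> P y (\<chi> k) = P y k \<otimes> inv (P l0 k)"
    using renormalised_row[OF l0] by blast
  have \<chi>I: "\<chi> k \<in> I - {i1}" if "k \<in> I - {i1}" for k using \<chi>(1) that bij_betwE by blast
  show ?thesis
  proof (cases "\<exists>x. L - {l1} = {x}")
    case True
    have "L - {l1} = {l0}" using True l0 by (metis singletonD)
    moreover have "a = b" using True ab by simp
    ultimately have L: "L - {l1} = {l0}" "a = b" by auto
    then have I: "I - {i1} = {f l0}" using f by (auto simp: bij_betw_def)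
    then have "i0 = f l0" using nt by (cases "i0 = i1") auto
    then have "b \<noteq> \<one>" using nt P[OF l0 l0] by simp
    moreover have "\<chi> (f l0) = f l0" using \<chi>I[of "f l0"] I by auto
    then have "b = inv b" using \<chi>(2)[of "f l0"] P[OF l0 l0] I by auto
    then have "b \<otimes> b = \<one>" using bG r_inv[of b] by simp
    ultimately show ?thesis using L bG cardL by (simp add: character_table_parameters_def)
  next
    case False
    with ab have ab: "a \<noteq> b" by simp
    have "L - {l1} \<noteq> {l0}" using False by metis
    with l0 obtain m where m: "m \<in> L - {l1}" "m \<noteq> l0" by blast
    have aG: "a \<in> carrier G" using P[OF l0 m(1)] fI[OF l0] l0 m P_closed[of m "f l0"] by auto
    \<comment> \<open>\<open>?D x\<close> is the entry of row \<open>m\<close> in column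
      \<open>\<chi> (f x)\<close>; as \<open>\<chi>\<close> is injective, at most one
      \<open>x\<close> hits the matching.\<close>
    let ?D = "\<lambda>x. if \<chi> (f x) = f m then b else a"
    have D: "?D x = P m (\<chi> (f x))" if x: "x \<in> L - {l1}" for x
      using surj[OF \<chi>I[OF fI[OF x]]] P inj m by auto
    have Dm: "?D m = b \<otimes> inv a"
      using D[OF m(1)] \<chi>(3)[OF m fI[OF m(1)]] P[OF m(1) m(1)] P[OF m(1) l0] m by simp
    have Dl: "?D l0 = a \<otimes> inv b"
      using D[OF l0] \<chi>(3)[OF m fI[OF l0]] P[OF l0 m(1)] P[OF l0 l0] m by simp
    have Dx: "?D x = \<one>" if x: "x \<in> L - {l1}" "x \<noteq> m" "x \<noteq> l0" for x
      using D[OF x(1)] \<chi>(3)[OF m fI[OF x(1)]] P[OF x(1) m(1)] P[OF x(1) l0] x aG by simp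
    have \<chi>inj: "x = y" if "x \<in> L - {l1}" "y \<in> L - {l1}" "\<chi> (f x) = f m" "\<chi> (f y) = f m" for x y
      using inj_onD[OF bij_betw_imp_inj_on[OF \<chi>(1)], of "f x" "f y"] fI[OF that(1)]
        fI[OF that(2)] inj[OF that(1,2)] that(3,4) by simp
    have ne: "b \<otimes> inv a \<noteq> \<one>" "a \<otimes> inv b \<noteq> \<one>"
      using ab aG bG div_eq_imp[of b a \<one>] div_eq_imp[of a b \<one>] by (metis l_one)+
    have card2: "card {l0, m} = 2" using m by simp
    show ?thesis
    proof (cases "L - {l1} = {l0, m}")
      case True
      have N: "card L = 3" using cardL True card2 by simp
      have "\<exists>x\<in>L - {l1}. \<chi> (f x) = f m"
        using \<chi>(1) f fI[OF m(1)] unfolding bij_betw_def by (metis imageE)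
      then consider "\<chi> (f m) = f m" "\<chi> (f l0) \<noteq> f m" | "\<chi> (f l0) = f m" "\<chi> (f m) \<noteq> f m"
        using True m \<chi>inj[OF l0 m(1)] by auto
      then show ?thesis
      proof cases
        case 1
        have "a = \<one>" using Dm unfolding if_P[OF 1(1)] by (rule div_eq_self[OF bG aG])
        moreover have "b = \<one>" using Dl unfolding if_not_P[OF 1(2)] by (rule div_eq_self[OF aG bG])
        ultimately show ?thesis using ab by simp
      next
        case 2
        have ba: "b = a \<otimes> a" using Dm unfolding if_not_P[OF 2(2)] by (rule div_eq_imp[OF bG aG])
        have "a = b \<otimes> b" using Dl unfolding if_P[OF 2(1)] by (rule div_eq_imp[OF aG bG])
        also have "\<dots> = a \<otimes> (a \<otimes> b)" using aG bG m_assoc[of a a b] ba by simp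
        finally have "a \<otimes> b = \<one>" using aG bG by (metis l_cancel_one' m_closed)
        then have "inv b = a" using bG aG by (rule inv_equality)
        then have "inv a = a \<otimes> a" using ba bG by (metis inv_inv)
        moreover have "a \<noteq> \<one>" using ab ba by auto
        ultimately show ?thesis
          using N aG ba by (simp add: character_table_parameters_def)
      qed
    next
      case False
      \<comment> \<open>For trivial \<open>a\<close> the quotients \<open>b/a\<close> and
        \<open>a/b\<close> both differ from \<open>a\<close>, so both would have to be the single
        occurrence of \<open>b\<close>.\<close>
      have a1: "a \<noteq> \<one>"
      proof
        assume "a = \<one>"
        then have "\<chi> (f m) = f m" "\<chi> (f l0) = f m" using Dm Dl ne by metis+
        with \<chi>inj[OF l0 m(1)] m(2) show False by simp
      qed
      \<comment> \<open>The identity is not \<open>a\<close>, so it is \<open>b\<close>, and the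
        single occurrence of \<open>b\<close> allows only one row besides \<open>l0\<close> and
        \<open>m\<close>.\<close>
      have x: "\<chi> (f x) = f m \<and> b = \<one>" if "x \<in> L - {l1}" "x \<noteq> m" "x \<noteq> l0" for x
        using Dx[OF that] a1 by metis
      obtain x where x': "x \<in> L - {l1}" "x \<noteq> m" "x \<noteq> l0" using False l0 m by blast
      have "L - {l1} = {x, l0, m}" using x x' \<chi>inj l0 m by blast
      then have N: "card L = 4" using cardL x' m by simp
      have "\<chi> (f m) \<noteq> f m" using \<chi>inj[OF m(1) x'(1)] x[OF x'] x' by blast
      then have "a = b \<otimes> inv a" using Dm by metis
      then have "b = a \<otimes> a" by (rule div_eq_imp[OF bG aG])
      then have "a \<otimes> a = \<one>" using x[OF x'] by metis
      then show ?thesis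
        using N aG a1 x[OF x'] by (simp add: character_table_parameters_def)
    qed
  qed
qed

text \<open>With the identity as permutation of the rows, the correcting factor comes from the
  trivial row \<open>l1\<close>, so \<open>\<theta>\<close> only permutes the entries of each row.
  This is why \<open>H\<close> is characteristic.\<close>

lemma automorphism_preserves_entries:
  assumes "\<theta> \<in> iso G G" "E = (\<Union>l\<in>L. P l ` I)"
  shows "\<theta> ` E = E"
proof -
  obtain \<psi> where \<psi>: "bij_betw \<psi> I I"
    "\<And>l j. l \<in> L \<Longrightarrow> j \<in> I \<Longrightarrow> \<theta> (P l j) = P l (\<psi> j) \<otimes> inv (P l1 (\<psi> j))"
    using row_permutation[of id, OF _ assms(1)] by (metis bij_betw_id id_apply)
  have \<psi>I: "\<psi> j \<in> I" if "j \<in> I" for j using \<psi>(1) that bij_betwE by blast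
  have "\<theta> ` E \<subseteq> E" using \<psi>(2) \<psi>I assms(2) by auto
  moreover have "finite E" using finite_I finite_L assms(2) by simp
  moreover have "inj_on \<theta> E"
    using iso_bij_betw[OF assms(1)] assms(2) by (auto simp: bij_betw_def intro: inj_on_subset)
  ultimately show ?thesis by (simp add: endo_inj_surj)
qed

theorem nontrivial_classification:
  assumes nt: "l0 \<in> L" "i0 \<in> I" "P l0 i0 \<noteq> \<one>"
  obtains N a b f g where "character_table_parameters G N a b"
    "bij_betw f {1..N} I" "bij_betw g {1..N} L"
    "\<And>l i. l \<in> {1..N} \<Longrightarrow> i \<in> {1..N} \<Longrightarrow> P (g l) (f i) = two_valued_matrix \<one> a b l i"
    "\<And>\<theta>. \<theta> \<in> iso G G \<Longrightarrow> \<theta> ` {\<one>, a, b} = {\<one>, a, b}"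
proof (rule matching[OF nt])
  fix f b a
  assume f: "bij_betw f (L - {l1}) (I - {i1})"
    and P: "\<And>x y. x \<in> L - {l1} \<Longrightarrow> y \<in> L - {l1} \<Longrightarrow> P y (f x) = (if y = x then b else a)"
    and ab: "a = b \<longleftrightarrow> (\<exists>x. L - {l1} = {x})"
  have ct: "character_table_parameters G (card L) a b"
    using nt f P ab by (rule matching_parameters)
  have l0: "l0 \<in> L - {l1}" using nt by auto
  let ?N = "card L"
  obtain f' g where f': "bij_betw f' {1..?N} I" and g: "bij_betw g {1..?N} L"
    and M: "\<forall>l\<in>{1..?N}. \<forall>i\<in>{1..?N}. P (g l) (f' i) = two_valued_matrix \<one> a b l i"
    using canonical_relabelling[OF finite_L base(2,1) f P P_base] by blast
  \<comment> \<open>All three values occur: \<open>a\<close> lies off the matching, or equals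
    \<open>b\<close> if \<open>P'\<close> has one entry.\<close>
  have E: "{\<one>, a, b} = (\<Union>l\<in>L. P l ` I)"
  proof
    have "a \<in> (\<Union>l\<in>L. P l ` I)" "b \<in> (\<Union>l\<in>L. P l ` I)"
    proof -
      have fI: "f x \<in> I" if "x \<in> L - {l1}" for x using f that bij_betwE by blast
      have "b = P l0 (f l0)" using P[OF l0 l0] by simp
      then show b: "b \<in> (\<Union>l\<in>L. P l ` I)" using fI[OF l0] nt(1) by blast
      show "a \<in> (\<Union>l\<in>L. P l ` I)"
      proof (cases "a = b")
        case False
        with ab have "L - {l1} \<noteq> {l0}" by metis
        with l0 obtain m where m: "m \<in> L - {l1}" "m \<noteq> l0" by blast
        then have "a = P m (f l0)" using P[OF l0 m(1)] by simp
        then show ?thesis using fI[OF l0] m(1) by blast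
      qed (use b in simp)
    qed
    moreover have "\<one> \<in> (\<Union>l\<in>L. P l ` I)"
      by (rule UN_I[OF base(2)], rule image_eqI[OF _ base(1)]) simp
    ultimately show "{\<one>, a, b} \<subseteq> (\<Union>l\<in>L. P l ` I)" by blast
    show "(\<Union>l\<in>L. P l ` I) \<subseteq> {\<one>, a, b}"
    proof
      fix x assume "x \<in> (\<Union>l\<in>L. P l ` I)"
      then obtain l i where li: "l \<in> L" "i \<in> I" "x = P l i" by blast
      then have "l \<in> g ` {1..?N}" "i \<in> f' ` {1..?N}" using f' g by (simp_all add: bij_betw_def)
      then obtain l' i' where "l = g l'" "i = f' i'" "l' \<in> {1..?N}" "i' \<in> {1..?N}" by blast
      with li M show "x \<in> {\<one>, a, b}" by (simp add: two_valued_matrix_def)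
    qed
  qed
  have inv: "\<theta> ` {\<one>, a, b} = {\<one>, a, b}" if "\<theta> \<in> iso G G" for \<theta>
    using that E by (rule automorphism_preserves_entries)
  have "P (g l) (f' i) = two_valued_matrix \<one> a b l i" if "l \<in> {1..?N}" "i \<in> {1..?N}" for l i
    using M that by blast
  then show ?thesis by (rule that[OF ct f' g _ inv])
qed

end

section \<open>Partial injections and subgroups in the finite case\<close>

lemma finite_injection_extends:
  assumes "finite A" "D \<subseteq> A" "inj_on f D" "f ` D \<subseteq> A"
  obtains \<rho> where "bij_betw \<rho> A A" "\<forall>x\<in>D. \<rho> x = f x"
proof -
  have fin: "finite D" using assms finite_subset by blast
  then have "card (f ` D) = card D" using assms(3) by (simp add: card_image)
  then have "card (A - D) = card (A - f ` D)"
    using assms fin by (simp add: card_Diff_subset)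
  then obtain h where h: "bij_betw h (A - D) (A - f ` D)"
    using finite_same_card_bij[of "A - D" "A - f ` D"] assms(1) by auto
  let ?\<rho> = "\<lambda>x. if x \<in> D then f x else h x"
  have "bij_betw ?\<rho> D (f ` D)"
    using assms(3) by (simp add: bij_betw_def inj_on_def)
  moreover have "bij_betw ?\<rho> (A - D) (A - f ` D)"
    using h by (rule bij_betw_cong[THEN iffD1, rotated]) auto
  ultimately have "bij_betw ?\<rho> (D \<union> (A - D)) (f ` D \<union> (A - f ` D))"
    by (rule bij_betw_combine) auto
  moreover have "D \<union> (A - D) = A" "f ` D \<union> (A - f ` D) = A" using assms by auto
  ultimately have "bij_betw ?\<rho> A A" by metis
  then show ?thesis by (rule that) simp
qed

text \<open>\<open>compat\<close> says at once that \<open>f\<close> and \<open>g\<close> agree on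
  \<open>D \<inter> E\<close> and that no further values coincide, so their union is an
  injection.\<close>

lemma finite_injections_common_extension:
  assumes "finite A" "D \<subseteq> A" "inj_on f D" "f ` D \<subseteq> A" "E \<subseteq> A" "inj_on g E" "g ` E \<subseteq> A"
    and compat: "\<And>x y. x \<in> E \<Longrightarrow> y \<in> D \<Longrightarrow> x = y \<longleftrightarrow> g x = f y"
  obtains \<rho> where "bij_betw \<rho> A A" "\<forall>x\<in>D. \<rho> x = f x" "\<forall>x\<in>E. \<rho> x = g x"
proof -
  let ?h = "\<lambda>x. if x \<in> D then f x else g x"
  have E: "?h x = g x" if "x \<in> E" for x using compat[OF that, of x] by auto
  have inj: "inj_on ?h (D \<union> E)"
  proof (rule inj_onI)
    fix x y assume "x \<in> D \<union> E" "y \<in> D \<union> E" "?h x = ?h y"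
    then show "x = y"
      using inj_onD[OF assms(3), of x y] inj_onD[OF assms(6), of x y] compat[of x y] compat[of y x]
      by (cases "x \<in> D"; cases "y \<in> D") simp_all
  qed
  have "?h ` (D \<union> E) \<subseteq> A" "D \<union> E \<subseteq> A" using assms(2,4,5,7) by auto
  then obtain \<rho> where "bij_betw \<rho> A A" "\<forall>x\<in>D \<union> E. \<rho> x = ?h x"
    using finite_injection_extends[OF assms(1) _ inj] by auto
  then show ?thesis using E by (intro that[of \<rho>]) simp_all
qed

context group
begin

lemma finite_closed_subset_subgroup:
  assumes "finite (carrier G)" "K \<subseteq> carrier G" "K \<noteq> {}"
    and closed: "\<And>x y. x \<in> K \<Longrightarrow> y \<in> K \<Longrightarrow> x \<otimes> y \<in> K"
  shows "subgroup K G"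
proof (rule subgroupI)
  fix x assume x: "x \<in> K"
  then have xG: "x \<in> carrier G" using assms by auto
  have "inj_on (\<lambda>y. x \<otimes> y) K"
    using inj_on_subset[OF inj_on_cmult[OF xG] assms(2)] by simp
  moreover have "finite K" using assms(1,2) finite_subset by blast
  moreover have "(\<lambda>y. x \<otimes> y) ` K \<subseteq> K" using x closed by auto
  ultimately have surj: "(\<lambda>y. x \<otimes> y) ` K = K" by (simp add: endo_inj_surj)
  then obtain y where y: "y \<in> K" "x = x \<otimes> y" using x by (metis imageE)
  then have "\<one> \<in> K" using assms(2) xG l_cancel_one'[of x y] by auto
  then obtain z where z: "z \<in> K" "\<one> = x \<otimes> z" using surj by (metis imageE)
  then have "inv z = x" using assms(2) xG by (intro inv_equality) auto
  then have "inv x = z" using z assms(2) inv_inv[of z] by auto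
  then show "inv x \<in> K" using z by simp
qed (use assms in auto)

lemma subgroup_imp_fg_subgroup:
  assumes "finite (carrier G)" "subgroup K G"
  shows "fg_subgroup K G"
proof -
  have K: "K \<subseteq> carrier G" using assms(2) by (rule subgroup.subset)
  then have "K = generate G K"
    using generateI[OF assms(2)] by blast
  with K assms(1) show ?thesis
    unfolding fg_subgroup_def by (intro exI[of _ K]) (auto intro: finite_subset)
qed

end

section \<open>Homogeneity of Rees matrix semigroups\<close>

context rees_matrix
begin

text \<open>The usual form of an automorphism of a Rees matrix semigroup. The factors
  \<open>u\<close> and \<open>v\<close> make up for the renormalisation when the base row or column
  is moved.\<close>

lemma rees_automorphism:
  assumes \<theta>: "\<theta> \<in> iso G G" and \<psi>: "bij_betw \<psi> I I" and \<pi>: "bij_betw \<pi> L L"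
    and u: "\<And>i. i \<in> I \<Longrightarrow> u i \<in> carrier G" and v: "\<And>l. l \<in> L \<Longrightarrow> v l \<in> carrier G"
    and P: "\<And>l i. l \<in> L \<Longrightarrow> i \<in> I \<Longrightarrow> \<theta> (P l i) = v l \<otimes> P (\<pi> l) (\<psi> i) \<otimes> u i"
  shows "(\<lambda>(i, g, l). (\<psi> i, u i \<otimes> \<theta> g \<otimes> v l, \<pi> l)) \<in> iso R R" (is "?f \<in> _")
proof (rule isoI)
  have \<psi>I: "\<psi> i \<in> I" if "i \<in> I" for i using \<psi> that bij_betwE by blast
  have \<pi>L: "\<pi> l \<in> L" if "l \<in> L" for l using \<pi> that bij_betwE by blast
  have \<theta>G: "\<theta> g \<in> carrier G" if "g \<in> carrier G" for g using \<theta> that by (rule iso_in_carrier)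
  show "?f \<in> hom R R"
  proof (rule homI)
    fix x assume "x \<in> carrier R"
    then show "?f x \<in> carrier R" using \<psi>I \<pi>L \<theta>G u v by (cases x) simp
  next
    fix x y assume "x \<in> carrier R" "y \<in> carrier R"
    then show "?f (x \<otimes>\<^bsub>R\<^esub> y) = ?f x \<otimes>\<^bsub>R\<^esub> ?f y"
      using \<psi>I \<pi>L \<theta>G u v
      by (cases x; cases y) (simp add: iso_mult[OF \<theta>] P m_assoc)
  qed
  have inj: "inj_on ?f (carrier R)"
  proof (rule inj_onI)
    fix x y assume "x \<in> carrier R" "y \<in> carrier R" "?f x = ?f y"
    moreover obtain i g l j h m where [simp]: "x = (i, g, l)" "y = (j, h, m)"
      by (cases x; cases y)
    ultimately have c: "i \<in> I" "g \<in> carrier G" "l \<in> L" "j \<in> I" "h \<in> carrier G" "m \<in> L"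
      and eq: "\<psi> i = \<psi> j" "u i \<otimes> \<theta> g \<otimes> v l = u j \<otimes> \<theta> h \<otimes> v m" "\<pi> l = \<pi> m"
      by simp_all
    have ij: "i = j" "l = m"
      using eq c inj_onD[OF bij_betw_imp_inj_on[OF \<psi>]] inj_onD[OF bij_betw_imp_inj_on[OF \<pi>]] by blast+
    with eq(2) c u v \<theta>G have "\<theta> g = \<theta> h" by (simp add: m_assoc)
    then have "g = h" using c inj_onD[OF bij_betw_imp_inj_on[OF iso_bij_betw[OF \<theta>]]] by blast
    with ij show "x = y" by simp
  qed
  have "?f x \<in> carrier R" if "x \<in> carrier R" for x
    using that \<psi>I \<pi>L \<theta>G u v by (cases x) simp
  then have "?f ` carrier R \<subseteq> carrier R" by blast
  then show "bij_betw ?f (carrier R) (carrier R)"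
    using inj finite_R by (intro bij_betw_imageI endo_inj_surj)
qed

text \<open>What homogeneity demands of the matrix once a partial isomorphism fixing the base
  idempotent is split into coordinates: the group part is already an automorphism
  \<open>\<theta>\<close> of \<open>G\<close>, only the maps of the index sets are partial.\<close>

definition "based_extension \<longleftrightarrow>
  (\<forall>I0 L0 \<psi> \<chi>. \<forall>\<theta>\<in>iso G G. I0 \<subseteq> I \<longrightarrow> i1 \<in> I0 \<longrightarrow> L0 \<subseteq> L \<longrightarrow> l1 \<in> L0 \<longrightarrow>
     inj_on \<psi> I0 \<longrightarrow> \<psi> ` I0 \<subseteq> I \<longrightarrow> \<psi> i1 = i1 \<longrightarrow> inj_on \<chi> L0 \<longrightarrow> \<chi> ` L0 \<subseteq> L \<longrightarrow> \<chi> l1 = l1 \<longrightarrow>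
     (\<forall>l\<in>L0. \<forall>i\<in>I0. \<theta> (P l i) = P (\<chi> l) (\<psi> i)) \<longrightarrow>
     (\<exists>\<psi>' \<chi>'. bij_betw \<psi>' I I \<and> bij_betw \<chi>' L L \<and> (\<forall>i\<in>I0. \<psi>' i = \<psi> i) \<and> (\<forall>l\<in>L0. \<chi>' l = \<chi> l) \<and>
        (\<forall>l\<in>L. \<forall>i\<in>I. \<theta> (P l i) = P (\<chi>' l) (\<psi>' i))))"

text \<open>The triples \<open>(i, inv (P l i), l)\<close> are exactly the idempotents of
  \<open>R\<close>.\<close>

definition "idempotent_transitive \<longleftrightarrow>
  (\<forall>i\<in>I. \<forall>l\<in>L. \<exists>\<alpha>\<in>iso R R. \<alpha> (i1, \<one>, l1) = (i, inv (P l i), l))"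

text \<open>Every element of \<open>A\<close> is the product of elements of \<open>A\<close> of the
  forms \<open>(i, \<one>, l1)\<close>, \<open>(i1, g, l1)\<close> and
  \<open>(i1, \<one>, l)\<close>. A map fixing the base idempotent preserves each of these forms, so
  it splits into \<open>\<psi>\<close>, \<open>\<tau>\<close> and \<open>\<chi>\<close>; homogeneity
  of \<open>G\<close> extends \<open>\<tau>\<close>, and \<open>based_extension\<close> extends the
  other two.\<close>

lemma extend_based:
  assumes G: "homogeneous_group G" and ext: based_extension
    and A: "subsemigroup A R" and B: "subsemigroup B R"
    and base_A: "(i1, \<one>, l1) \<in> A"
    and \<phi>: "bij_betw \<phi> A B" and \<phi>_mult: "\<And>x y. x \<in> A \<Longrightarrow> y \<in> A \<Longrightarrow> \<phi> (x \<otimes>\<^bsub>R\<^esub> y) = \<phi> x \<otimes>\<^bsub>R\<^esub> \<phi> y"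
    and \<phi>_base: "\<phi> (i1, \<one>, l1) = (i1, \<one>, l1)"
  shows "\<exists>\<theta>\<in>iso R R. \<forall>x\<in>A. \<theta> x = \<phi> x"
proof -
  let ?e = "(i1, \<one>, l1)"
  have AR: "x \<in> carrier R" if "x \<in> A" for x using A that by (auto simp: subsemigroup_def)
  have A_mult: "x \<otimes>\<^bsub>R\<^esub> y \<in> A" if "x \<in> A" "y \<in> A" for x y
    using A that by (auto simp: subsemigroup_def)
  have \<phi>R: "\<phi> x \<in> carrier R" if "x \<in> A" for x
    using B \<phi> that bij_betwE by (fastforce simp: subsemigroup_def)
  have \<phi>_inj: "x = y" if "x \<in> A" "y \<in> A" "\<phi> x = \<phi> y" for x y
    using \<phi> that by (auto simp: bij_betw_def dest: inj_onD)
  define I0 where "I0 = {i. (i, \<one>, l1) \<in> A}"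
  define L0 where "L0 = {l. (i1, \<one>, l) \<in> A}"
  define K where "K = {g. (i1, g, l1) \<in> A}"
  have sub: "I0 \<subseteq> I" "L0 \<subseteq> L" "K \<subseteq> carrier G"
    using AR by (fastforce simp: I0_def L0_def K_def)+
  have K: "subgroup K G"
  proof (rule finite_closed_subset_subgroup[OF finite_G sub(3)])
    show "K \<noteq> {}" using base_A by (auto simp: K_def)
    fix x y assume xy: "x \<in> K" "y \<in> K"
    then show "x \<otimes> y \<in> K"
      using A_mult[of "(i1, x, l1)" "(i1, y, l1)"] sub(3) by (auto simp: K_def)
  qed
  \<comment> \<open>Multiplication by the base idempotent on both sides gives
    \<open>(i1, g, l1)\<close>; the inverse of \<open>g\<close> in \<open>K\<close> then strips
    \<open>g\<close> from the other two factors.\<close>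
  have coords: "g \<in> K \<and> i \<in> I0 \<and> l \<in> L0" if x: "(i, g, l) \<in> A" for i g l
  proof -
    have c: "i \<in> I" "g \<in> carrier G" "l \<in> L" using AR[OF x] by auto
    have g: "g \<in> K" using A_mult[OF A_mult[OF base_A x] base_A] c by (simp add: K_def)
    then have k: "(i1, inv g, l1) \<in> A" using subgroup.m_inv_closed[OF K] by (simp add: K_def)
    have "i \<in> I0" using A_mult[OF A_mult[OF x base_A] k] c by (simp add: I0_def)
    moreover have "l \<in> L0" using A_mult[OF k A_mult[OF base_A x]] c by (simp add: L0_def)
    ultimately show ?thesis using g by blast
  qed
  have "\<exists>h. h \<in> carrier G \<and> \<phi> (i1, g, l1) = (i1, h, l1)" if g: "g \<in> K" for g
  proof -
    let ?x = "(i1, g, l1)"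
    have x: "?x \<in> A" using g by (simp add: K_def)
    obtain j h m where jhm: "\<phi> ?x = (j, h, m)" "j \<in> I" "h \<in> carrier G" "m \<in> L"
      using \<phi>R[OF x] by (cases "\<phi> ?x") auto
    have "g \<in> carrier G" using g sub by auto
    then have "\<phi> ?x = ?e \<otimes>\<^bsub>R\<^esub> \<phi> ?x" "\<phi> ?x = \<phi> ?x \<otimes>\<^bsub>R\<^esub> ?e"
      using \<phi>_mult[OF base_A x] \<phi>_mult[OF x base_A] \<phi>_base by simp_all
    with jhm show ?thesis by simp
  qed
  then obtain \<tau> where \<tau>: "\<And>g. g \<in> K \<Longrightarrow> \<tau> g \<in> carrier G"
    "\<And>g. g \<in> K \<Longrightarrow> \<phi> (i1, g, l1) = (i1, \<tau> g, l1)" by metis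
  have "\<exists>j. j \<in> I \<and> \<phi> (i, \<one>, l1) = (j, \<one>, l1)" if i: "i \<in> I0" for i
  proof -
    let ?x = "(i, \<one>, l1)"
    have x: "?x \<in> A" using i by (simp add: I0_def)
    obtain j h m where jhm: "\<phi> ?x = (j, h, m)" "j \<in> I" "h \<in> carrier G" "m \<in> L"
      using \<phi>R[OF x] by (cases "\<phi> ?x") auto
    have "i \<in> I" using i sub by auto
    then have "?e = ?e \<otimes>\<^bsub>R\<^esub> \<phi> ?x" "\<phi> ?x = \<phi> ?x \<otimes>\<^bsub>R\<^esub> ?e"
      using \<phi>_mult[OF base_A x] \<phi>_mult[OF x base_A] \<phi>_base by simp_all
    with jhm show ?thesis by simp
  qed
  then obtain \<psi> where \<psi>: "\<And>i. i \<in> I0 \<Longrightarrow> \<psi> i \<in> I"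
    "\<And>i. i \<in> I0 \<Longrightarrow> \<phi> (i, \<one>, l1) = (\<psi> i, \<one>, l1)" by metis
  have "\<exists>m. m \<in> L \<and> \<phi> (i1, \<one>, l) = (i1, \<one>, m)" if l: "l \<in> L0" for l
  proof -
    let ?x = "(i1, \<one>, l)"
    have x: "?x \<in> A" using l by (simp add: L0_def)
    obtain j h m where jhm: "\<phi> ?x = (j, h, m)" "j \<in> I" "h \<in> carrier G" "m \<in> L"
      using \<phi>R[OF x] by (cases "\<phi> ?x") auto
    have "l \<in> L" using l sub by auto
    then have "?e = \<phi> ?x \<otimes>\<^bsub>R\<^esub> ?e" "\<phi> ?x = ?e \<otimes>\<^bsub>R\<^esub> \<phi> ?x"
      using \<phi>_mult[OF base_A x] \<phi>_mult[OF x base_A] \<phi>_base by simp_all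
    with jhm show ?thesis by simp
  qed
  then obtain \<chi> where \<chi>: "\<And>l. l \<in> L0 \<Longrightarrow> \<chi> l \<in> L"
    "\<And>l. l \<in> L0 \<Longrightarrow> \<phi> (i1, \<one>, l) = (i1, \<one>, \<chi> l)" by metis
  have \<tau>_mult: "\<tau> (g \<otimes> h) = \<tau> g \<otimes> \<tau> h" if gh: "g \<in> K" "h \<in> K" for g h
  proof -
    have "g \<otimes> h \<in> K" using K gh by (rule subgroup.m_closed)
    moreover have "g \<in> carrier G" "h \<in> carrier G" using gh sub by auto
    ultimately show ?thesis
      using \<phi>_mult[of "(i1, g, l1)" "(i1, h, l1)"] gh \<tau> by (simp add: K_def)
  qed
  have \<tau>_inj: "inj_on \<tau> K"
  proof (rule inj_onI)
    fix g h assume "g \<in> K" "h \<in> K" "\<tau> g = \<tau> h"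
    then show "g = h" using \<phi>_inj[of "(i1, g, l1)" "(i1, h, l1)"] \<tau>(2) by (simp add: K_def)
  qed
  have \<tau>K: "subgroup (\<tau> ` K) G"
  proof (rule finite_closed_subset_subgroup[OF finite_G])
    show "\<tau> ` K \<subseteq> carrier G" using \<tau>(1) by auto
    show "\<tau> ` K \<noteq> {}" using subgroup.one_closed[OF K] by auto
    fix x y assume "x \<in> \<tau> ` K" "y \<in> \<tau> ` K"
    then obtain g h where "x = \<tau> g" "y = \<tau> h" "g \<in> K" "h \<in> K" by blast
    then show "x \<otimes> y \<in> \<tau> ` K" using \<tau>_mult subgroup.m_closed[OF K] by (metis imageI)
  qed
  have "\<tau> \<in> iso (G\<lparr>carrier := K\<rparr>) (G\<lparr>carrier := \<tau> ` K\<rparr>)"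
    using \<tau>_mult \<tau>_inj by (simp add: iso_def hom_def bij_betw_def)
  then obtain \<theta> where \<theta>: "\<theta> \<in> iso G G" "\<And>g. g \<in> K \<Longrightarrow> \<theta> g = \<tau> g"
    using G subgroup_imp_fg_subgroup[OF finite_G K] subgroup_imp_fg_subgroup[OF finite_G \<tau>K]
    unfolding homogeneous_group_def by blast
  \<comment> \<open>The product of \<open>(i1, \<one>, l)\<close> and \<open>(i, \<one>, l1)\<close>
    is \<open>(i1, P l i, l1)\<close>, so the entry lies in \<open>K\<close>, where
    \<open>\<theta>\<close> agrees with \<open>\<tau>\<close>.\<close>
  have "\<forall>l\<in>L0. \<forall>i\<in>I0. \<theta> (P l i) = P (\<chi> l) (\<psi> i)"
  proof (intro ballI)
    fix l i assume li: "l \<in> L0" "i \<in> I0"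
    let ?x = "(i1, \<one>, l)" and ?y = "(i, \<one>, l1)"
    have "l \<in> L" "i \<in> I" "?x \<in> A" "?y \<in> A" using li sub by (auto simp: L0_def I0_def)
    moreover from this have "P l i \<in> K" using A_mult[of ?x ?y] by (simp add: K_def)
    ultimately show "\<theta> (P l i) = P (\<chi> l) (\<psi> i)"
      using \<phi>_mult[of ?x ?y] li by (simp add: \<theta>(2) \<tau> \<chi> \<psi>)
  qed
  moreover have "i1 \<in> I0" "l1 \<in> L0" using base_A by (simp_all add: I0_def L0_def)
  moreover from this have "\<psi> i1 = i1" "\<chi> l1 = l1" using \<phi>_base \<psi>(2)[of i1] \<chi>(2)[of l1] by auto
  moreover have "inj_on \<psi> I0"
  proof (rule inj_onI)
    fix i j assume "i \<in> I0" "j \<in> I0" "\<psi> i = \<psi> j"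
    then show "i = j" using \<phi>_inj[of "(i, \<one>, l1)" "(j, \<one>, l1)"] \<psi>(2) by (simp add: I0_def)
  qed
  moreover have "inj_on \<chi> L0"
  proof (rule inj_onI)
    fix l m assume "l \<in> L0" "m \<in> L0" "\<chi> l = \<chi> m"
    then show "l = m" using \<phi>_inj[of "(i1, \<one>, l)" "(i1, \<one>, m)"] \<chi>(2) by (simp add: L0_def)
  qed
  moreover have "\<psi> ` I0 \<subseteq> I" "\<chi> ` L0 \<subseteq> L" using \<psi>(1) \<chi>(1) by auto
  ultimately have "\<exists>\<psi>' \<chi>'. bij_betw \<psi>' I I \<and> bij_betw \<chi>' L L \<and>
      (\<forall>i\<in>I0. \<psi>' i = \<psi> i) \<and> (\<forall>l\<in>L0. \<chi>' l = \<chi> l) \<and> (\<forall>l\<in>L. \<forall>i\<in>I. \<theta> (P l i) = P (\<chi>' l) (\<psi>' i))"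
    using ext[unfolded based_extension_def, rule_format, OF \<theta>(1), of I0 L0 \<psi> \<chi>] sub(1,2) by blast
  then obtain \<psi>' \<chi>' where ext': "bij_betw \<psi>' I I" "bij_betw \<chi>' L L"
    "\<forall>i\<in>I0. \<psi>' i = \<psi> i" "\<forall>l\<in>L0. \<chi>' l = \<chi> l" "\<forall>l\<in>L. \<forall>i\<in>I. \<theta> (P l i) = P (\<chi>' l) (\<psi>' i)"
    by blast
  let ?f = "\<lambda>(i, g, l). (\<psi>' i, \<one> \<otimes> \<theta> g \<otimes> \<one>, \<chi>' l)"
  have "?f \<in> iso R R"
  proof (rule rees_automorphism[OF \<theta>(1) ext'(1,2)])
    fix l i assume "l \<in> L" "i \<in> I"
    moreover from this have "\<chi>' l \<in> L" "\<psi>' i \<in> I" using ext'(1,2) bij_betwE by blast+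
    ultimately show "\<theta> (P l i) = \<one> \<otimes> P (\<chi>' l) (\<psi>' i) \<otimes> \<one>" using ext'(5) by simp
  qed auto
  moreover have "?f x = \<phi> x" if x: "x \<in> A" for x
  proof -
    obtain i g l where [simp]: "x = (i, g, l)" by (cases x)
    have *: "g \<in> K" "i \<in> I0" "l \<in> L0" using coords x by auto
    then have c: "g \<in> carrier G" "i \<in> I" "l \<in> L" using sub by auto
    have A': "(i, \<one>, l1) \<in> A" "(i1, g, l1) \<in> A" "(i1, \<one>, l) \<in> A"
      using * by (auto simp: I0_def L0_def K_def)
    have "x = (i, \<one>, l1) \<otimes>\<^bsub>R\<^esub> (i1, g, l1) \<otimes>\<^bsub>R\<^esub> (i1, \<one>, l)" using c by simp
    then have "\<phi> x = \<phi> (i, \<one>, l1) \<otimes>\<^bsub>R\<^esub> \<phi> (i1, g, l1) \<otimes>\<^bsub>R\<^esub> \<phi> (i1, \<one>, l)"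
      using \<phi>_mult A_mult A' by metis
    also have "\<dots> = (\<psi> i, \<tau> g, \<chi> l)" using * by (simp add: \<psi> \<chi> \<tau>)
    also have "\<dots> = ?f x" using * ext'(3,4) \<theta>(2) \<tau>(1) by simp
    finally show ?thesis ..
  qed
  ultimately show ?thesis by blast
qed

text \<open>\<open>A\<close> need not contain the base idempotent. By finiteness it has an
  idempotent \<open>?e\<close> in any class \<open>{i} \<times> G \<times> {l}\<close> that it
  meets; \<open>?e\<close> and \<open>\<phi> ?e\<close> are moved to the base by separate
  automorphisms.\<close>

lemma homogeneous_semigroup_R:
  assumes G: "homogeneous_group G" and ext: based_extension and trans: idempotent_transitive
  shows "homogeneous_semigroup R"
proof (rule homogeneous_semigroupI[OF alg_semigroup_R finite_R])
  fix A B \<phi>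
  assume A: "subsemigroup A R" and B: "subsemigroup B R" and \<phi>: "bij_betw \<phi> A B"
    and \<phi>_mult: "\<And>x y. x \<in> A \<Longrightarrow> y \<in> A \<Longrightarrow> \<phi> (x \<otimes>\<^bsub>R\<^esub> y) = \<phi> x \<otimes>\<^bsub>R\<^esub> \<phi> y"
  have AR: "x \<in> carrier R" if "x \<in> A" for x using A that by (auto simp: subsemigroup_def)
  have A_mult: "x \<otimes>\<^bsub>R\<^esub> y \<in> A" if "x \<in> A" "y \<in> A" for x y
    using A that by (auto simp: subsemigroup_def)
  obtain i g l where igl: "(i, g, l) \<in> A" using A by (auto simp: subsemigroup_def)
  then have i: "i \<in> I" and l: "l \<in> L" and gG: "g \<in> carrier G" using AR by fastforce+
  \<comment> \<open>Multiplication by \<open>P l i\<close> on the right is an isomorphism from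
    \<open>{i} \<times> G \<times> {l}\<close> to \<open>G\<close>. It turns the part of
    \<open>A\<close> there into a subgroup, whose identity corresponds to the idempotent.\<close>
  let ?K = "(\<lambda>k. k \<otimes> P l i) ` {k \<in> carrier G. (i, k, l) \<in> A}"
  have "subgroup ?K G"
  proof (rule finite_closed_subset_subgroup[OF finite_G])
    show "?K \<subseteq> carrier G" using i l by auto
    show "?K \<noteq> {}" using igl gG by auto
    fix x y assume "x \<in> ?K" "y \<in> ?K"
    then obtain k k' where k: "k \<in> carrier G" "(i, k, l) \<in> A" "x = k \<otimes> P l i"
      "k' \<in> carrier G" "(i, k', l) \<in> A" "y = k' \<otimes> P l i" by blast
    then have "(i, k \<otimes> P l i \<otimes> k', l) \<in> A" using A_mult[OF k(2,5)] by simp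
    then show "x \<otimes> y \<in> ?K"
      using k i l by (intro rev_image_eqI[of "k \<otimes> P l i \<otimes> k'"]) (auto simp: m_assoc)
  qed
  then have "\<one> \<in> ?K" by (rule subgroup.one_closed)
  then obtain k where k: "k \<in> carrier G" "(i, k, l) \<in> A" "k \<otimes> P l i = \<one>" by auto
  then have "inv (P l i) = k" using i l by (intro inv_equality) auto
  with k have e: "(i, inv (P l i), l) \<in> A" (is "?e \<in> A") by simp
  have "\<phi> ?e \<in> carrier R" using \<phi> e B bij_betwE by (fastforce simp: subsemigroup_def)
  then obtain j h m where jhm: "\<phi> ?e = (j, h, m)" "j \<in> I" "h \<in> carrier G" "m \<in> L"
    by (cases "\<phi> ?e") auto
  have "?e \<otimes>\<^bsub>R\<^esub> ?e = ?e" using i l by simp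
  then have "h \<otimes> P m j \<otimes> h = h" using \<phi>_mult[OF e e] jhm by simp
  then have "h \<otimes> P m j = \<one>" using jhm(2-4) by (metis P_closed m_closed r_cancel_one)
  then have "inv (P m j) = h" using jhm by (intro inv_equality) auto
  with jhm have \<phi>e: "\<phi> ?e = (j, inv (P m j), m)" by simp
  obtain \<alpha> where \<alpha>: "\<alpha> \<in> iso R R" "\<alpha> (i1, \<one>, l1) = ?e"
    using trans i l unfolding idempotent_transitive_def by blast
  obtain \<beta> where \<beta>: "\<beta> \<in> iso R R" "\<beta> (i1, \<one>, l1) = \<phi> ?e"
    using trans jhm(2,4) \<phi>e unfolding idempotent_transitive_def by metis
  interpret R: alg_semigroup R by (rule alg_semigroup_R)
  let ?a = "inv_into (carrier R) \<alpha>" and ?b = "inv_into (carrier R) \<beta>"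
  have b1: "(i1, \<one>, l1) \<in> carrier R" by simp
  have a: "?a \<in> iso R R" "?a ?e = (i1, \<one>, l1)"
    using R.inv_into_iso[OF \<alpha>(1)] bij_betw_inv_into_left[OF iso_bij_betw[OF \<alpha>(1)] b1] \<alpha>(2) by simp_all
  have b: "?b \<in> iso R R" "?b (\<phi> ?e) = (i1, \<one>, l1)"
    using R.inv_into_iso[OF \<beta>(1)] bij_betw_inv_into_left[OF iso_bij_betw[OF \<beta>(1)] b1] \<beta>(2) by simp_all
  show "\<exists>\<theta>\<in>iso R R. \<forall>x\<in>A. \<theta> x = \<phi> x"
  proof (rule extend_conjugate[OF alg_semigroup_R a(1) b(1) A B \<phi> \<phi>_mult])
    fix \<psi>
    assume \<psi>: "bij_betw \<psi> (?a ` A) (?b ` B)"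
      "\<And>x y. x \<in> ?a ` A \<Longrightarrow> y \<in> ?a ` A \<Longrightarrow> \<psi> (x \<otimes>\<^bsub>R\<^esub> y) = \<psi> x \<otimes>\<^bsub>R\<^esub> \<psi> y"
      and conj: "\<And>x. x \<in> A \<Longrightarrow> \<psi> (?a x) = ?b (\<phi> x)"
    show "\<exists>\<theta>\<in>iso R R. \<forall>x\<in>?a ` A. \<theta> x = \<psi> x"
    proof (rule extend_based[OF G ext subsemigroup_image[OF a(1) A] subsemigroup_image[OF b(1) B] _ \<psi>])
      show "(i1, \<one>, l1) \<in> ?a ` A" using a(2) e by (metis imageI)
      show "\<psi> (i1, \<one>, l1) = (i1, \<one>, l1)" using conj[OF e] a(2) b(2) by simp
    qed
  qed
qed

text \<open>With trivial entries nothing links rows and columns: the two partial injections extend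
  independently, and transpositions move the base idempotent anywhere.\<close>

lemma trivial_matrix_homogeneous:
  assumes "homogeneous_group G" and P: "\<And>l i. l \<in> L \<Longrightarrow> i \<in> I \<Longrightarrow> P l i = \<one>"
  shows "homogeneous_semigroup R"
proof (rule homogeneous_semigroup_R[OF assms(1)])
  show based_extension
    unfolding based_extension_def
  proof (intro allI ballI impI)
    fix I0 L0 \<psi> \<chi> \<theta>
    assume "\<theta> \<in> iso G G" and I0: "I0 \<subseteq> I" "inj_on \<psi> I0" "\<psi> ` I0 \<subseteq> I"
      and L0: "L0 \<subseteq> L" "inj_on \<chi> L0" "\<chi> ` L0 \<subseteq> L"
    then have "\<theta> \<one> = \<one>" by (simp add: iso_def hom_one)
    obtain \<psi>' where \<psi>': "bij_betw \<psi>' I I" "\<forall>i\<in>I0. \<psi>' i = \<psi> i"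
      using finite_injection_extends[OF finite_I I0] .
    obtain \<chi>' where \<chi>': "bij_betw \<chi>' L L" "\<forall>l\<in>L0. \<chi>' l = \<chi> l"
      using finite_injection_extends[OF finite_L L0] .
    have "\<theta> (P l i) = P (\<chi>' l) (\<psi>' i)" if "l \<in> L" "i \<in> I" for l i
      using bij_betwE[OF \<psi>'(1)] bij_betwE[OF \<chi>'(1)] that P \<open>\<theta> \<one> = \<one>\<close> by simp
    with \<psi>' \<chi>' show "\<exists>\<psi>' \<chi>'. bij_betw \<psi>' I I \<and> bij_betw \<chi>' L L \<and> (\<forall>i\<in>I0. \<psi>' i = \<psi> i) \<and>
        (\<forall>l\<in>L0. \<chi>' l = \<chi> l) \<and> (\<forall>l\<in>L. \<forall>i\<in>I. \<theta> (P l i) = P (\<chi>' l) (\<psi>' i))"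
      by blast
  qed
  show idempotent_transitive
    unfolding idempotent_transitive_def
  proof (intro ballI)
    fix i l assume il: "i \<in> I" "l \<in> L"
    let ?\<psi> = "Transposition.transpose i1 i" and ?\<pi> = "Transposition.transpose l1 l"
    have b: "bij_betw ?\<psi> I I" "bij_betw ?\<pi> L L" using il by auto
    have "(\<lambda>(i, g, l). (?\<psi> i, \<one> \<otimes> g \<otimes> \<one>, ?\<pi> l)) \<in> iso R R"
      by (rule rees_automorphism[OF iso_set_refl b])
        (use bij_betwE[OF b(1)] bij_betwE[OF b(2)] P in auto)
    then show "\<exists>\<alpha>\<in>iso R R. \<alpha> (i1, \<one>, l1) = (i, inv (P l i), l)"
      by (rule rev_bexI) (use il P in simp)
  qed
qed

end

section \<open>Matrices of character tables\<close>

lemma two_valued_matrix_sym: "two_valued_matrix u a b l i = two_valued_matrix u a b i l"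
  by (auto simp: two_valued_matrix_def)

locale character_table_matrix = group G for G (structure) +
  fixes N :: nat and a b :: 'a
  assumes finite_G': "finite (carrier G)" and parameters: "character_table_parameters G N a b"
begin

abbreviation "M \<equiv> two_valued_matrix \<one> a b"

lemma ab_closed [simp]: "a \<in> carrier G" "b \<in> carrier G"
  using parameters by (auto simp: character_table_parameters_def)

lemma a_not_one: "a \<noteq> \<one>"
  using parameters by (auto simp: character_table_parameters_def)

lemma N_cases: "N = 2 \<or> N = 3 \<or> N = 4"
  using parameters by (auto simp: character_table_parameters_def)

lemma M_closed [simp]: "M l i \<in> carrier G"
  by (simp add: two_valued_matrix_def)

sublocale rees_matrix G "{1..N}" "{1..N}" "two_valued_matrix \<one> a b" 1 1
proof unfold_locales
  show "normalised_matrix G {1..N} {1..N} 1 1 M"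
    using N_cases by (auto simp: normalised_matrix_def matrix_over_def two_valued_matrix_def)
qed (simp_all add: finite_G')

lemma M_commute: "M l i \<otimes> M m j = M m j \<otimes> M l i"
proof -
  have "a \<otimes> b = b \<otimes> a"
    using parameters by (auto simp: character_table_parameters_def)
  then show ?thesis by (simp add: two_valued_matrix_def)
qed

text \<open>The rows form a group under entrywise multiplication, cyclic of order two or three or a
  Klein four-group, and \<open>\<pi>\<close> is the translation by row \<open>l0\<close>.\<close>

lemma row_translation:
  assumes "l0 \<in> {1..N}"
  obtains \<pi> where "bij_betw \<pi> {1..N} {1..N}" "\<pi> 1 = l0"
    "\<And>l i. l \<in> {1..N} \<Longrightarrow> i \<in> {1..N} \<Longrightarrow> M (\<pi> l) i = M l i \<otimes> M l0 i"
proof -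
  consider "l0 = 1" | "N = 2" "l0 = 2" | "N = 3" "l0 = 2" | "N = 3" "l0 = 3"
    | "N = 4" "l0 = 2" | "N = 4" "l0 = 3" | "N = 4" "l0 = 4"
    using N_cases assms by fastforce
  then have "\<exists>\<pi>. bij_betw \<pi> {1..N} {1..N} \<and> \<pi> 1 = l0 \<and>
    (\<forall>l\<in>{1..N}. \<forall>i\<in>{1..N}. M (\<pi> l) i = M l i \<otimes> M l0 i)"
  proof cases
    case 1
    then show ?thesis by (intro exI[of _ id]) (auto simp: two_valued_matrix_def)
  next
    case 2
    then have "a \<otimes> a = \<one>" "b = a" using parameters by (auto simp: character_table_parameters_def)
    moreover have "{1..N} = {1, 2}" using 2 by auto
    \<comment> \<open>The list holds the images of \<open>1, 2, ...\<close> under the translation;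
      \<open>k - 1\<close> is the zero-based position in it.\<close>
    ultimately show ?thesis using 2
      by (intro exI[of _ "\<lambda>k. [2, 1] ! (k - 1)"])
        (auto simp: two_valued_matrix_def bij_betw_def)
  next
    case 3
    then have "b = inv a" "a \<otimes> a = inv a"
      using parameters by (auto simp: character_table_parameters_def)
    then have "a \<otimes> a = b" "b \<otimes> b = a" "a \<otimes> b = \<one>" "b \<otimes> a = \<one>"
      using inv_mult_group[of a a] by simp_all
    moreover have "{1..N} = {1, 2, 3}" using 3 by auto
    ultimately show ?thesis using 3
      by (intro exI[of _ "\<lambda>k. [2, 3, 1] ! (k - 1)"])
        (auto simp: two_valued_matrix_def bij_betw_def)
  next
    case 4
    then have "b = inv a" "a \<otimes> a = inv a"
      using parameters by (auto simp: character_table_parameters_def)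
    then have "a \<otimes> a = b" "b \<otimes> b = a" "a \<otimes> b = \<one>" "b \<otimes> a = \<one>"
      using inv_mult_group[of a a] by simp_all
    moreover have "{1..N} = {1, 2, 3}" using 4 by auto
    ultimately show ?thesis using 4
      by (intro exI[of _ "\<lambda>k. [3, 1, 2] ! (k - 1)"])
        (auto simp: two_valued_matrix_def bij_betw_def)
  next
    case 5
    then have "a \<otimes> a = \<one>" "b = \<one>" using parameters by (auto simp: character_table_parameters_def)
    moreover have "{1..N} = {1, 2, 3, 4}" using 5 by auto
    ultimately show ?thesis using 5
      by (intro exI[of _ "\<lambda>k. [2, 1, 4, 3] ! (k - 1)"])
        (auto simp: two_valued_matrix_def bij_betw_def)
  next
    case 6
    then have "a \<otimes> a = \<one>" "b = \<one>" using parameters by (auto simp: character_table_parameters_def)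
    moreover have "{1..N} = {1, 2, 3, 4}" using 6 by auto
    ultimately show ?thesis using 6
      by (intro exI[of _ "\<lambda>k. [3, 4, 1, 2] ! (k - 1)"])
        (auto simp: two_valued_matrix_def bij_betw_def)
  next
    case 7
    then have "a \<otimes> a = \<one>" "b = \<one>" using parameters by (auto simp: character_table_parameters_def)
    moreover have "{1..N} = {1, 2, 3, 4}" using 7 by auto
    ultimately show ?thesis using 7
      by (intro exI[of _ "\<lambda>k. [4, 3, 2, 1] ! (k - 1)"])
        (auto simp: two_valued_matrix_def bij_betw_def)
  qed
  then show ?thesis using that by blast
qed

text \<open>As \<open>M\<close> is symmetric, a row translation \<open>\<psi>\<close> also serves as
  a column translation. Multiplicativity in both indices gives \<open>M (\<pi> l) (\<psi> i) = M l i
  \<otimes> M l i0 \<otimes> M l0 (\<psi> i)\<close>; of the extra factors one depends only on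
  \<open>l\<close> and the other only on \<open>i\<close>, so \<open>v\<close> and \<open>u\<close>
  cancel them.\<close>

lemma transitive: idempotent_transitive
  unfolding idempotent_transitive_def
proof (intro ballI)
  fix i0 l0 assume i0: "i0 \<in> {1..N}" and l0: "l0 \<in> {1..N}"
  show "\<exists>\<alpha>\<in>iso R R. \<alpha> (1, \<one>, 1) = (i0, inv (M l0 i0), l0)"
  proof (rule row_translation[OF l0], rule row_translation[OF i0])
    fix \<pi> \<psi>
    assume \<pi>: "bij_betw \<pi> {1..N} {1..N}" "\<pi> 1 = l0"
        "\<And>l i. l \<in> {1..N} \<Longrightarrow> i \<in> {1..N} \<Longrightarrow> M (\<pi> l) i = M l i \<otimes> M l0 i"
      and \<psi>: "bij_betw \<psi> {1..N} {1..N}" "\<psi> 1 = i0"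
        "\<And>l i. l \<in> {1..N} \<Longrightarrow> i \<in> {1..N} \<Longrightarrow> M (\<psi> l) i = M l i \<otimes> M i0 i"
    let ?u = "\<lambda>i. inv (M l0 (\<psi> i))" and ?v = "\<lambda>l. inv (M l i0)"
    have iso: "(\<lambda>(i, g, l). (\<psi> i, ?u i \<otimes> g \<otimes> ?v l, \<pi> l)) \<in> iso R R"
    proof (rule rees_automorphism[OF iso_set_refl \<psi>(1) \<pi>(1)])
      fix l i assume li: "l \<in> {1..N}" "i \<in> {1..N}"
      then have "\<psi> i \<in> {1..N}" using bij_betwE[OF \<psi>(1)] by blast
      then have "M (\<pi> l) (\<psi> i) = M l (\<psi> i) \<otimes> M l0 (\<psi> i)" using li \<pi>(3) by blast
      also have "M l (\<psi> i) = M (\<psi> i) l" by (rule two_valued_matrix_sym)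
      also have "\<dots> = M l i \<otimes> M l i0" using \<psi>(3)[OF li(2,1)] by (metis two_valued_matrix_sym)
      also have "\<dots> = M l i0 \<otimes> M l i" by (rule M_commute)
      finally show "M l i = ?v l \<otimes> M (\<pi> l) (\<psi> i) \<otimes> ?u i"
        by (simp add: m_assoc[symmetric]) (simp add: m_assoc)
    qed auto
    have "M 1 i0 = \<one>" by (simp add: two_valued_matrix_def)
    with \<pi>(2) \<psi>(2) show ?thesis by (intro rev_bexI[OF iso]) simp
  qed
qed

text \<open>Rows and columns share the index set, and the matching is equality of indices. Off the
  base, \<open>a \<noteq> b\<close> lets the entry \<open>M l i\<close> decide whether
  \<open>l = i\<close>, so \<open>\<psi>\<close> and \<open>\<chi>\<close> are compatible and have a
  common extension. For \<open>N = 2\<close> the two values coincide, but only one index is off the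
  base.\<close>

lemma matching_preserved_extends:
  assumes I0: "I0 \<subseteq> {1..N}" "1 \<in> I0" "inj_on \<psi> I0" "\<psi> ` I0 \<subseteq> {1..N}" "\<psi> 1 = 1"
    and L0: "L0 \<subseteq> {1..N}" "1 \<in> L0" "inj_on \<chi> L0" "\<chi> ` L0 \<subseteq> {1..N}" "\<chi> 1 = 1"
    and P: "\<And>l i. l \<in> L0 \<Longrightarrow> i \<in> I0 \<Longrightarrow> M l i = M (\<chi> l) (\<psi> i)"
  obtains \<rho> where "bij_betw \<rho> {1..N} {1..N}" "\<forall>i\<in>I0. \<rho> i = \<psi> i" "\<forall>l\<in>L0. \<rho> l = \<chi> l"
proof (rule finite_injections_common_extension[OF _ I0(1,3,4) L0(1,3,4)])
  fix l i assume l: "l \<in> L0" and i: "i \<in> I0"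
  have \<chi>1: "\<chi> l = 1 \<longleftrightarrow> l = 1" using L0(2,3,5) l by (metis inj_onD)
  have \<psi>1: "\<psi> i = 1 \<longleftrightarrow> i = 1" using I0(2,3,5) i by (metis inj_onD)
  show "l = i \<longleftrightarrow> \<chi> l = \<psi> i"
  proof (cases "l = 1 \<or> i = 1")
    case True
    then show ?thesis using \<chi>1 \<psi>1 L0(5) I0(5) by auto
  next
    case False
    have c: "l \<in> {1..N}" "i \<in> {1..N}" "\<chi> l \<in> {1..N}" "\<psi> i \<in> {1..N}" using I0 L0 l i by auto
    show ?thesis
    proof (cases "N = 2")
      case True
      then show ?thesis using c False \<chi>1 \<psi>1 by auto
    next
      case N: False
      then have "a \<noteq> b"
        using parameters a_not_one by (auto simp: character_table_parameters_def)
      with P[OF l i] False \<chi>1 \<psi>1 show ?thesis by (auto simp: two_valued_matrix_def split: if_splits)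
    qed
  qed
qed (use that in auto)

lemma two_valued_matrix_bij:
  assumes "bij_betw \<rho> {1..N} {1..N}" "\<rho> 1 = 1" "l \<in> {1..N}" "i \<in> {1..N}"
  shows "M (\<rho> l) (\<rho> i) = M l i"
proof -
  have "\<rho> l = \<rho> i \<longleftrightarrow> l = i" "\<rho> l = \<rho> 1 \<longleftrightarrow> l = 1" "\<rho> i = \<rho> 1 \<longleftrightarrow> i = 1"
    using inj_on_eq_iff[OF bij_betw_imp_inj_on[OF assms(1)]] assms(3,4) base(1) by blast+
  then show ?thesis using assms(2) by (simp add: two_valued_matrix_def)
qed

text \<open>An automorphism of \<open>G\<close> permutes \<open>{\<one>, a, b}\<close> and fixes the
  identity, so it fixes \<open>a\<close> and \<open>b\<close> or, for \<open>N = 3\<close>,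
  exchanges them.\<close>

lemma based_extension_M:
  assumes inv: "\<And>\<theta>. \<theta> \<in> iso G G \<Longrightarrow> \<theta> ` {\<one>, a, b} = {\<one>, a, b}"
  shows based_extension
  unfolding based_extension_def
proof (intro allI ballI impI)
  fix I0 L0 \<psi> \<chi> \<theta>
  assume \<theta>: "\<theta> \<in> iso G G"
    and I0: "I0 \<subseteq> {1..N}" "1 \<in> I0" "inj_on \<psi> I0" "\<psi> ` I0 \<subseteq> {1..N}" "\<psi> 1 = 1"
    and L0: "L0 \<subseteq> {1..N}" "1 \<in> L0" "inj_on \<chi> L0" "\<chi> ` L0 \<subseteq> {1..N}" "\<chi> 1 = 1"
    and P: "\<forall>l\<in>L0. \<forall>i\<in>I0. \<theta> (M l i) = M (\<chi> l) (\<psi> i)"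
  have \<theta>1: "\<theta> \<one> = \<one>" using \<theta> by (simp add: iso_def hom_one)
  have \<theta>inj: "\<theta> x = \<theta> y \<longleftrightarrow> x = y" if "x \<in> carrier G" "y \<in> carrier G" for x y
    using inj_on_eq_iff[OF bij_betw_imp_inj_on[OF iso_bij_betw[OF \<theta>]]] that by blast
  have \<theta>ab: "\<theta> a \<in> {\<one>, a, b}" "\<theta> b \<in> {\<one>, a, b}" "\<theta> a \<noteq> \<one>"
    using inv[OF \<theta>] \<theta>inj[of a \<one>] \<theta>1 a_not_one by auto
  have \<theta>inv: "\<theta> (inv a) = inv (\<theta> a)"
  proof -
    have "\<theta> (inv a) \<otimes> \<theta> a = \<one>" using iso_mult[OF \<theta>, of "inv a" a] \<theta>1 by simp
    then show ?thesis using iso_in_carrier[OF \<theta>] by (intro inv_equality[symmetric]) auto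
  qed
  consider "\<theta> a = a" "\<theta> b = b" | "N = 3" "\<theta> a = b" "\<theta> b = a"
    using parameters \<theta>ab \<theta>inv \<theta>1 unfolding character_table_parameters_def by fastforce
  then show "\<exists>\<psi>' \<chi>'. bij_betw \<psi>' {1..N} {1..N} \<and> bij_betw \<chi>' {1..N} {1..N} \<and>
    (\<forall>i\<in>I0. \<psi>' i = \<psi> i) \<and> (\<forall>l\<in>L0. \<chi>' l = \<chi> l) \<and>
    (\<forall>l\<in>{1..N}. \<forall>i\<in>{1..N}. \<theta> (M l i) = M (\<chi>' l) (\<psi>' i))"
  proof cases
    case 1
    then have \<theta>M: "\<theta> (M l i) = M l i" for l i using \<theta>1 by (simp add: two_valued_matrix_def)
    obtain \<rho> where \<rho>: "bij_betw \<rho> {1..N} {1..N}" "\<forall>i\<in>I0. \<rho> i = \<psi> i" "\<forall>l\<in>L0. \<rho> l = \<chi> l"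
      using matching_preserved_extends[OF I0 L0] P \<theta>M by auto
    moreover have "\<rho> 1 = 1" using \<rho>(2) I0(2,5) by simp
    ultimately show ?thesis using two_valued_matrix_bij \<theta>M by (intro exI[of _ \<rho>]) simp
  next
    case 2
    \<comment> \<open>Exchanging \<open>a\<close> and \<open>b\<close> in the table has the same
      effect as exchanging rows 2 and 3; composing \<open>\<chi>\<close> with this transposition
      reduces to maps that preserve the entries.\<close>
    let ?s = "Transposition.transpose (2::nat) 3"
    have s: "?s k \<in> {1..N}" "?s k = 1 \<longleftrightarrow> k = 1" if "k \<in> {1..N}" for k
      using that 2(1) by (auto simp: Transposition.transpose_def)
    have \<theta>M: "\<theta> (M l i) = M (?s l) i" if "l \<in> {1..N}" "i \<in> {1..N}" for l i
    proof -
      have "l \<in> {1, 2, 3}" "i \<in> {1, 2, 3}" using that 2(1) by auto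
      then show ?thesis
        using 2(2,3) \<theta>1 by (auto simp: two_valued_matrix_def Transposition.transpose_def)
    qed
    have L0': "?s ` L0 \<subseteq> {1..N}" "1 \<in> ?s ` L0" "inj_on (\<chi> \<circ> ?s) (?s ` L0)"
      "(\<chi> \<circ> ?s) ` ?s ` L0 \<subseteq> {1..N}" "(\<chi> \<circ> ?s) 1 = 1"
      using L0 s by (auto simp: image_image inj_on_def image_iff intro: bexI[of _ 1])
    obtain \<rho> where \<rho>: "bij_betw \<rho> {1..N} {1..N}" "\<forall>i\<in>I0. \<rho> i = \<psi> i" "\<forall>l\<in>?s ` L0. \<rho> l = (\<chi> \<circ> ?s) l"
    proof (rule matching_preserved_extends[OF I0 L0'])
      fix l i assume "l \<in> ?s ` L0" "i \<in> I0"
      then obtain l' where l': "l = ?s l'" "l' \<in> L0" by blast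
      have N: "l' \<in> {1..N}" "i \<in> {1..N}" using \<open>i \<in> I0\<close> l'(2) L0(1) I0(1) by blast+
      have "M (?s l') i = \<theta> (M l' i)" by (rule \<theta>M[OF N, symmetric])
      also have "\<dots> = M (\<chi> l') (\<psi> i)" using P \<open>i \<in> I0\<close> l'(2) by blast
      finally show "M l i = M ((\<chi> \<circ> ?s) l) (\<psi> i)" by (simp add: l'(1))
    qed
    have "\<rho> 1 = 1" using \<rho>(2) I0(2,5) by simp
    moreover have "bij_betw (\<rho> \<circ> ?s) {1..N} {1..N}"
      using 2(1) by (intro bij_betw_trans[OF _ \<rho>(1)]) auto
    ultimately show ?thesis
      using \<rho> two_valued_matrix_bij[OF \<rho>(1)] \<theta>M s
      by (intro exI[of _ \<rho>] exI[of _ "\<rho> \<circ> ?s"]) simp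
  qed
qed

lemma homogeneous_semigroup_M:
  assumes "homogeneous_group G" "\<And>\<theta>. \<theta> \<in> iso G G \<Longrightarrow> \<theta> ` {\<one>, a, b} = {\<one>, a, b}"
  shows "homogeneous_semigroup R"
  using assms(1) based_extension_M[OF assms(2)] transitive by (rule homogeneous_semigroup_R)

end

section \<open>The classification\<close>

text \<open>The theorem asks for a group and index sets on the naturals. The Rees coordinates of a
  semigroup are built from its own elements, so it is enough to pass to a copy on \<open>nat\<close>
  at the outset.\<close>

lemma (in alg_semigroup) ex_nat_copy:
  assumes "finite (carrier S)"
  obtains T :: "nat monoid" where "S \<cong> T"
proof -
  obtain c :: "'a \<Rightarrow> nat" where c: "inj_on c (carrier S)"
    using finite_imp_inj_to_nat_seg[OF assms] by metis
  let ?d = "inv_into (carrier S) c"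
  let ?T = "\<lparr>carrier = c ` carrier S, monoid.mult = \<lambda>x y. c (?d x \<otimes> ?d y), one = 0\<rparr>"
  have "c \<in> iso S ?T"
    using c by (auto simp: iso_def hom_def bij_betw_def)
  then show ?thesis using that by (auto simp: is_iso_def)
qed

lemma regular_semigroup_iso:
  assumes "regular_semigroup S" "S \<cong> T"
  shows "regular_semigroup T"
  unfolding regular_semigroup_def
proof (intro conjI ballI)
  interpret alg_semigroup S using assms(1) by (simp add: regular_semigroup_def)
  show "alg_semigroup T" using assms(2) by (rule alg_semigroup_iso)
  fix x assume x: "x \<in> carrier T"
  obtain \<phi> where \<phi>: "\<phi> \<in> iso S T" using assms(2) by (auto simp: is_iso_def)
  obtain x' where x': "x' \<in> carrier S" "x = \<phi> x'"
    using iso_bij_betw[OF \<phi>] x by (auto simp: bij_betw_def)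
  then obtain y where y: "y \<in> carrier S" "x' = x' \<otimes>\<^bsub>S\<^esub> y \<otimes>\<^bsub>S\<^esub> x'"
    using assms(1) unfolding regular_semigroup_def by blast
  then have "x = x \<otimes>\<^bsub>T\<^esub> \<phi> y \<otimes>\<^bsub>T\<^esub> x"
    using x' iso_mult[OF \<phi>, of "x' \<otimes>\<^bsub>S\<^esub> y" x'] iso_mult[OF \<phi>, of x' y] m_closed by simp
  then show "\<exists>y\<in>carrier T. x = x \<otimes>\<^bsub>T\<^esub> y \<otimes>\<^bsub>T\<^esub> x"
    using iso_in_carrier[OF \<phi> y(1)] by blast
qed

lemma rees_relabelling_iso:
  assumes f: "bij_betw f I' I" and g: "bij_betw g L' L"
    and P: "\<And>l i. l \<in> L' \<Longrightarrow> i \<in> I' \<Longrightarrow> P (g l) (f i) = P' l i"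
  shows "rees_matrix_semigroup G I' L' P' \<cong> rees_matrix_semigroup G I L P"
proof -
  have "map_prod f (map_prod id g) \<in> iso (rees_matrix_semigroup G I' L' P') (rees_matrix_semigroup G I L P)"
  proof (rule isoI)
    show b: "bij_betw (map_prod f (map_prod id g)) (carrier (rees_matrix_semigroup G I' L' P'))
      (carrier (rees_matrix_semigroup G I L P))"
      unfolding rees_simps by (intro bij_betw_map_prod f g bij_betw_id)
    show "map_prod f (map_prod id g) \<in> hom (rees_matrix_semigroup G I' L' P') (rees_matrix_semigroup G I L P)"
      using bij_betwE[OF f] bij_betwE[OF g] P by (intro homI) (auto simp: bij_betwE[OF b])
  qed
  then show ?thesis by (rule is_isoI)
qed

lemma trivial_matrix_iso:
  assumes "group G" and P: "\<And>l i. l \<in> L \<Longrightarrow> i \<in> I \<Longrightarrow> P l i = \<one>\<^bsub>G\<^esub>"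
  shows "rees_matrix_semigroup G I L P \<cong> G \<times>\<times> rectangular_band I L"
proof -
  interpret group G by fact
  let ?f = "\<lambda>(i, g, l). (g, (i, l))"
  have "bij_betw ?f (I \<times> carrier G \<times> L) (carrier G \<times> (I \<times> L))"
    by (rule bij_betwI[of _ _ _ "\<lambda>(g, (i, l)). (i, g, l)"]) auto
  then have "?f \<in> iso (rees_matrix_semigroup G I L P) (G \<times>\<times> rectangular_band I L)"
    by (intro isoI homI) (auto simp: rectangular_band_def P)
  then show ?thesis by (rule is_isoI)
qed

section \<open>Translation of the wording of the cases\<close>

context group
begin

lemma order_two_iff:
  assumes "a \<in> carrier G"
  shows "subgroup {\<one>, a} G \<and> G\<lparr>carrier := {\<one>, a}\<rparr> \<cong> integer_mod_group 2 \<longleftrightarrow>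
    a \<noteq> \<one> \<and> a \<otimes> a = \<one>"
proof
  assume *: "subgroup {\<one>, a} G \<and> G\<lparr>carrier := {\<one>, a}\<rparr> \<cong> integer_mod_group 2"
  then have "card {\<one>, a} = 2"
    using iso_same_card by (fastforce simp: carrier_integer_mod_group)
  then have "a \<noteq> \<one>" by auto
  moreover have "a \<otimes> a \<in> {\<one>, a}" using subgroup.m_closed[of "{\<one>, a}" G a a] * by simp
  ultimately show "a \<noteq> \<one> \<and> a \<otimes> a = \<one>" using assms by auto
next
  assume *: "a \<noteq> \<one> \<and> a \<otimes> a = \<one>"
  then have "inv a = a" using assms by (simp add: inv_equality)
  with * assms have "subgroup {\<one>, a} G" by (intro subgroupI) auto
  moreover have "(\<lambda>x. if x = \<one> then 0 else 1) \<in> iso (G\<lparr>carrier := {\<one>, a}\<rparr>) (integer_mod_group 2)"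
    using * assms
    by (intro isoI homI) (auto simp: carrier_integer_mod_group bij_betw_def)
  ultimately show "subgroup {\<one>, a} G \<and> G\<lparr>carrier := {\<one>, a}\<rparr> \<cong> integer_mod_group 2"
    using is_isoI by blast
qed

lemma order_three_iff:
  assumes "a \<in> carrier G"
  shows "subgroup {\<one>, a, inv a} G \<and> G\<lparr>carrier := {\<one>, a, inv a}\<rparr> \<cong> integer_mod_group 3 \<longleftrightarrow>
    a \<noteq> \<one> \<and> a \<otimes> a = inv a"
proof
  assume *: "subgroup {\<one>, a, inv a} G \<and> G\<lparr>carrier := {\<one>, a, inv a}\<rparr> \<cong> integer_mod_group 3"
  then have "card {\<one>, a, inv a} = 3"
    using iso_same_card by (fastforce simp: carrier_integer_mod_group)
  then have d: "a \<noteq> \<one>" "a \<noteq> inv a" by (auto simp: card_insert_if split: if_splits)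
  moreover have "a \<otimes> a \<in> {\<one>, a, inv a}"
    using subgroup.m_closed[of "{\<one>, a, inv a}" G a a] * by simp
  moreover have "a \<otimes> a \<noteq> \<one>" using d(2) assms inv_equality by metis
  ultimately show "a \<noteq> \<one> \<and> a \<otimes> a = inv a" using assms by auto
next
  assume *: "a \<noteq> \<one> \<and> a \<otimes> a = inv a"
  then have 2: "inv a \<otimes> inv a = a" using assms inv_mult_group[of a a] by simp
  have ne: "a \<noteq> inv a" "inv a \<noteq> \<one>"
    using * assms inv_eq_1_iff by (metis l_cancel_one, metis)
  have "subgroup {\<one>, a, inv a} G" using * 2 assms by (intro subgroupI) auto
  moreover have "(\<lambda>x. if x = \<one> then 0 else if x = a then 1 else 2)
      \<in> iso (G\<lparr>carrier := {\<one>, a, inv a}\<rparr>) (integer_mod_group 3)"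
    using * ne assms 2
    by (intro isoI homI) (auto simp: carrier_integer_mod_group bij_betw_def)
  ultimately show "subgroup {\<one>, a, inv a} G \<and> G\<lparr>carrier := {\<one>, a, inv a}\<rparr> \<cong> integer_mod_group 3"
    using is_isoI by blast
qed

end

text \<open>Existence and uniqueness at the left vertices give the function \<open>m\<close>; at the
  right vertices uniqueness gives its injectivity and existence its surjectivity. The matching has
  the colour \<open>b\<close>, all other edges have the colour \<open>a\<close>.\<close>

lemma perfect_matching_sandwich_graph_iff:
  fixes P :: "'l \<Rightarrow> 'i \<Rightarrow> 'g"
  assumes "a \<noteq> b"
  shows "edge_coloured_by (sandwich_graph I L i1 l1 P) {a, b} \<and>
      perfect_matching (sandwich_graph I L i1 l1 P) (edges_of_colour (sandwich_graph I L i1 l1 P) b) \<longleftrightarrow>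
    (\<exists>m. bij_betw m (L - {l1}) (I - {i1}) \<and>
      (\<forall>x\<in>L - {l1}. \<forall>y\<in>L - {l1}. P y (m x) = (if y = x then b else a)))"
    (is "?l \<longleftrightarrow> ?r")
proof
  let ?L = "L - {l1}" and ?I = "I - {i1}"
  assume ?l
  then have col: "P l i = a \<or> P l i = b" if "l \<in> ?L" "i \<in> ?I" for l i
    using that by (auto simp: edge_coloured_by_def sandwich_graph_def edges_def)
  from \<open>?l\<close> have row: "\<exists>!e. (e \<in> ?L \<times> ?I \<and> P (fst e) (snd e) = b) \<and> fst e = l" if "l \<in> ?L" for l
    using that unfolding perfect_matching_def edges_of_colour_def edges_def sandwich_graph_def
    by (simp add: case_prod_beta)
  from \<open>?l\<close> have column: "\<exists>!e. (e \<in> ?L \<times> ?I \<and> P (fst e) (snd e) = b) \<and> snd e = i" if "i \<in> ?I" for i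
    using that unfolding perfect_matching_def edges_of_colour_def edges_def sandwich_graph_def
    by (simp add: case_prod_beta)
  have "\<exists>i. i \<in> ?I \<and> P l i = b" if "l \<in> ?L" for l
    using ex1_implies_ex[OF row[OF that]] by auto
  then obtain m where m: "\<And>l. l \<in> ?L \<Longrightarrow> m l \<in> ?I" "\<And>l. l \<in> ?L \<Longrightarrow> P l (m l) = b" by metis
  have m_eq: "i = m l" if "l \<in> ?L" "i \<in> ?I" "P l i = b" for l i
  proof -
    have "(l, i) = (l, m l)" by (rule ex1E[OF row[OF that(1)]]) (use that m in \<open>metis SigmaI fst_conv snd_conv\<close>)
    then show ?thesis by simp
  qed
  have l_eq: "l = k" if "l \<in> ?L" "k \<in> ?L" "i \<in> ?I" "P l i = b" "P k i = b" for l k i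
  proof -
    have "(l, i) = (k, i)" by (rule ex1E[OF column[OF that(3)]]) (use that in \<open>metis SigmaI fst_conv snd_conv\<close>)
    then show ?thesis by simp
  qed
  have "inj_on m ?L" using l_eq m by (metis inj_onI)
  moreover have "m ` ?L = ?I"
  proof
    show "m ` ?L \<subseteq> ?I" using m(1) by blast
    show "?I \<subseteq> m ` ?L"
    proof
      fix i assume i: "i \<in> ?I"
      then obtain l where "l \<in> ?L" "P l i = b" using ex1_implies_ex[OF column[OF i]] by auto
      with m_eq i show "i \<in> m ` ?L" by blast
    qed
  qed
  moreover have "P y (m x) = (if y = x then b else a)" if "x \<in> ?L" "y \<in> ?L" for x y
    using that m l_eq[of x y "m x"] col[of y "m x"] by auto
  ultimately show ?r by (auto simp: bij_betw_def)
next
  let ?L = "L - {l1}" and ?I = "I - {i1}"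
  assume ?r
  then obtain m where m: "bij_betw m ?L ?I"
    and P: "\<And>x y. x \<in> ?L \<Longrightarrow> y \<in> ?L \<Longrightarrow> P y (m x) = (if y = x then b else a)" by blast
  have mI: "m l \<in> ?I" if "l \<in> ?L" for l using bij_betwE[OF m] that by blast
  have surj: "\<exists>x\<in>?L. i = m x" if "i \<in> ?I" for i
    using m that unfolding bij_betw_def by blast
  let ?\<Gamma> = "sandwich_graph I L i1 l1 P"
  have E: "e \<in> edges_of_colour ?\<Gamma> b \<longleftrightarrow> (\<exists>x\<in>?L. e = (x, m x))" for e
  proof
    assume "e \<in> edges_of_colour ?\<Gamma> b"
    then obtain l i where e: "e = (l, i)" "l \<in> ?L" "i \<in> ?I" "P l i = b"
      by (auto simp: edges_of_colour_def edges_def sandwich_graph_def)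
    then obtain x where "x \<in> ?L" "i = m x" using surj by blast
    then show "\<exists>x\<in>?L. e = (x, m x)" using P e assms by metis
  next
    assume "\<exists>x\<in>?L. e = (x, m x)"
    then obtain x where "x \<in> ?L" "e = (x, m x)" by blast
    then show "e \<in> edges_of_colour ?\<Gamma> b"
      using P[of x x] mI[of x] by (simp add: edges_of_colour_def edges_def sandwich_graph_def)
  qed
  have "edge_coloured_by ?\<Gamma> {a, b}"
    unfolding edge_coloured_by_def
  proof
    fix e assume "e \<in> edges ?\<Gamma>"
    then obtain l i where e: "e = (l, i)" "l \<in> ?L" "i \<in> ?I"
      by (auto simp: edges_def sandwich_graph_def)
    then obtain x where "x \<in> ?L" "i = m x" using surj by blast
    with P[of x l] e show "colour ?\<Gamma> e \<in> {a, b}" by (simp add: sandwich_graph_def)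
  qed
  moreover have "perfect_matching ?\<Gamma> (edges_of_colour ?\<Gamma> b)"
    unfolding perfect_matching_def
  proof (intro conjI ballI)
    show "edges_of_colour ?\<Gamma> b \<subseteq> edges ?\<Gamma>" by (auto simp: edges_of_colour_def)
    fix u assume "u \<in> left_vertices ?\<Gamma>"
    then have "u \<in> ?L" by (simp add: sandwich_graph_def)
    then show "\<exists>!e. e \<in> edges_of_colour ?\<Gamma> b \<and> fst e = u" unfolding E by (intro ex1I[of _ "(u, m u)"]) auto
  next
    fix v assume "v \<in> right_vertices ?\<Gamma>"
    then have "v \<in> ?I" by (simp add: sandwich_graph_def)
    then obtain x where x: "x \<in> ?L" "v = m x" using surj by blast
    then show "\<exists>!e. e \<in> edges_of_colour ?\<Gamma> b \<and> snd e = v"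
      unfolding E using inj_on_eq_iff[OF bij_betw_imp_inj_on[OF m]]
      by (intro ex1I[of _ "(x, m x)"]) auto
  qed
  ultimately show ?l by blast
qed

lemma homogeneous_regular_rees_coordinates:
  fixes S :: "('a, 'm) monoid_scheme"
  assumes fin: "finite (carrier S)" and reg: "regular_semigroup S" and hom: "homogeneous_semigroup S"
  shows "\<exists>(G :: nat monoid) (I :: nat set) (L :: nat set) P e.
    homogeneous_rees_matrix G I L P e e \<and> S \<cong> rees_matrix_semigroup G I L P"
proof -
  interpret S: alg_semigroup S using reg by (simp add: regular_semigroup_def)
  obtain T :: "nat monoid" where ST: "S \<cong> T" using S.ex_nat_copy[OF fin] .
  have regT: "regular_semigroup T" using reg ST by (rule regular_semigroup_iso)
  interpret T: alg_semigroup T using regT by (simp add: regular_semigroup_def)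
  have finT: "finite (carrier T)" using fin ST iso_finite by blast
  have homT: "homogeneous_semigroup T"
    using S.is_iso_sym[OF ST] hom fin T.alg_semigroup_axioms by (rule homogeneous_semigroup_iso)
  interpret T: primitive_regular_semigroup T
  proof
    show "\<exists>y\<in>carrier T. x = x \<otimes>\<^bsub>T\<^esub> y \<otimes>\<^bsub>T\<^esub> x" if "x \<in> carrier T" for x
      using regT that by (simp add: regular_semigroup_def)
    show "f = g" if "f \<in> carrier T" "g \<in> carrier T" "f \<otimes>\<^bsub>T\<^esub> f = f" "g \<otimes>\<^bsub>T\<^esub> g = g"
      "f \<otimes>\<^bsub>T\<^esub> g = f" "g \<otimes>\<^bsub>T\<^esub> f = f" for f g
      using homogeneous_primitive[OF homT finT that(1,3,2,4,5,6)] .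
  qed
  obtain x y where x: "x \<in> carrier T" and y: "y \<in> carrier T" "x = x \<otimes>\<^bsub>T\<^esub> y \<otimes>\<^bsub>T\<^esub> x"
    using T.nonempty T.regular by blast
  \<comment> \<open>By regularity \<open>x y\<close> is idempotent; it serves as base for rows and
    columns alike.\<close>
  let ?e = "x \<otimes>\<^bsub>T\<^esub> y"
  have e: "?e \<in> carrier T" "?e \<otimes>\<^bsub>T\<^esub> ?e = ?e"
    using x y T.m_closed T.m_assoc[of ?e x y] by simp_all
  let ?I = "{i \<in> carrier T. i \<otimes>\<^bsub>T\<^esub> i = i \<and> i \<otimes>\<^bsub>T\<^esub> ?e = i \<and> ?e \<otimes>\<^bsub>T\<^esub> i = ?e}"
  let ?L = "{l \<in> carrier T. l \<otimes>\<^bsub>T\<^esub> l = l \<and> ?e \<otimes>\<^bsub>T\<^esub> l = l \<and> l \<otimes>\<^bsub>T\<^esub> ?e = ?e}"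
  let ?R = "rees_matrix_semigroup (T.local_group ?e) ?I ?L (\<otimes>\<^bsub>T\<^esub>)"
  have "finite (carrier (T.local_group ?e))" using finT by (simp add: T.local_group_def)
  then interpret R: rees_matrix "T.local_group ?e" ?I ?L "(\<otimes>\<^bsub>T\<^esub>)" ?e ?e
    using T.group_local_group[OF e] finT T.rees_coordinates(1)[OF e]
    by (intro rees_matrix.intro rees_matrix_axioms.intro) simp_all
  have RT: "?R \<cong> T" using T.rees_coordinates(2)[OF e] by (rule is_isoI)
  have homR: "homogeneous_semigroup ?R"
    using RT homT finT R.alg_semigroup_R by (rule homogeneous_semigroup_iso)
  have "homogeneous_rees_matrix (T.local_group ?e) ?I ?L (\<otimes>\<^bsub>T\<^esub>) ?e ?e"
    by (intro homogeneous_rees_matrix.intro homogeneous_rees_matrix_axioms.intro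
        R.rees_matrix_axioms homR)
  moreover have "S \<cong> ?R" using ST alg_semigroup.is_iso_sym[OF R.alg_semigroup_R RT] by (rule iso_trans)
  ultimately show ?thesis by (intro exI conjI)
qed

text \<open>Cases (2), (3) and (4) in one: \<open>{\<one>, a, b}\<close> stands for
  \<open>H\<close>, and \<open>N\<close> selects the case.\<close>

definition is_character_table_semigroup where
  "is_character_table_semigroup S G N a b \<longleftrightarrow> character_table_parameters G N a b \<and>
     (\<forall>\<theta>\<in>iso G G. \<theta> ` {\<one>\<^bsub>G\<^esub>, a, b} = {\<one>\<^bsub>G\<^esub>, a, b}) \<and>
     S \<cong> rees_matrix_semigroup G {1..N} {1..N} (two_valued_matrix \<one>\<^bsub>G\<^esub> a b)"

lemma homogeneous_iff_character_table:
  fixes S :: "('a, 'm) monoid_scheme"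
  assumes fin: "finite (carrier S)" and reg: "regular_semigroup S"
  shows "homogeneous_semigroup S \<longleftrightarrow>
    (\<exists>G :: nat monoid. finite (carrier G) \<and> homogeneous_group G \<and>
      ((\<exists>(I :: nat set) (L :: nat set). finite I \<and> I \<noteq> {} \<and> finite L \<and> L \<noteq> {} \<and>
          S \<cong> G \<times>\<times> rectangular_band I L) \<or>
       (\<exists>N a b. is_character_table_semigroup S G N a b)))"
    (is "_ \<longleftrightarrow> (\<exists>G. ?fin G \<and> ?hom G \<and> (?band G \<or> ?table G))")
proof
  assume "homogeneous_semigroup S"
  then obtain G :: "nat monoid" and I L P e where "homogeneous_rees_matrix G I L P e e"
    and SR: "S \<cong> rees_matrix_semigroup G (I :: nat set) (L :: nat set) P"
    using homogeneous_regular_rees_coordinates[OF fin reg] by blast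
  then interpret homogeneous_rees_matrix G I L P e e by simp
  have "?band G \<or> ?table G"
  proof (cases "\<forall>l\<in>L. \<forall>i\<in>I. P l i = \<one>\<^bsub>G\<^esub>")
    case True
    then have "R \<cong> G \<times>\<times> rectangular_band I L"
      by (intro trivial_matrix_iso is_group) simp
    then have "S \<cong> G \<times>\<times> rectangular_band I L" using SR iso_trans by blast
    then show ?thesis using finite_I finite_L base by blast
  next
    case False
    then obtain l0 i0 where nt: "l0 \<in> L" "i0 \<in> I" "P l0 i0 \<noteq> \<one>\<^bsub>G\<^esub>" by blast
    have "?table G"
    proof (rule nontrivial_classification[OF nt])
      fix N a b f g
      assume N: "character_table_parameters G N a b" and f: "bij_betw f {1..N} I"
        and g: "bij_betw g {1..N} L"
        and P: "\<And>l i. l \<in> {1..N} \<Longrightarrow> i \<in> {1..N} \<Longrightarrow> P (g l) (f i) = two_valued_matrix \<one>\<^bsub>G\<^esub> a b l i"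
        and inv: "\<And>\<theta>. \<theta> \<in> iso G G \<Longrightarrow> \<theta> ` {\<one>\<^bsub>G\<^esub>, a, b} = {\<one>\<^bsub>G\<^esub>, a, b}"
      let ?M = "rees_matrix_semigroup G {1..N} {1..N} (two_valued_matrix \<one>\<^bsub>G\<^esub> a b)"
      interpret M: character_table_matrix G N a b
        using N finite_G by unfold_locales
      have "R \<cong> ?M"
        using M.alg_semigroup_R rees_relabelling_iso[where P = P, OF f g P] by (rule alg_semigroup.is_iso_sym)
      with SR have "S \<cong> ?M" by (rule iso_trans)
      with N inv show ?thesis unfolding is_character_table_semigroup_def by blast
    qed
    then show ?thesis by simp
  qed
  then show "\<exists>G. ?fin G \<and> ?hom G \<and> (?band G \<or> ?table G)"
    using finite_G homogeneous_group_G by blast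
next
  assume "\<exists>G. ?fin G \<and> ?hom G \<and> (?band G \<or> ?table G)"
  then obtain G where finG: "?fin G" and homG: "?hom G" and disj: "?band G \<or> ?table G"
    by (elim exE conjE)
  have S: "alg_semigroup S" using reg by (simp add: regular_semigroup_def)
  interpret group G using homG by (simp add: homogeneous_group_def)
  from disj show "homogeneous_semigroup S"
  proof
    assume "?band G"
    then obtain I L :: "nat set" where IL: "finite I" "I \<noteq> {}" "finite L" "L \<noteq> {}"
      and SB: "S \<cong> G \<times>\<times> rectangular_band I L" by (elim exE conjE)
    let ?P = "\<lambda>l i. \<one>\<^bsub>G\<^esub>"
    obtain i1 l1 where "i1 \<in> I" "l1 \<in> L" using IL by blast
    then interpret R: rees_matrix G I L ?P i1 l1
      using finG IL by unfold_locales (auto simp: normalised_matrix_def matrix_over_def)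
    have "R.R \<cong> G \<times>\<times> rectangular_band I L"
      using is_group by (rule trivial_matrix_iso) (rule refl)
    then have "G \<times>\<times> rectangular_band I L \<cong> R.R"
      by (rule alg_semigroup.is_iso_sym[OF R.alg_semigroup_R])
    with SB have "S \<cong> R.R" by (rule iso_trans)
    moreover have "homogeneous_semigroup R.R"
      using homG by (rule R.trivial_matrix_homogeneous) (rule refl)
    ultimately show ?thesis using R.finite_R S by (rule homogeneous_semigroup_iso)
  next
    assume "?table G"
    then obtain N a b where N: "character_table_parameters G N a b"
      and inv: "\<forall>\<theta>\<in>iso G G. \<theta> ` {\<one>\<^bsub>G\<^esub>, a, b} = {\<one>\<^bsub>G\<^esub>, a, b}"
      and SR: "S \<cong> rees_matrix_semigroup G {1..N} {1..N} (two_valued_matrix \<one>\<^bsub>G\<^esub> a b)"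
      unfolding is_character_table_semigroup_def by blast
    interpret M: character_table_matrix G N a b
      using N finG by unfold_locales
    have "homogeneous_semigroup M.R"
      using homG by (rule M.homogeneous_semigroup_M) (use inv in blast)
    with SR show ?thesis using M.finite_R S by (rule homogeneous_semigroup_iso)
  qed
qed

text \<open>The base indices and the matching are in arbitrary position in the statement;
  renumbering brings them to 1 and to the diagonal.\<close>

lemma canonical_rees_iso:
  assumes "group G" "finite (carrier G)" and P: "normalised_matrix G {1..N} {1..N} i1 l1 P"
    and ct: "character_table_parameters G N a b"
    and m: "\<exists>m. bij_betw m ({1..N} - {l1}) ({1..N} - {i1}) \<and>
      (\<forall>x\<in>{1..N} - {l1}. \<forall>y\<in>{1..N} - {l1}. P y (m x) = (if y = x then b else a))"
  shows "rees_matrix_semigroup G {1..N} {1..N} P \<cong>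
    rees_matrix_semigroup G {1..N} {1..N} (two_valued_matrix \<one>\<^bsub>G\<^esub> a b)"
proof -
  interpret group G by fact
  interpret M: character_table_matrix G N a b
    using ct assms(2) by unfold_locales
  obtain m where m: "bij_betw m ({1..N} - {l1}) ({1..N} - {i1})"
    "\<And>x y. x \<in> {1..N} - {l1} \<Longrightarrow> y \<in> {1..N} - {l1} \<Longrightarrow> P y (m x) = (if y = x then b else a)"
    using m by blast
  have b: "l1 \<in> {1..N}" "i1 \<in> {1..N}" "\<And>i. i \<in> {1..N} \<Longrightarrow> P l1 i = \<one>\<^bsub>G\<^esub>"
    "\<And>l. l \<in> {1..N} \<Longrightarrow> P l i1 = \<one>\<^bsub>G\<^esub>"
    using P by (auto simp: normalised_matrix_def)
  obtain f g where fg: "bij_betw f {1..N} {1..N}" "bij_betw g {1..N} {1..N}"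
    "\<forall>l\<in>{1..N}. \<forall>i\<in>{1..N}. P (g l) (f i) = two_valued_matrix \<one>\<^bsub>G\<^esub> a b l i"
    using canonical_relabelling[of "{1..N}" l1 i1 "{1..N}" m P b a "\<one>\<^bsub>G\<^esub>", OF _ b(1,2) m b(3,4)]
    by auto
  have "M.R \<cong> rees_matrix_semigroup G {1..N} {1..N} P"
    by (rule rees_relabelling_iso[OF fg(1,2)]) (use fg(3) in blast)
  then show ?thesis by (rule alg_semigroup.is_iso_sym[OF M.alg_semigroup_R])
qed

lemma canonical_matching:
  shows "\<exists>m. bij_betw m ({1..N} - {1}) ({1..N} - {1}) \<and>
      (\<forall>x\<in>{1..N} - {1}. \<forall>y\<in>{1..N} - {1}. two_valued_matrix u a b y (m x) = (if y = x then b else a))"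
  by (rule exI[of _ id]) (auto simp: two_valued_matrix_def)

theorem mainTheorem3:
  fixes S :: "('a, 'm) monoid_scheme"
  assumes "finite (carrier S)" and "regular_semigroup S"
  shows "homogeneous_semigroup S \<longleftrightarrow>
    (\<exists>(G :: nat monoid) H.
       finite (carrier G) \<and> homogeneous_group G \<and> characteristic_subgroup H G \<and>
       ((\<exists>(I :: nat set) (L :: nat set).
           finite I \<and> I \<noteq> {} \<and> finite L \<and> L \<noteq> {} \<and>
           S \<cong> G \<times>\<times> rectangular_band I L)
      \<or> (\<exists>(P :: nat \<Rightarrow> nat \<Rightarrow> nat) i1 l1 a.
           normalised_matrix G {1..2} {1..2} i1 l1 P \<and>
           H = {\<one>\<^bsub>G\<^esub>, a} \<and> G\<lparr>carrier := H\<rparr> \<cong> integer_mod_group 2 \<and>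
           (\<forall>l \<in> {1..2} - {l1}. \<forall>i \<in> {1..2} - {i1}. P l i = a) \<and>
           S \<cong> rees_matrix_semigroup G {1..2} {1..2} P)
      \<or> (\<exists>(P :: nat \<Rightarrow> nat \<Rightarrow> nat) i1 l1 a.
           normalised_matrix G {1..3} {1..3} i1 l1 P \<and>
           H = {\<one>\<^bsub>G\<^esub>, a, inv\<^bsub>G\<^esub> a} \<and> G\<lparr>carrier := H\<rparr> \<cong> integer_mod_group 3 \<and>
           edge_coloured_by (sandwich_graph {1..3} {1..3} i1 l1 P) {a, inv\<^bsub>G\<^esub> a} \<and>
           perfect_matching (sandwich_graph {1..3} {1..3} i1 l1 P)
             (edges_of_colour (sandwich_graph {1..3} {1..3} i1 l1 P) a) \<and>
           S \<cong> rees_matrix_semigroup G {1..3} {1..3} P)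
      \<or> (\<exists>(P :: nat \<Rightarrow> nat \<Rightarrow> nat) i1 l1 a.
           normalised_matrix G {1..4} {1..4} i1 l1 P \<and>
           H = {\<one>\<^bsub>G\<^esub>, a} \<and> G\<lparr>carrier := H\<rparr> \<cong> integer_mod_group 2 \<and>
           edge_coloured_by (sandwich_graph {1..4} {1..4} i1 l1 P) {\<one>\<^bsub>G\<^esub>, a} \<and>
           perfect_matching (sandwich_graph {1..4} {1..4} i1 l1 P)
             (edges_of_colour (sandwich_graph {1..4} {1..4} i1 l1 P) \<one>\<^bsub>G\<^esub>) \<and>
           S \<cong> rees_matrix_semigroup G {1..4} {1..4} P)))"
  (is "_ \<longleftrightarrow> (\<exists>G H. ?fin G \<and> ?hom G \<and> characteristic_subgroup H G \<and>
      (?band G \<or> ?two G H \<or> ?three G H \<or> ?four G H))")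
  unfolding homogeneous_iff_character_table[OF assms]
proof (intro iff_exI iffI)
  fix G :: "nat monoid"
    assume *: "?fin G \<and> ?hom G \<and> (?band G \<or> (\<exists>N a b. is_character_table_semigroup S G N a b))"
    then have fin: "?fin G" and hom: "?hom G" by simp_all
    from hom interpret group G by (simp add: homogeneous_group_def)
    have "\<exists>H. characteristic_subgroup H G \<and> (?band G \<or> ?two G H \<or> ?three G H \<or> ?four G H)"
    proof (cases "?band G")
      case True
      \<comment> \<open>The trivial subgroup is characteristic in every group, so it can serve as
        \<open>H\<close>.\<close>
      have "characteristic_subgroup {\<one>\<^bsub>G\<^esub>} G"
        by (auto simp: characteristic_subgroup_def triv_subgroup iso_def hom_one)
      with True show ?thesis by blast
    next
      case False
      with * obtain N a b where ct: "character_table_parameters G N a b"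
        and inv: "\<forall>\<theta>\<in>iso G G. \<theta> ` {\<one>\<^bsub>G\<^esub>, a, b} = {\<one>\<^bsub>G\<^esub>, a, b}"
        and SM: "S \<cong> rees_matrix_semigroup G {1..N} {1..N} (two_valued_matrix \<one>\<^bsub>G\<^esub> a b)"
        unfolding is_character_table_semigroup_def by blast
      interpret M: character_table_matrix G N a b
        using ct fin by unfold_locales
      note norm = M.normalised
      have aG: "a \<in> carrier G" "a \<noteq> \<one>\<^bsub>G\<^esub>" using M.a_not_one by auto
      consider "N = 2" "b = a" "a \<otimes>\<^bsub>G\<^esub> a = \<one>\<^bsub>G\<^esub>" | "N = 3" "b = inv\<^bsub>G\<^esub> a" "a \<otimes>\<^bsub>G\<^esub> a = inv\<^bsub>G\<^esub> a"
        | "N = 4" "b = \<one>\<^bsub>G\<^esub>" "a \<otimes>\<^bsub>G\<^esub> a = \<one>\<^bsub>G\<^esub>"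
        using ct by (auto simp: character_table_parameters_def)
      then show ?thesis
      proof cases
        case 1
        let ?H = "{\<one>\<^bsub>G\<^esub>, a}"
        have H: "subgroup ?H G" "G\<lparr>carrier := ?H\<rparr> \<cong> integer_mod_group 2"
          using order_two_iff[of a] aG 1 by auto
        have "characteristic_subgroup ?H G" using H inv 1 by (simp add: characteristic_subgroup_def)
        moreover have "\<forall>l\<in>{1..2} - {1}. \<forall>i\<in>{1..2} - {1}. two_valued_matrix \<one>\<^bsub>G\<^esub> a b l i = a"
          using 1 by (auto simp: two_valued_matrix_def)
        then have "?two G ?H"
          using norm SM H(2) unfolding 1(1)
          by (intro exI[of _ "two_valued_matrix \<one>\<^bsub>G\<^esub> a b"] exI[of _ 1] exI[of _ a] conjI refl)
        ultimately show ?thesis by blast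
      next
        case 2
        \<comment> \<open>In the statement \<open>a\<close> is the colour of the matching, which is
          \<open>b\<close> in \<open>two_valued_matrix\<close>; so \<open>b\<close> is the witness
          for \<open>a\<close>, and \<open>H\<close> is written accordingly.\<close>
        let ?H = "{\<one>\<^bsub>G\<^esub>, b, inv\<^bsub>G\<^esub> b}"
        have b: "b \<noteq> \<one>\<^bsub>G\<^esub>" "b \<otimes>\<^bsub>G\<^esub> b = inv\<^bsub>G\<^esub> b" "inv\<^bsub>G\<^esub> b = a" "a \<noteq> b"
          using 2 aG inv_mult_group[of a a] by auto
        then have H: "subgroup ?H G" "G\<lparr>carrier := ?H\<rparr> \<cong> integer_mod_group 3"
          using order_three_iff[of b] by auto
        have "characteristic_subgroup ?H G"
          using H inv b by (simp add: characteristic_subgroup_def insert_commute)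
        moreover have "?three G ?H"
          using norm SM H perfect_matching_sandwich_graph_iff[THEN iffD2, OF b(4) canonical_matching]
          unfolding 2(1) b(3) insert_commute[of a b "{}"]
          by (intro exI[of _ "two_valued_matrix \<one>\<^bsub>G\<^esub> a b"] exI[of _ 1] exI[of _ b] conjI) (simp_all only: b(3))
        ultimately show ?thesis by blast
      next
        case 3
        let ?H = "{\<one>\<^bsub>G\<^esub>, a}"
        have H: "subgroup ?H G" "G\<lparr>carrier := ?H\<rparr> \<cong> integer_mod_group 2"
          using order_two_iff[of a] aG 3 by auto
        have "characteristic_subgroup ?H G"
          using H inv 3 by (simp add: characteristic_subgroup_def insert_commute)
        moreover have "?four G ?H"
          using norm SM H perfect_matching_sandwich_graph_iff[THEN iffD2, OF aG(2) canonical_matching]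
          unfolding 3(1,2) insert_commute[of a "\<one>\<^bsub>G\<^esub>" "{}"]
          by (intro exI[of _ "two_valued_matrix \<one>\<^bsub>G\<^esub> a \<one>\<^bsub>G\<^esub>"] exI[of _ 1] exI[of _ a] conjI refl) simp_all
        ultimately show ?thesis by blast
      qed
    qed
    then obtain H where "characteristic_subgroup H G" "?band G \<or> ?two G H \<or> ?three G H \<or> ?four G H"
      by (elim exE conjE)
    with fin hom show "\<exists>H. ?fin G \<and> ?hom G \<and> characteristic_subgroup H G \<and>
      (?band G \<or> ?two G H \<or> ?three G H \<or> ?four G H)" by (intro exI[of _ H] conjI)
  next
    fix G :: "nat monoid"
    assume "\<exists>H. ?fin G \<and> ?hom G \<and> characteristic_subgroup H G \<and>
      (?band G \<or> ?two G H \<or> ?three G H \<or> ?four G H)"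
    then obtain H where *: "?fin G" "?hom G" and "characteristic_subgroup H G"
      and disj: "?band G \<or> ?two G H \<or> ?three G H \<or> ?four G H"
      by (elim exE conjE)
    then have H: "subgroup H G" "\<forall>\<theta>\<in>iso G G. \<theta> ` H = H"
      by (simp_all add: characteristic_subgroup_def)
    interpret group G using *(2) by (simp add: homogeneous_group_def)
    have HG: "h \<in> carrier G" if "h \<in> H" for h using H(1) that by (rule subgroup.mem_carrier)
    from disj have "?band G \<or> (\<exists>N a b. is_character_table_semigroup S G N a b)"
    proof (elim disjE)
      assume "?two G H"
      then obtain P :: "nat \<Rightarrow> nat \<Rightarrow> nat" and i1 l1 a where P: "normalised_matrix G {1..2} {1..2} i1 l1 P"
        and Ha: "H = {\<one>\<^bsub>G\<^esub>, a}" "G\<lparr>carrier := H\<rparr> \<cong> integer_mod_group 2"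
        and Pa: "\<forall>l \<in> {1..2} - {l1}. \<forall>i \<in> {1..2} - {i1}. P l i = a"
        and SP: "S \<cong> rees_matrix_semigroup G {1..2} {1..2} P"
        by (elim exE conjE)
      have aG: "a \<in> carrier G" using HG Ha by simp
      then have "a \<noteq> \<one>\<^bsub>G\<^esub>" "a \<otimes>\<^bsub>G\<^esub> a = \<one>\<^bsub>G\<^esub>" using order_two_iff[of a] H(1) Ha by auto
      with aG have ct: "character_table_parameters G 2 a a" by (simp add: character_table_parameters_def)
      have "i1 \<in> {1, 2}" "l1 \<in> {1, 2}" using P by (auto simp: normalised_matrix_def)
      \<comment> \<open>With two indices, \<open>3 - i1\<close> and \<open>3 - l1\<close> are the
        ones off the base.\<close>
      then have "{1..2} - {i1} = {3 - i1}" "{1..2} - {l1} = {3 - l1}" by auto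
      then have "\<exists>m. bij_betw m ({1..2} - {l1}) ({1..2} - {i1}) \<and>
        (\<forall>x\<in>{1..2} - {l1}. \<forall>y\<in>{1..2} - {l1}. P y (m x) = (if y = x then a else a))"
        using Pa by (intro exI[of _ "\<lambda>_. 3 - i1"]) (simp add: bij_betw_def)
      then have "S \<cong> rees_matrix_semigroup G {1..2} {1..2} (two_valued_matrix \<one>\<^bsub>G\<^esub> a a)"
        by (rule iso_trans[OF SP canonical_rees_iso[OF is_group *(1) P ct]])
      then have "is_character_table_semigroup S G 2 a a" unfolding is_character_table_semigroup_def using ct H(2) Ha(1) by simp
      then show ?thesis by (intro disjI2 exI)
    next
      assume "?three G H"
      then obtain P :: "nat \<Rightarrow> nat \<Rightarrow> nat" and i1 l1 a where P: "normalised_matrix G {1..3} {1..3} i1 l1 P"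
        and Ha: "H = {\<one>\<^bsub>G\<^esub>, a, inv\<^bsub>G\<^esub> a}" "G\<lparr>carrier := H\<rparr> \<cong> integer_mod_group 3"
        and Pa: "edge_coloured_by (sandwich_graph {1..3} {1..3} i1 l1 P) {a, inv\<^bsub>G\<^esub> a}"
          "perfect_matching (sandwich_graph {1..3} {1..3} i1 l1 P)
             (edges_of_colour (sandwich_graph {1..3} {1..3} i1 l1 P) a)"
        and SP: "S \<cong> rees_matrix_semigroup G {1..3} {1..3} P"
        by (elim exE conjE)
      let ?b = "inv\<^bsub>G\<^esub> a"
      have aG: "a \<in> carrier G" using HG Ha by simp
      then have a: "a \<noteq> \<one>\<^bsub>G\<^esub>" "a \<otimes>\<^bsub>G\<^esub> a = ?b" using order_three_iff[of a] H(1) Ha by auto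
      then have b: "?b \<noteq> \<one>\<^bsub>G\<^esub>" "?b \<otimes>\<^bsub>G\<^esub> ?b = a" "?b \<noteq> a"
        using aG inv_mult_group[of a a] l_cancel_one[of a a] by auto
      \<comment> \<open>The colour \<open>a\<close> of the matching is the last parameter, so its
        inverse takes the place of the other value.\<close>
      have ct: "character_table_parameters G 3 ?b a"
        using b aG by (simp add: character_table_parameters_def)
      have "\<exists>m. bij_betw m ({1..3} - {l1}) ({1..3} - {i1}) \<and>
        (\<forall>x\<in>{1..3} - {l1}. \<forall>y\<in>{1..3} - {l1}. P y (m x) = (if y = x then a else ?b))"
        using Pa perfect_matching_sandwich_graph_iff[OF b(3), of "{1..3}" "{1..3}" i1 l1 P]
        unfolding insert_commute[of a ?b "{}"] by blast
      then have "S \<cong> rees_matrix_semigroup G {1..3} {1..3} (two_valued_matrix \<one>\<^bsub>G\<^esub> ?b a)"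
        by (rule iso_trans[OF SP canonical_rees_iso[OF is_group *(1) P ct]])
      then have "is_character_table_semigroup S G 3 ?b a" unfolding is_character_table_semigroup_def using ct H(2) Ha(1) by (simp add: insert_commute)
      then show ?thesis by (intro disjI2 exI)
    next
      assume "?four G H"
      then obtain P :: "nat \<Rightarrow> nat \<Rightarrow> nat" and i1 l1 a where P: "normalised_matrix G {1..4} {1..4} i1 l1 P"
        and Ha: "H = {\<one>\<^bsub>G\<^esub>, a}" "G\<lparr>carrier := H\<rparr> \<cong> integer_mod_group 2"
        and Pa: "edge_coloured_by (sandwich_graph {1..4} {1..4} i1 l1 P) {\<one>\<^bsub>G\<^esub>, a}"
          "perfect_matching (sandwich_graph {1..4} {1..4} i1 l1 P)
             (edges_of_colour (sandwich_graph {1..4} {1..4} i1 l1 P) \<one>\<^bsub>G\<^esub>)"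
        and SP: "S \<cong> rees_matrix_semigroup G {1..4} {1..4} P"
        by (elim exE conjE)
      have aG: "a \<in> carrier G" using HG Ha by simp
      then have a: "a \<noteq> \<one>\<^bsub>G\<^esub>" "a \<otimes>\<^bsub>G\<^esub> a = \<one>\<^bsub>G\<^esub>" using order_two_iff[of a] H(1) Ha by auto
      with aG have ct: "character_table_parameters G 4 a \<one>\<^bsub>G\<^esub>"
        by (simp add: character_table_parameters_def)
      have "\<exists>m. bij_betw m ({1..4} - {l1}) ({1..4} - {i1}) \<and>
        (\<forall>x\<in>{1..4} - {l1}. \<forall>y\<in>{1..4} - {l1}. P y (m x) = (if y = x then \<one>\<^bsub>G\<^esub> else a))"
        using Pa perfect_matching_sandwich_graph_iff[OF a(1), of "{1..4}" "{1..4}" i1 l1 P]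
        unfolding insert_commute[of a "\<one>\<^bsub>G\<^esub>" "{}"] by blast
      then have "S \<cong> rees_matrix_semigroup G {1..4} {1..4} (two_valued_matrix \<one>\<^bsub>G\<^esub> a \<one>\<^bsub>G\<^esub>)"
        by (rule iso_trans[OF SP canonical_rees_iso[OF is_group *(1) P ct]])
      then have "is_character_table_semigroup S G 4 a \<one>\<^bsub>G\<^esub>" unfolding is_character_table_semigroup_def using ct H(2) Ha(1) by (simp add: insert_commute)
      then show ?thesis by (intro disjI2 exI)
    qed simp
    with * show "?fin G \<and> ?hom G \<and> (?band G \<or> (\<exists>N a b. is_character_table_semigroup S G N a b))" by (intro conjI)
qed

end
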